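(* Let $\Omega$ be a bounded domain in $\mathbb{R}^{2n}$. Let $\vec F\in W^{1,2}(\Omega)$ be a vector field satisfying $\operatorname{div}\vec F^{\ast}>0$ (a.e.) in $\Omega$. Suppose $u,v\in W^{1,2}(\Omega)$ satisfy $$\operatorname{div}N(u)\ge\operatorname{div}N(v)\ \text{ in }\Omega\ \text{(in the weak sense)},\qquad u\le v\ \text{ on }\partial\Omega.$$ Then $u\le v$ in $\Omega$.
   Context: For a vector field $\vec G=(g_1,\dots,g_{2n})$ on $\Omega\subset\mathbb{R}^{2n}$, set $\vec G^{\ast}=(g_2,-g_1,g_4,-g_3,\dots,g_{2n},-g_{2n-1})$. For a weakly differentiable $u$, $S(u)=\{\nabla u+\vec F=0\}$ is the singular set and $N(u)=\frac{\nabla u+\vec F}{|\nabla u+\vec F|}$ on $\Omega\setminus S(u)$. "$\operatorname{div}N(u)\ge\operatorname{div}N(v)$ in $\Omega$ in the weak sense" means: for every $\varphi\in W^{1,1}_0(\Omega)$ with $\varphi\ge0$, $$-\int_{S(u)}|\nabla\varphi|+\int_{\Omega\setminus S(u)}N(u)\cdot\nabla\varphi\le\int_{S(v)}|\nabla\varphi|+\int_{\Omega\setminus S(v)}N(v)\cdot\nabla\varphi .$$ "$u\le v$ on $\partial\Omega$" means $(u-v)^+=\max(u-v,0)\in W^{1,1}_0(\Omega)$. Pointwise relations between Sobolev functions are understood almost everywhere. *)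

theory Defs
  imports "HOL-Analysis.Analysis"
begin

text \<open>Sobolev spaces on a set \<open>\<Omega>\<close> of a Euclidean space. Functions are total; only their values on
  \<open>\<Omega>\<close> matter, and only up to Lebesgue null sets.\<close>

fun C_k :: "nat \<Rightarrow> ('a::euclidean_space \<Rightarrow> real) \<Rightarrow> bool" where
  "C_k 0 f \<longleftrightarrow> continuous_on UNIV f"
| "C_k (Suc k) f \<longleftrightarrow>
     (\<forall>x. f differentiable (at x)) \<and>
     (\<forall>i\<in>Basis. C_k k (\<lambda>x. frechet_derivative f (at x) i))"

definition test_fun :: "'a::euclidean_space set \<Rightarrow> ('a \<Rightarrow> real) set" where
  "test_fun \<Omega> = {\<phi>. (\<forall>k. C_k k \<phi>) \<and> compact (closure {x. \<phi> x \<noteq> 0}) \<and> closure {x. \<phi> x \<noteq> 0} \<subseteq> \<Omega>}"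

definition locally_integrable ::
    "'a::euclidean_space set \<Rightarrow> ('a \<Rightarrow> 'b::euclidean_space) \<Rightarrow> bool" where
  "locally_integrable \<Omega> f \<longleftrightarrow> (\<forall>K. compact K \<and> K \<subseteq> \<Omega> \<longrightarrow> integrable (lebesgue_on K) f)"

definition has_weak_grad ::
    "'a::euclidean_space set \<Rightarrow> ('a \<Rightarrow> real) \<Rightarrow> ('a \<Rightarrow> 'a) \<Rightarrow> bool" where
  "has_weak_grad \<Omega> u D \<longleftrightarrow>
     locally_integrable \<Omega> u \<and> locally_integrable \<Omega> D \<and>
     (\<forall>\<phi>\<in>test_fun \<Omega>. \<forall>i\<in>Basis.
        (LINT x|lebesgue_on \<Omega>. u x * frechet_derivative \<phi> (at x) i)
        = - (LINT x|lebesgue_on \<Omega>. (D x \<bullet> i) * \<phi> x))"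

text \<open>The weak gradient is unique up to null sets; one representative is chosen. The value is
  meaningful only if \<open>u\<close> is weakly differentiable on \<open>\<Omega>\<close>.\<close>

definition weak_grad :: "'a::euclidean_space set \<Rightarrow> ('a \<Rightarrow> real) \<Rightarrow> 'a \<Rightarrow> 'a" where
  "weak_grad \<Omega> u = (SOME D. has_weak_grad \<Omega> u D)"

definition in_Lp ::
    "real \<Rightarrow> 'a::euclidean_space set \<Rightarrow> ('a \<Rightarrow> 'b::euclidean_space) \<Rightarrow> bool" where
  "in_Lp p \<Omega> f \<longleftrightarrow>
     f \<in> borel_measurable (lebesgue_on \<Omega>) \<and> integrable (lebesgue_on \<Omega>) (\<lambda>x. norm (f x) powr p)"

definition sobolev :: "real \<Rightarrow> 'a::euclidean_space set \<Rightarrow> ('a \<Rightarrow> real) set" where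
  "sobolev p \<Omega> = {u. in_Lp p \<Omega> u \<and> (\<exists>D. has_weak_grad \<Omega> u D \<and> in_Lp p \<Omega> D)}"

definition sobolev_norm :: "real \<Rightarrow> 'a::euclidean_space set \<Rightarrow> ('a \<Rightarrow> real) \<Rightarrow> real" where
  "sobolev_norm p \<Omega> u =
     ((LINT x|lebesgue_on \<Omega>. norm (u x) powr p)
      + (LINT x|lebesgue_on \<Omega>. norm (weak_grad \<Omega> u x) powr p)) powr (1 / p)"

text \<open>\<open>W\<^sub>0\<close> is the closure of the test functions with respect to the Sobolev norm.\<close>

definition sobolev0 :: "real \<Rightarrow> 'a::euclidean_space set \<Rightarrow> ('a \<Rightarrow> real) set" where
  "sobolev0 p \<Omega> =
     {u \<in> sobolev p \<Omega>. \<forall>\<epsilon>>0. \<exists>\<phi>\<in>test_fun \<Omega>. sobolev_norm p \<Omega> (\<lambda>x. u x - \<phi> x) < \<epsilon>}"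

definition sobolev_field :: "real \<Rightarrow> 'a::euclidean_space set \<Rightarrow> ('a \<Rightarrow> 'a) set" where
  "sobolev_field p \<Omega> = {G. \<forall>i\<in>Basis. (\<lambda>x. G x \<bullet> i) \<in> sobolev p \<Omega>}"

definition weak_div :: "'a::euclidean_space set \<Rightarrow> ('a \<Rightarrow> 'a) \<Rightarrow> 'a \<Rightarrow> real" where
  "weak_div \<Omega> G x = (\<Sum>i\<in>Basis. weak_grad \<Omega> (\<lambda>y. G y \<bullet> i) x \<bullet> i)"

text \<open>\<open>\<real>\<^sup>2\<^sup>n\<close> is rendered as \<open>real ^ ('n \<times> 2)\<close> with \<open>n = CARD('n)\<close>: the coordinates with index
  \<open>(j, 1)\<close> and \<open>(j, 2)\<close> are those numbered \<open>2j - 1\<close> and \<open>2j\<close>.\<close>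

definition star_field ::
    "('a \<Rightarrow> real ^ ('n::finite \<times> 2)) \<Rightarrow> 'a \<Rightarrow> real ^ ('n \<times> 2)" where
  "star_field G x = (\<chi> k. if snd k = 1 then G x $ (fst k, 2) else - G x $ (fst k, 1))"

definition sing_set ::
    "'a::euclidean_space set \<Rightarrow> ('a \<Rightarrow> 'a) \<Rightarrow> ('a \<Rightarrow> real) \<Rightarrow> 'a set" where
  "sing_set \<Omega> F u = {x \<in> \<Omega>. weak_grad \<Omega> u x + F x = 0}"

definition N_field ::
    "'a::euclidean_space set \<Rightarrow> ('a \<Rightarrow> 'a) \<Rightarrow> ('a \<Rightarrow> real) \<Rightarrow> 'a \<Rightarrow> 'a" where
  "N_field \<Omega> F u x = (weak_grad \<Omega> u x + F x) /\<^sub>R norm (weak_grad \<Omega> u x + F x)"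

definition div_N_ge ::
    "'a::euclidean_space set \<Rightarrow> ('a \<Rightarrow> 'a) \<Rightarrow> ('a \<Rightarrow> real) \<Rightarrow> ('a \<Rightarrow> real) \<Rightarrow> bool" where
  "div_N_ge \<Omega> F u v \<longleftrightarrow>
     (\<forall>\<phi>\<in>sobolev0 1 \<Omega>. (AE x in lebesgue_on \<Omega>. \<phi> x \<ge> 0) \<longrightarrow>
        - (LINT x|lebesgue_on (sing_set \<Omega> F u). norm (weak_grad \<Omega> \<phi> x))
        + (LINT x|lebesgue_on (\<Omega> - sing_set \<Omega> F u). N_field \<Omega> F u x \<bullet> weak_grad \<Omega> \<phi> x)
        \<le> (LINT x|lebesgue_on (sing_set \<Omega> F v). norm (weak_grad \<Omega> \<phi> x))
        + (LINT x|lebesgue_on (\<Omega> - sing_set \<Omega> F v). N_field \<Omega> F v x \<bullet> weak_grad \<Omega> \<phi> x))"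

definition le_on_boundary ::
    "'a::euclidean_space set \<Rightarrow> ('a \<Rightarrow> real) \<Rightarrow> ('a \<Rightarrow> real) \<Rightarrow> bool" where
  "le_on_boundary \<Omega> u v \<longleftrightarrow> (\<lambda>x. max (u x - v x) 0) \<in> sobolev0 1 \<Omega>"

end

theory Submission
  imports Defs
begin

text \<open>Write \<open>\<alpha> = \<nabla>u + F\<close> and \<open>\<beta> = \<nabla>v + F\<close>. Testing the weak inequality with \<open>(u - v)\<^sup>+\<close> gives
  \<open>\<bar>\<alpha>\<bar> \<beta> = \<bar>\<beta>\<bar> \<alpha>\<close> almost everywhere on \<open>{u > v}\<close>, so \<open>\<beta>\<^sup>* \<bullet> \<nabla>h(u - v) = 0\<close> for every function \<open>h\<close> of one
  variable that vanishes on the negative half-line. Weakly \<open>div \<beta>\<^sup>* = div F\<^sup>*\<close>, because \<open>(\<nabla>v)\<^sup>*\<close> is divergence free; hence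
  the integral of \<open>h(u - v) div F\<^sup>*\<close> is zero, and \<open>div F\<^sup>* > 0\<close> forces \<open>h(u - v) = 0\<close>.

  The difficulty is to integrate by parts against \<open>h(u - v)\<close>: test functions approximate \<open>(u - v)\<^sup>+\<close> only in
  \<open>W\<^sup>1\<^sup>,\<^sup>1\<close>, whereas the fields \<open>F\<close> and \<open>\<nabla>v\<close> are only square integrable. Truncating \<open>F\<close> and \<open>v\<close> makes the limit
  possible for \<open>F\<close>. For \<open>\<nabla>v\<close>, replace \<open>v\<close> by \<open>v k(u - v)\<close> with a cut-off \<open>k\<close> equal to 1 on the support of
  \<open>h'\<close>; the extension by zero of \<open>h(u - v)\<close> to the whole space has square integrable gradient, so it can be
  mollified there, where second derivatives commute.\<close>

section \<open>Smooth bump functions\<close>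

text \<open>The weak inequality charges singular points with their worst value, yet nothing is lost
  there: where \<alpha> or \<beta> vanishes both integrands agree, and elsewhere they differ by
  \<open>(norm \<alpha> * norm \<beta> - \<alpha> \<bullet> \<beta>) * (1 / norm \<alpha> + 1 / norm
  \<beta>)\<close>, which is zero only for parallel vectors. The star turns each coordinate pair by
  a right angle, so \<open>\<beta>\<^sup>*\<close> is orthogonal to \<beta> and to every multiple of
  it; this makes parallelism an equation for the gradient of u - v. The two cut-offs cannot start at
  the same level: k has to vanish for t \<le> 0, to inherit zero boundary values, and has to equal 1
  already where h' is nonzero. So h starts at a level \<delta> > 0, k climbs from 0 to 1 between 0
  and \<delta>, and \<delta> tends to 0 at the end. The boundary of \<Omega> is arbitrary, so zero
  boundary values enter solely through the compact support of h(\<phi> n) for approximating test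
  functions \<phi> n. Their gradients converge only in L1, hence every factor beside them must be
  bounded at that stage; square integrability acts afterwards, when the truncations are
  removed.\<close>

lemma frechet_derivative_eqI:
  "(f has_derivative f') (at x) \<Longrightarrow> frechet_derivative f (at x) = f'"
  by (metis frechet_derivative_at)

section \<open>Calculus of \<open>C_k\<close> functions\<close>

lemma C_k_const: "C_k k (\<lambda>x. c)"
proof (induction k arbitrary: c)
  case (Suc k)
  then show ?case
    using frechet_derivative_eqI[OF has_derivative_const] by simp
qed simp

text \<open>Above level 0, \<open>C_k\<close> has no continuity clause; in the base case continuity
  comes from differentiability at every point.\<close>

lemma C_k_SucD: "C_k (Suc k) f \<Longrightarrow> C_k k f"
proof (induction k arbitrary: f)
  case 0
  then show ?case
    by (simp add: continuous_at_imp_continuous_on differentiable_imp_continuous_within)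
next
  case (Suc k)
  then show ?case by (meson C_k.simps(2))
qed

lemma C_k_add: "C_k k f \<Longrightarrow> C_k k g \<Longrightarrow> C_k k (\<lambda>x. f x + g x)"
proof (induction k arbitrary: f g)
  case 0
  then show ?case by (simp add: continuous_on_add)
next
  case (Suc k)
  have "frechet_derivative (\<lambda>x. f x + g x) (at x)
      = (\<lambda>i. frechet_derivative f (at x) i + frechet_derivative g (at x) i)" for x
    using Suc.prems by (intro frechet_derivative_eqI has_derivative_add) (auto simp: frechet_derivative_works)
  with Suc show ?case by (auto intro!: Suc.IH)
qed

lemma frechet_derivative_mult:
  fixes f g :: "'a::real_normed_vector \<Rightarrow> real"
  assumes "f differentiable (at x)" "g differentiable (at x)"
  shows "frechet_derivative (\<lambda>x. f x * g x) (at x)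
      = (\<lambda>i. f x * frechet_derivative g (at x) i + frechet_derivative f (at x) i * g x)"
  using assms by (intro frechet_derivative_eqI has_derivative_mult) (auto simp: frechet_derivative_works)

lemma C_k_mult: "C_k k f \<Longrightarrow> C_k k g \<Longrightarrow> C_k k (\<lambda>x. f x * g x)"
proof (induction k arbitrary: f g)
  case 0
  then show ?case by (simp add: continuous_on_mult)
next
  case (Suc k)
  have "C_k k (\<lambda>x. f x * frechet_derivative g (at x) i + frechet_derivative f (at x) i * g x)"
    if "i \<in> Basis" for i
    using Suc.prems that by (intro C_k_add Suc.IH C_k_SucD[of k f] C_k_SucD[of k g]) auto
  with Suc.prems show ?case
    by (simp add: frechet_derivative_mult)
qed

text \<open>Serves the kernels \<open>mollifier n (x - y)\<close>, which have to be test functions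
  in the variable y.\<close>

lemma C_k_reflect:
  fixes f :: "'a::euclidean_space \<Rightarrow> real"
  shows "C_k k f \<Longrightarrow> C_k k (\<lambda>y. f (x - y))"
proof (induction k arbitrary: f)
  case 0
  then show ?case
    by (auto intro!: continuous_intros continuous_on_compose2[of UNIV f])
next
  case (Suc k)
  have D: "((\<lambda>y. f (x - y)) has_derivative (\<lambda>i. frechet_derivative f (at (x - y)) (- i))) (at y)" for y
  proof (rule has_derivative_compose[of "\<lambda>y. x - y" "\<lambda>i. - i" y UNIV f, simplified])
    show "((-) x has_derivative uminus) (at y)"
      by (auto intro!: derivative_eq_intros)
    show "(f has_derivative frechet_derivative f (at (x - y))) (at (x - y))"
      using Suc.prems by (simp add: frechet_derivative_works)
  qed
  have neg: "frechet_derivative f (at (x - y)) (- i) = (-1) * frechet_derivative f (at (x - y)) i" for y i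
    using Suc.prems by (simp add: linear_frechet_derivative linear_neg)
  have "C_k k (\<lambda>y. (-1) * frechet_derivative f (at (x - y)) i)" if "i \<in> Basis" for i
    using Suc.prems that by (intro C_k_mult C_k_const Suc.IH) auto
  with D show ?case
    by (auto simp: frechet_derivative_eqI[OF D] neg differentiable_def)
qed

section \<open>The flat function exp(-1/t) and its derivatives\<close>

text \<open>The polynomial parameter closes the family under differentiation: all derivatives of
  exp(-1/t) are polynomials in 1/t times exp(-1/t). Smoothness is then an induction with
  \<open>p\<close> arbitrary, and no higher derivative is ever written out.\<close>

definition exp_bump :: "real poly \<Rightarrow> real \<Rightarrow> real" where
  "exp_bump p t = (if t > 0 then poly p (1 / t) * exp (- (1 / t)) else 0)"

text \<open>In the variable s = 1/t the operator d/dt is -s^2 d/ds, which sends p(s) exp(-s) to s^2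
  (p - p')(s) exp(-s). The two zero coefficients in front are the factor s^2.\<close>

definition exp_bump_step :: "real poly \<Rightarrow> real poly" where
  "exp_bump_step p = pCons 0 (pCons 0 (p - pderiv p))"

lemma poly_exp_decay: "((\<lambda>s. poly p s * exp (- s)) \<longlongrightarrow> 0) (at_top::real filter)"
proof -
  have "((\<lambda>s. \<Sum>i\<le>degree p. coeff p i * (s ^ i / exp s)) \<longlongrightarrow> (\<Sum>i\<le>degree p. coeff p i * 0)) at_top"
    by (intro tendsto_intros tendsto_power_div_exp_0)
  moreover have "(\<lambda>s. \<Sum>i\<le>degree p. coeff p i * (s ^ i / exp s)) = (\<lambda>s. poly p s * exp (- s))"
    by (auto simp: poly_altdef sum_distrib_right exp_minus divide_inverse mult.assoc)
  ultimately show ?thesis by simp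
qed

lemma exp_bump_deriv: "(exp_bump p has_real_derivative exp_bump (exp_bump_step p) t) (at t)"
proof -
  consider "t > 0" | "t < 0" | "t = 0" by linarith
  then show ?thesis
  proof cases
    case 1
    have "((\<lambda>t. poly p (1 / t) * exp (- (1 / t))) has_real_derivative
        exp_bump (exp_bump_step p) t) (at t)"
      using 1 by (auto intro!: derivative_eq_intros simp: exp_bump_def exp_bump_step_def field_simps power2_eq_square)
    then show ?thesis
      by (rule has_field_derivative_transform_within[where d = t]) (use 1 in \<open>auto simp: exp_bump_def dist_real_def\<close>)
  next
    case 2
    have "((\<lambda>t. 0) has_real_derivative exp_bump (exp_bump_step p) t) (at t)"
      using 2 by (auto simp: exp_bump_def)
    then show ?thesis
      by (rule has_field_derivative_transform_within[where d = "-t"]) (use 2 in \<open>auto simp: exp_bump_def dist_real_def\<close>)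
  next
    case 3
    \<comment> \<open>From the right, the difference quotient at 0 is s p(s) exp(-s) with s = 1/y;
      \<open>pCons 0 p\<close> absorbs the extra factor s, and exponential decay wins.\<close>
    have "((\<lambda>y. poly (pCons 0 p) (inverse y) * exp (- inverse y)) \<longlongrightarrow> 0) (at_right (0::real))"
      using filterlim_compose[OF poly_exp_decay filterlim_inverse_at_top_right] .
    then have R: "((\<lambda>y. exp_bump p y / y) \<longlongrightarrow> 0) (at_right 0)"
      by (rule tendsto_cong[THEN iffD1, rotated])
         (auto simp: exp_bump_def eventually_at_filter field_simps)
    have L: "((\<lambda>y. exp_bump p y / y) \<longlongrightarrow> 0) (at_left 0)"
      by (rule tendsto_eventually) (auto simp: exp_bump_def eventually_at_filter)
    have "((\<lambda>y. exp_bump p y / y) \<longlongrightarrow> 0) (at 0)"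
      using L R by (simp add: filterlim_split_at)
    with 3 show ?thesis
      by (simp add: has_field_derivative_iff exp_bump_def)
  qed
qed

lemma exp_bump_affine_deriv:
  fixes v :: "'a::euclidean_space"
  shows "((\<lambda>x. exp_bump p (d + x \<bullet> v)) has_derivative
    (\<lambda>i. exp_bump (exp_bump_step p) (d + x \<bullet> v) * (i \<bullet> v))) (at x)"
proof -
  have "((\<lambda>x. d + x \<bullet> v) has_derivative (\<lambda>i. i \<bullet> v)) (at x)"
    by (auto intro!: derivative_eq_intros)
  from has_derivative_compose[OF this exp_bump_deriv[unfolded has_field_derivative_def]]
  show ?thesis by simp
qed

lemma C_k_exp_bump:
  fixes v :: "'a::euclidean_space"
  shows "C_k k (\<lambda>x. exp_bump p (d + x \<bullet> v))"
proof (induction k arbitrary: p)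
  case 0
  have "continuous_on UNIV (exp_bump p)"
    using exp_bump_deriv by (meson DERIV_isCont continuous_at_imp_continuous_on)
  then show ?case
    by (auto intro!: continuous_intros continuous_on_compose2[of UNIV "exp_bump p"])
next
  case (Suc k)
  then show ?case
    by (auto simp: frechet_derivative_eqI[OF exp_bump_affine_deriv] differentiable_def
        intro!: C_k_mult C_k_const exp_bump_affine_deriv)
qed

section \<open>Symmetry of second partial derivatives\<close>

text \<open>Equality of mixed partials is carried along as a property of explicit functions: it is
  visible for functions of one affine form and passes to products, which is how the kernels are
  built. Its purpose is to exchange two derivatives that both fall on a mollifier.\<close>

definition sym_partials :: "('a::euclidean_space \<Rightarrow> real) \<Rightarrow> bool" where
  "sym_partials f \<longleftrightarrow> (\<forall>k. C_k k f) \<and> (\<forall>i\<in>Basis. \<forall>j\<in>Basis. \<forall>x.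
     frechet_derivative (\<lambda>y. frechet_derivative f (at y) i) (at x) j
     = frechet_derivative (\<lambda>y. frechet_derivative f (at y) j) (at x) i)"

lemma C_k_diffD: "(\<And>k. C_k k f) \<Longrightarrow> f differentiable (at x)"
  and C_k_partialD: "(\<And>k. C_k k f) \<Longrightarrow> i \<in> Basis \<Longrightarrow> C_k m (\<lambda>x. frechet_derivative f (at x) i)"
  using C_k.simps(2) by blast+

lemma sym_partials_mult:
  assumes "sym_partials f" "sym_partials g"
  shows "sym_partials (\<lambda>x. f x * g x)"
proof -
  have f: "\<And>k. C_k k f" and g: "\<And>k. C_k k g" using assms by (auto simp: sym_partials_def)
  note C_k_diffD[OF f, simp] C_k_diffD[OF g, simp]
  have df[simp]: "(\<lambda>x. frechet_derivative f (at x) i) differentiable (at x)" if "i \<in> Basis" for i x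
    using C_k_diffD[OF C_k_partialD[OF f that]] .
  have dg[simp]: "(\<lambda>x. frechet_derivative g (at x) i) differentiable (at x)" if "i \<in> Basis" for i x
    using C_k_diffD[OF C_k_partialD[OF g that]] .
  \<comment> \<open>Of the four terms, the outer two are symmetric by assumption and the two mixed
    products of first partials change places when i and j are swapped.\<close>
  have "frechet_derivative (\<lambda>y. frechet_derivative (\<lambda>x. f x * g x) (at y) i) (at x) j
     = f x * frechet_derivative (\<lambda>y. frechet_derivative g (at y) i) (at x) j
       + frechet_derivative f (at x) j * frechet_derivative g (at x) i
       + (frechet_derivative f (at x) i * frechet_derivative g (at x) j
       + frechet_derivative (\<lambda>y. frechet_derivative f (at y) i) (at x) j * g x)"
    if "i \<in> Basis" for i j x
  proof -
    have "((\<lambda>y. f y * frechet_derivative g (at y) i + frechet_derivative f (at y) i * g y)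
      has_derivative (\<lambda>j. (f x * frechet_derivative (\<lambda>y. frechet_derivative g (at y) i) (at x) j
       + frechet_derivative f (at x) j * frechet_derivative g (at x) i)
       + (frechet_derivative f (at x) i * frechet_derivative g (at x) j
       + frechet_derivative (\<lambda>y. frechet_derivative f (at y) i) (at x) j * g x))) (at x)"
      using that by (intro has_derivative_add has_derivative_mult)
        (auto simp: frechet_derivative_works[symmetric])
    then show ?thesis
      by (simp add: frechet_derivative_mult frechet_derivative_eqI)
  qed
  with assms f g show ?thesis
    unfolding sym_partials_def by (auto intro!: C_k_mult simp: algebra_simps)
qed

lemma sym_partials_exp_bump: "sym_partials (\<lambda>x. exp_bump p (d + x \<bullet> v))"
proof -
  have "frechet_derivative (\<lambda>x. exp_bump p (d + x \<bullet> v) * c) (at x) j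
     = exp_bump (exp_bump_step p) (d + x \<bullet> v) * (j \<bullet> v) * c" for p c x j
    by (subst frechet_derivative_eqI[OF has_derivative_mult_left[OF exp_bump_affine_deriv]]) simp
  then show ?thesis
    by (auto simp: sym_partials_def C_k_exp_bump frechet_derivative_eqI[OF exp_bump_affine_deriv])
qed

lemma sym_partials_const: "sym_partials (\<lambda>x. c)"
  by (simp add: sym_partials_def C_k_const frechet_derivative_eqI[OF has_derivative_const])

lemma sym_partials_prod: "finite A \<Longrightarrow> (\<And>a. a \<in> A \<Longrightarrow> sym_partials (f a)) \<Longrightarrow> sym_partials (\<lambda>x. \<Prod>a\<in>A. f a x)"
  by (induction A rule: finite_induct) (auto intro: sym_partials_mult sym_partials_const)

text \<open>For c > 0 this is positive exactly on the open cube of half-side 1/c. A cube instead of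
  a ball keeps each factor a function of one affine form, the shape for which smoothness and
  symmetric partials are established.\<close>

definition bump :: "real \<Rightarrow> 'a::euclidean_space \<Rightarrow> real" where
  "bump c x = (\<Prod>i\<in>Basis. exp_bump 1 (1 + x \<bullet> (c *\<^sub>R i)) * exp_bump 1 (1 + x \<bullet> ((- c) *\<^sub>R i)))"

lemma sym_partials_bump: "sym_partials (bump c)"
  unfolding bump_def[abs_def] by (intro sym_partials_prod sym_partials_mult sym_partials_exp_bump finite_Basis)

lemma bump_nonneg: "bump c x \<ge> 0"
  by (auto simp: bump_def exp_bump_def intro!: prod_nonneg)

lemma bump_pos: "c * norm x < 1 \<Longrightarrow> c > 0 \<Longrightarrow> bump c x > 0"
proof -
  assume *: "c * norm x < 1" "c > 0"
  have "\<bar>c * (x \<bullet> i)\<bar> < 1" if "i \<in> Basis" for i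
    using * Basis_le_norm[OF that, of x] by (simp add: abs_mult) (meson le_less_trans mult_left_mono less_imp_le)
  then have "1 + c * (x \<bullet> i) > 0 \<and> 1 - c * (x \<bullet> i) > 0" if "i \<in> Basis" for i
    using that by force
  then show ?thesis
    by (auto simp: bump_def exp_bump_def intro!: prod_pos)
qed

text \<open>The radius comes from bounding the norm by the sum of the coordinates, each at most 1/c
  in absolute value. It is crude, but it shrinks to 0 as c grows.\<close>

lemma bump_support: 
  fixes x :: "'a::euclidean_space"
  assumes "c > 0" "bump c x \<noteq> 0"
  shows "norm x \<le> DIM('a) / c"
proof -
  have "\<bar>x \<bullet> i\<bar> \<le> 1 / c" if "i \<in> Basis" for i
  proof -
    have "1 + c * (x \<bullet> i) > 0 \<and> 1 - c * (x \<bullet> i) > 0"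
      using assms that by (auto simp: bump_def exp_bump_def split: if_splits)
    then show ?thesis using \<open>c > 0\<close> by (auto simp: abs_le_iff field_simps)
  qed
  then have "(\<Sum>i\<in>Basis. \<bar>x \<bullet> i\<bar>) \<le> of_nat (card (Basis::'a set)) * (1 / c)"
    by (intro sum_bounded_above)
  with norm_le_l1[of x] show ?thesis by simp
qed

section \<open>Partial derivatives and mollifiers\<close>

text \<open>A C^1 condition in a single direction. The class admits products, convolutions and
  compositions with functions that are only C^1, such as the piecewise quadratic cut-offs applied to
  a test function, and it still supports integration by parts in that direction.\<close>

definition has_partial :: "'a::euclidean_space \<Rightarrow> ('a \<Rightarrow> real) \<Rightarrow> ('a \<Rightarrow> real) \<Rightarrow> bool" where
  "has_partial i f g \<longleftrightarrow> continuous_on UNIV f \<and> continuous_on UNIV g \<and>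
     (\<forall>x. ((\<lambda>t. f (x + t *\<^sub>R i)) has_real_derivative g x) (at 0))"

lemma has_partial_line:
  assumes "has_partial i f g"
  shows "((\<lambda>t. f (x + t *\<^sub>R i)) has_real_derivative g (x + s *\<^sub>R i)) (at s)"
proof -
  have "((\<lambda>t. f ((x + s *\<^sub>R i) + t *\<^sub>R i)) has_real_derivative g (x + s *\<^sub>R i)) (at 0)"
    using assms by (simp add: has_partial_def)
  then have "((\<lambda>t. f (x + (t + s) *\<^sub>R i)) has_real_derivative g (x + s *\<^sub>R i)) (at 0)"
    by (simp add: algebra_simps)
  then show ?thesis
    using DERIV_shift[of "\<lambda>t. f (x + t *\<^sub>R i)" _ 0 s] by (simp add: add.commute)
qed

lemma has_partial_mult:
  assumes "has_partial i f f'" "has_partial i g g'"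
  shows "has_partial i (\<lambda>x. f x * g x) (\<lambda>x. f' x * g x + f x * g' x)"
  using assms unfolding has_partial_def
  by (auto intro!: continuous_intros derivative_eq_intros) 

lemma has_partial_compose:
  assumes "has_partial i f f'" "\<And>t. (h has_real_derivative h' t) (at t)" "continuous_on UNIV h'"
  shows "has_partial i (\<lambda>x. h (f x)) (\<lambda>x. h' (f x) * f' x)"
proof -
  have "continuous_on UNIV h"
    using assms(2) by (meson DERIV_isCont continuous_at_imp_continuous_on)
  moreover have "((\<lambda>t. h (f (x + t *\<^sub>R i))) has_real_derivative h' (f x) * f' x) (at 0)" for x
    using DERIV_chain2[of h "h' (f x)" "\<lambda>t. f (x + t *\<^sub>R i)" 0 "f' x" UNIV] assms(1,2)
    by (simp add: has_partial_def)
  ultimately show ?thesis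
    using assms unfolding has_partial_def
    by (auto intro!: continuous_intros continuous_on_compose2[of UNIV h] continuous_on_compose2[of UNIV h'])
qed

lemma has_partial_reflect:
  assumes "has_partial i k k'"
  shows "has_partial i (\<lambda>y. k (x - y)) (\<lambda>y. - k' (x - y))"
proof -
  have c: "continuous_on UNIV k" "continuous_on UNIV k'" using assms by (auto simp: has_partial_def)
  have "((\<lambda>t. k (x - (y + t *\<^sub>R i))) has_real_derivative - k' (x - y)) (at 0)" for y
  proof -
    have "((\<lambda>t::real. - t) has_real_derivative - 1) (at 0)" by (auto intro!: derivative_eq_intros)
    from DERIV_chain2[OF has_partial_line[OF assms, of "x - y"] this] show ?thesis
      by (simp add: algebra_simps)
  qed
  moreover have "continuous_on UNIV (\<lambda>y. k (x - y))" "continuous_on UNIV (\<lambda>y. - k' (x - y))"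
    by (auto intro!: continuous_intros continuous_on_compose2[OF c(1)] continuous_on_compose2[OF c(2)])
  ultimately show ?thesis by (simp add: has_partial_def)
qed

lemma has_partial_C_k:
  fixes f :: "'a::euclidean_space \<Rightarrow> real"
  assumes "\<And>k. C_k k f" "i \<in> Basis"
  shows "has_partial i f (\<lambda>x. frechet_derivative f (at x) i)"
proof -
  have "((\<lambda>t. f (x + t *\<^sub>R i)) has_real_derivative frechet_derivative f (at x) i) (at 0)" for x
  proof -
    have "((\<lambda>t::real. x + t *\<^sub>R i) has_derivative (\<lambda>t. t *\<^sub>R i)) (at 0)"
      by (auto intro!: derivative_eq_intros)
    moreover have f: "(f has_derivative frechet_derivative f (at x)) (at (x + 0 *\<^sub>R i))"
      using C_k_diffD[OF assms(1)] by (simp add: frechet_derivative_works)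
    ultimately have "((\<lambda>t. f (x + t *\<^sub>R i)) has_derivative (\<lambda>t. frechet_derivative f (at x) (t *\<^sub>R i))) (at 0)"
      using has_derivative_compose[of "\<lambda>t::real. x + t *\<^sub>R i" "\<lambda>t. t *\<^sub>R i" 0 UNIV f] by simp
    moreover have "frechet_derivative f (at x) (t *\<^sub>R i) = frechet_derivative f (at x) i * t" for t
      using C_k_diffD[OF assms(1)] by (simp add: linear_frechet_derivative linear_scale)
    ultimately show ?thesis by (simp add: has_field_derivative_def)
  qed
  moreover have "C_k 0 f" "C_k 0 (\<lambda>x. frechet_derivative f (at x) i)"
    using assms C_k_partialD by blast+
  ultimately show ?thesis by (auto simp: has_partial_def)
qed

section \<open>Integrals of compactly supported functions\<close>

lemma continuous_compact_support_bounded: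
  fixes g :: "'a::euclidean_space \<Rightarrow> real"
  assumes "continuous_on UNIV g" "compact S" "\<And>x. x \<notin> S \<Longrightarrow> g x = 0"
  obtains B where "B > 0" "\<And>x. \<bar>g x\<bar> \<le> B"
proof -
  have "compact (g ` S)"
    using assms by (meson compact_continuous_image continuous_on_subset subset_UNIV)
  then obtain B where "\<forall>x\<in>S. norm (g x) \<le> B"
    by (meson bounded_iff compact_imp_bounded image_eqI)
  then have "\<bar>g x\<bar> \<le> max B 1" for x
    using assms(3)[of x] by (cases "x \<in> S") force+
  then show ?thesis by (intro that[of "max B 1"]) auto
qed

lemma integrable_indicator_compact:
  fixes S :: "'a::euclidean_space set" and B :: real
  assumes "compact S"
  shows "integrable lborel (\<lambda>x. indicator S x * B)"
proof -
  have "emeasure lborel S < \<infinity>"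
    using assms using compact_imp_bounded emeasure_bounded_finite by auto
  then show ?thesis
    using assms by (intro integrable_mult_left integrable_real_indicator) (auto simp: borel_compact)
qed

lemma integrable_continuous_compact_support:
  fixes g :: "'a::euclidean_space \<Rightarrow> real"
  assumes "continuous_on UNIV g" "compact S" "\<And>x. x \<notin> S \<Longrightarrow> g x = 0"
  shows "integrable lborel g"
proof -
  obtain B where B: "B > 0" "\<And>x. \<bar>g x\<bar> \<le> B"
    using continuous_compact_support_bounded[OF assms] by blast
  have "integrable lborel (\<lambda>x. indicator S x * B)"
    by (rule integrable_indicator_compact[OF assms(2)])
  then show ?thesis
    by (rule Bochner_Integration.integrable_bound)
       (use assms(1,3) B in \<open>auto intro: borel_measurable_continuous_onI simp: indicator_def\<close>)
qed

lemma lborel_integral_shift: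
  fixes f :: "'a::euclidean_space \<Rightarrow> real"
  assumes "f \<in> borel_measurable borel"
  shows "(LINT x|lborel. f (x + a)) = (LINT x|lborel. f x)"
proof -
  have "(LINT x|lborel. f x) = (LINT x|distr lborel borel ((+) a). f x)"
    by (simp add: lborel_distr_plus)
  also have "\<dots> = (LINT x|lborel. f (a + x))"
    using assms by (subst integral_distr) auto
  finally show ?thesis by (simp add: add.commute)
qed

text \<open>Translation invariance makes the integral of every difference quotient vanish.\<close>

lemma integral_partial_zero:
  fixes f :: "'a::euclidean_space \<Rightarrow> real"
  assumes p: "has_partial i f g" and S: "compact S" "\<And>x. x \<notin> S \<Longrightarrow> f x = 0" "\<And>x. x \<notin> S \<Longrightarrow> g x = 0"
  shows "(LINT x|lborel. g x) = 0"
proof -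
  have cf: "continuous_on UNIV f" and cg: "continuous_on UNIV g" using p by (auto simp: has_partial_def)
  obtain B where B: "B > 0" "\<And>x. \<bar>g x\<bar> \<le> B"
    using continuous_compact_support_bounded[OF cg S(1,3)] by blast
  define t where "t n = 1 / real (Suc n)" for n
  define Q where "Q n x = (f (x + t n *\<^sub>R i) - f x) / t n" for n x
  have tpos: "0 < t n" "t n \<le> 1" for n by (auto simp: t_def)
  have t0: "t \<longlonglongrightarrow> 0" unfolding t_def using LIMSEQ_inverse_real_of_nat by (simp add: inverse_eq_divide)
  \<comment> \<open>\<open>T\<close> is swept out by moving \<open>S\<close> backwards along i by at
    most 1. As \<open>t n \<le> 1\<close>, it contains the supports of all the quotients and yields
    one dominating function.\<close>
  define T where "T = (\<lambda>(x, s). x - s *\<^sub>R i) ` (S \<times> {0..1::real})"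
  have "compact T" unfolding T_def
    by (intro compact_continuous_image compact_Times S) (auto simp: case_prod_unfold intro!: continuous_intros)
  have inT: "x \<in> T" if "x + s *\<^sub>R i \<in> S" "0 \<le> s" "s \<le> 1" for x s
    unfolding T_def using that by (intro image_eqI[of _ _ "(x + s *\<^sub>R i, s)"]) auto
  have Qz: "Q n x = 0" if "x \<notin> T" for n x
  proof -
    have "x + t n *\<^sub>R i \<notin> S" "x \<notin> S"
      using inT[of x "t n"] inT[of x 0] tpos[of n] that by auto
    then show ?thesis using S(2) by (simp add: Q_def)
  qed
  have Qb: "\<bar>Q n x\<bar> \<le> B" for n x
  proof -
    \<comment> \<open>The mean value theorem makes the quotient a value of \<open>g\<close>, so the
      bound on \<open>g\<close> dominates uniformly in n.\<close>
    obtain z where "f (x + t n *\<^sub>R i) - f (x + 0 *\<^sub>R i) = (t n - 0) * g (x + z *\<^sub>R i)"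
      using MVT2[of 0 "t n" "\<lambda>s. f (x + s *\<^sub>R i)" "\<lambda>s. g (x + s *\<^sub>R i)"] tpos[of n] has_partial_line[OF p] by blast
    then have "Q n x = g (x + z *\<^sub>R i)" using tpos[of n] by (simp add: Q_def)
    then show ?thesis using B by simp
  qed
  have fint: "integrable lborel f" by (rule integrable_continuous_compact_support[OF cf S(1,2)])
  have fint': "integrable lborel (\<lambda>x. f (x + a))" for a
    by (rule integrable_continuous_compact_support[of _ "(\<lambda>x. x - a) ` S"])
       (use S cf in \<open>auto intro!: continuous_on_compose2[of UNIV f] continuous_intros compact_continuous_image image_eqI[of _ _ "_ + a"]\<close>)
  have fm: "f \<in> borel_measurable borel" using cf by (rule borel_measurable_continuous_onI)
  have "(LINT x|lborel. Q n x) = 0" for n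
    unfolding Q_def using fint fint' fm by (simp add: lborel_integral_shift)
  moreover have "(\<lambda>n. LINT x|lborel. Q n x) \<longlonglongrightarrow> (LINT x|lborel. g x)"
  proof (rule integral_dominated_convergence[where w = "\<lambda>x. indicator T x * B"])
    show "g \<in> borel_measurable lborel" using cg by (simp add: borel_measurable_continuous_onI)
    show "Q n \<in> borel_measurable lborel" for n
      unfolding Q_def using fm by measurable
    show "integrable lborel (\<lambda>x. indicator T x * B)"
      by (rule integrable_indicator_compact[OF \<open>compact T\<close>])
    show "AE x in lborel. (\<lambda>n. Q n x) \<longlonglongrightarrow> g x"
    proof (rule AE_I2)
      fix x
      have "((\<lambda>h. (f (x + h *\<^sub>R i) - f x) / h) \<longlongrightarrow> g x) (at 0)"
        using p by (auto simp: has_partial_def has_field_derivative_iff)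
      moreover have "filterlim t (at 0) sequentially"
        using t0 tpos by (auto simp: filterlim_at intro!: always_eventually less_imp_neq[symmetric])
      ultimately show "(\<lambda>n. Q n x) \<longlonglongrightarrow> g x"
        unfolding Q_def by (rule filterlim_compose)
    qed
    show "AE x in lborel. norm (Q n x) \<le> indicator T x * B" for n
      using Qb Qz by (auto simp: indicator_def)
  qed
  ultimately show ?thesis by (simp add: LIMSEQ_const_iff)
qed

text \<open>\<open>Suc n\<close> avoids the degenerate scale 0 at n = 0. Each kernel is divided by
  its own integral, so unit mass comes without any scaling law for bumps.\<close>

definition mollifier :: "nat \<Rightarrow> 'a::euclidean_space \<Rightarrow> real" where
  "mollifier n x = bump (Suc n) x * inverse (LINT y|lborel. bump (Suc n) (y::'a))"

lemma sym_partials_mollifier: "sym_partials (mollifier n)"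
  unfolding mollifier_def[abs_def] by (intro sym_partials_mult sym_partials_bump sym_partials_const)

lemma C_k_bump: "C_k k (bump c)"
  using sym_partials_bump by (auto simp: sym_partials_def)

lemma C_k_mollifier: "C_k k (mollifier n)"
  using sym_partials_mollifier by (auto simp: sym_partials_def)

lemma mollifier_support:
  fixes x :: "'a::euclidean_space"
  shows "mollifier n x \<noteq> 0 \<Longrightarrow> norm x \<le> DIM('a) / Suc n"
  by (rule bump_support) (auto simp: mollifier_def)

lemma integrable_bump: "c > 0 \<Longrightarrow> integrable lborel (bump c :: 'a::euclidean_space \<Rightarrow> real)"
  by (rule integrable_continuous_compact_support[of _ "cball 0 (DIM('a) / c)"])
     (use C_k_bump[of 0 c] bump_support[of c] in auto)

text \<open>A nonnegative function with zero integral vanishes almost everywhere, but the bump is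
  positive on a ball, which is not a null set.\<close>

lemma integral_bump_pos: "c > 0 \<Longrightarrow> (LINT x|lborel. bump c (x::'a::euclidean_space)) > 0"
proof -
  assume c: "c > 0"
  have "(LINT x|lborel. bump c (x::'a)) \<noteq> 0"
  proof
    assume "(LINT x|lborel. bump c (x::'a)) = 0"
    then have "AE x in lborel. bump c (x::'a) = 0"
      using integral_nonneg_eq_0_iff_AE[OF integrable_bump[OF c]] bump_nonneg by auto
    then have "AE x in lborel. (x::'a) \<notin> ball 0 (1/c)"
    proof eventually_elim
      case (elim x)
      then have "\<not> c * norm x < 1" using bump_pos[of c x] c by linarith
      then have "\<not> norm x < 1 / c" using c by (simp add: pos_less_divide_eq mult.commute)
      then show ?case by simp
    qed
    then have "ball (0::'a) (1/c) \<in> null_sets lborel"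
      by (subst AE_iff_null_sets) auto
    then have "negligible (ball (0::'a) (1/c))"
      by (simp add: negligible_iff_null_sets null_sets_completionI)
    then show False using c by (simp add: open_not_negligible)
  qed
  moreover have "(LINT x|lborel. bump c (x::'a)) \<ge> 0" by (simp add: bump_nonneg)
  ultimately show ?thesis by linarith
qed

lemma mollifier_nonneg: "mollifier n x \<ge> 0"
  unfolding mollifier_def
  by (intro mult_nonneg_nonneg bump_nonneg) (auto intro: Bochner_Integration.integral_nonneg bump_nonneg)

lemma integrable_mollifier: "integrable lborel (mollifier n :: 'a::euclidean_space \<Rightarrow> real)"
  unfolding mollifier_def[abs_def] by (simp add: integrable_bump del: of_nat_Suc)

lemma integral_mollifier: "(LINT x|lborel. mollifier n (x::'a::euclidean_space)) = 1"
  using integral_bump_pos[of "Suc n", where 'a='a] by (simp add: mollifier_def del: of_nat_Suc)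

abbreviation mollifier_deriv :: "nat \<Rightarrow> 'a::euclidean_space \<Rightarrow> 'a \<Rightarrow> real" where
  "mollifier_deriv n i x \<equiv> frechet_derivative (mollifier n) (at x) i"

text \<open>The complement of \<open>S\<close> is open, so a short segment through \<open>x\<close>
  in direction \<open>i\<close> avoids \<open>S\<close>, and \<open>f\<close> is constantly 0 along
  it. A support bound for \<open>f\<close> thus carries over to its derivative.\<close>

lemma has_partial_zero_outside:
  assumes p: "has_partial i f g" and S: "closed S" "\<And>x. x \<notin> S \<Longrightarrow> f x = 0" and x: "x \<notin> S"
  shows "g x = 0"
proof -
  have "open {t. x + t *\<^sub>R i \<notin> S}"
  proof -
    have "continuous_on UNIV (\<lambda>t::real. x + t *\<^sub>R i)" by (intro continuous_intros)
    from open_vimage[OF open_Compl[OF S(1)] this] show ?thesis by (simp add: vimage_def)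
  qed
  moreover have "0 \<in> {t. x + t *\<^sub>R i \<notin> S}" using x by simp
  ultimately obtain e where e0: "e > 0" and "ball 0 e \<subseteq> {t. x + t *\<^sub>R i \<notin> S}"
    using open_contains_ball by blast
  then have e: "x + t *\<^sub>R i \<notin> S" if "\<bar>t\<bar> < e" for t
    using that by (auto simp: subset_iff)
  have "((\<lambda>t. 0) has_real_derivative g x) (at 0)"
    by (rule has_field_derivative_transform_within[of "\<lambda>t. f (x + t *\<^sub>R i)" _ _ _ e])
       (use p e0 e S in \<open>auto simp: has_partial_def dist_real_def\<close>)
  then show ?thesis using DERIV_unique DERIV_const by blast
qed

section \<open>Continuity of translations\<close>

lemma tendsto_at_0_sequentiallyI:
  fixes f :: "'a::real_normed_vector \<Rightarrow> 'b::topological_space"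
  assumes "\<And>a. a \<longlonglongrightarrow> 0 \<Longrightarrow> (\<And>n. a n \<noteq> 0) \<Longrightarrow> (\<lambda>n. f (a n)) \<longlonglongrightarrow> l"
  shows "(f \<longlongrightarrow> l) (at 0)"
  using assms by (auto simp: tendsto_at_iff_sequentially o_def)

lemma integrable_shift:
  fixes f :: "'a::euclidean_space \<Rightarrow> real"
  assumes "integrable lborel f"
  shows "integrable lborel (\<lambda>x. f (x + a))"
proof -
  have "integrable (distr lborel borel ((+) a)) f"
    using assms by (simp add: lborel_distr_plus)
  then have "integrable lborel (\<lambda>x. f (a + x))"
    using assms by (subst (asm) integrable_distr_eq) auto
  then show ?thesis by (simp add: add.commute)
qed

lemma tendsto_integral_shift_continuous:
  fixes g :: "'a::euclidean_space \<Rightarrow> real"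
  assumes g: "continuous_on UNIV g" and S: "compact S" "\<And>x. x \<notin> S \<Longrightarrow> g x = 0"
    and a: "a \<longlonglongrightarrow> 0"
  shows "(\<lambda>n. LINT x|lborel. \<bar>g (x + a n) - g x\<bar>) \<longlonglongrightarrow> 0"
proof -
  obtain B where B: "B > 0" "\<And>x. \<bar>g x\<bar> \<le> B"
    using continuous_compact_support_bounded[OF g S] by blast
  obtain R where R: "\<And>x. x \<in> S \<Longrightarrow> norm x \<le> R"
    using compact_imp_bounded[OF S(1)] by (auto simp: bounded_iff)
  have ev: "\<forall>\<^sub>F n in sequentially. norm (a n) \<le> 1"
    using a[THEN tendstoD, of 1] by (auto elim: eventually_mono simp: dist_norm)
  \<comment> \<open>The first \<open>m\<close> shifts are dropped, so that all remaining shifted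
    supports lie in the ball of radius \<open>R + 1\<close>.\<close>
  then obtain m where m: "\<And>n. n \<ge> m \<Longrightarrow> norm (a n) \<le> 1" by (auto simp: eventually_sequentially)
  have gm: "g \<in> borel_measurable borel" using g by (rule borel_measurable_continuous_onI)
  have "(\<lambda>n. LINT x|lborel. \<bar>g (x + a (n + m)) - g x\<bar>) \<longlonglongrightarrow> (LINT x|(lborel::'a measure). (0::real))"
  proof (rule integral_dominated_convergence[where w = "\<lambda>x. indicator (cball 0 (R + 1)) x * (2 * B)"])
    show "(\<lambda>x. \<bar>g (x + a (n + m)) - g x\<bar>) \<in> borel_measurable lborel" for n
      using gm by measurable
    show "integrable lborel (\<lambda>x::'a. indicator (cball 0 (R + 1)) x * (2 * B))"
      by (rule integrable_indicator_compact) simp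
    show "AE x in lborel. (\<lambda>n. \<bar>g (x + a (n + m)) - g x\<bar>) \<longlonglongrightarrow> 0"
    proof (rule AE_I2)
      fix x
      have "(\<lambda>n. x + a (n + m)) \<longlonglongrightarrow> x + 0"
        by (intro tendsto_add tendsto_const LIMSEQ_ignore_initial_segment a)
      then have "(\<lambda>n. g (x + a (n + m))) \<longlonglongrightarrow> g x"
        using g continuous_on_tendsto_compose[of UNIV g] by simp
      then show "(\<lambda>n. \<bar>g (x + a (n + m)) - g x\<bar>) \<longlonglongrightarrow> 0"
        by (intro tendsto_rabs_zero LIM_zero)
    qed
    show "AE x in lborel. norm \<bar>g (x + a (n + m)) - g x\<bar> \<le> indicator (cball 0 (R + 1)) x * (2 * B)" for n
    proof (rule AE_I2)
      fix x
      have *: "\<bar>g (x + a (n + m)) - g x\<bar> \<le> 2 * B"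
        using B(2)[of x] B(2)[of "x + a (n + m)"] by linarith
      have "g (x + a (n + m)) = 0 \<and> g x = 0" if "x \<notin> cball 0 (R + 1)"
      proof -
        have "norm (x + a (n + m)) \<ge> norm x - norm (a (n + m))"
          by (metis norm_diff_ineq)
        with that m[of "n + m"] have "norm (x + a (n + m)) > R" "norm x > R" by auto
        then show ?thesis using R S(2) by (meson not_le)
      qed
      with * show "norm \<bar>g (x + a (n + m)) - g x\<bar> \<le> indicator (cball 0 (R + 1)) x * (2 * B)"
        by (auto simp: indicator_def)
    qed
  qed simp
  then show ?thesis by (simp add: LIMSEQ_offset)
qed

text \<open>Continuous functions that converge to \<open>f\<close> almost everywhere are clamped
  between \<open>- k\<close> and \<open>k\<close>, where \<open>k\<close> is a continuous plateau
  equal to \<open>M\<close> on the ball of radius \<open>R\<close> and 0 outside radius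
  \<open>R + 1\<close>. The clamp leaves the limit alone and provides a common bound and support for
  dominated convergence.\<close>

lemma bounded_approx_continuous:
  fixes f :: "'a::euclidean_space \<Rightarrow> real"
  assumes f: "f \<in> borel_measurable borel" and M: "\<And>x. \<bar>f x\<bar> \<le> M" and R: "\<And>x. norm x > R \<Longrightarrow> f x = 0"
    and e: "e > 0"
  obtains g S where "continuous_on UNIV g" "compact S" "\<And>x. x \<notin> S \<Longrightarrow> g x = 0"
    "(LINT x|lborel. \<bar>f x - g x\<bar>) < e"
proof -
  have M0: "M \<ge> 0" using M[of 0] by linarith
  have "f \<in> borel_measurable (lebesgue_on UNIV)"
    using f by (simp add: lebesgue_on_UNIV_eq measurable_completion)
  then have "f measurable_on UNIV" by (simp add: measurable_on_iff_borel_measurable)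
  then obtain N g where N: "negligible N" and g: "\<And>n. continuous_on UNIV (g n)"
    and lim: "\<And>x. x \<notin> N \<Longrightarrow> (\<lambda>n. g n x) \<longlonglongrightarrow> f x"
    unfolding measurable_on_def by auto
  define k where "k x = M * max 0 (min 1 (R + 1 - norm x))" for x :: 'a
  define c where "c n x = max (- k x) (min (k x) (g n x))" for n x
  have k: "0 \<le> k x" "k x \<le> M" for x
    using M0 by (auto simp: k_def intro!: mult_nonneg_nonneg mult_left_le)
  have kz: "k x = 0" if "x \<notin> cball 0 (R + 1)" for x
    using that by (auto simp: k_def)
  have cc: "continuous_on UNIV (c n)" for n
    unfolding c_def k_def using g by (intro continuous_intros) auto
  have cb: "\<bar>c n x\<bar> \<le> k x" for n x using k[of x] by (auto simp: c_def)
  have cz: "c n x = 0" if "x \<notin> cball 0 (R + 1)" for n x using cb[of n x] kz[OF that] by simp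
  have clim: "(\<lambda>n. c n x) \<longlonglongrightarrow> f x" if "x \<notin> N" for x
  proof -
    have "(\<lambda>n. c n x) \<longlonglongrightarrow> max (- k x) (min (k x) (f x))"
      unfolding c_def by (intro tendsto_intros lim that)
    moreover have "max (- k x) (min (k x) (f x)) = f x"
    proof (cases "norm x > R")
      case True
      then show ?thesis using R[of x] k[of x] by simp
    next
      case False
      then have "k x = M" by (simp add: k_def)
      then show ?thesis using M[of x] by (auto simp: abs_le_iff)
    qed
    ultimately show ?thesis by simp
  qed
  have fz: "f x = 0" if "x \<notin> cball 0 (R + 1)" for x using R[of x] that by auto
  have "(\<lambda>n. LINT x|lborel. \<bar>f x - c n x\<bar>) \<longlonglongrightarrow> (LINT x|(lborel::'a measure). (0::real))"
  proof (rule integral_dominated_convergence[where w = "\<lambda>x. indicator (cball 0 (R + 1)) x * (2 * M)"])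
    show "(\<lambda>x. \<bar>f x - c n x\<bar>) \<in> borel_measurable lborel" for n
      using f borel_measurable_continuous_onI[OF cc[of n]] by measurable
    show "integrable lborel (\<lambda>x::'a. indicator (cball 0 (R + 1)) x * (2 * M))"
      by (rule integrable_indicator_compact) simp
    have "AE x in lebesgue. x \<notin> N"
      using N by (intro AE_not_in) (simp add: negligible_iff_null_sets)
    then have "AE x in lborel. x \<notin> N" by (simp add: AE_completion_iff)
    then show "AE x in lborel. (\<lambda>n. \<bar>f x - c n x\<bar>) \<longlonglongrightarrow> 0"
    proof eventually_elim
      case (elim x)
      have "(\<lambda>n. f x - c n x) \<longlonglongrightarrow> f x - f x" by (intro tendsto_intros clim elim)
      then show ?case by (simp add: tendsto_rabs_zero)
    qed
    show "AE x in lborel. norm \<bar>f x - c n x\<bar> \<le> indicator (cball 0 (R + 1)) x * (2 * M)" for n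
    proof (rule AE_I2)
      fix x
      show "norm \<bar>f x - c n x\<bar> \<le> indicator (cball 0 (R + 1)) x * (2 * M)"
        using M[of x] cb[of n x] k[of x] cz[of x n] fz[of x] by (auto simp: indicator_def)
    qed
  qed simp
  then have "(\<lambda>n. LINT x|lborel. \<bar>f x - c n x\<bar>) \<longlonglongrightarrow> 0" by simp
  from order_tendstoD(2)[OF this e] obtain n where "(LINT x|lborel. \<bar>f x - c n x\<bar>) < e"
    by (auto simp: eventually_sequentially)
  then show ?thesis using that[OF cc[of n], of "cball 0 (R + 1)"] cz by simp
qed

text \<open>The function that sets the threshold is kept apart from the integrand because both
  \<open>g = f\<close> and \<open>g\<close> equal to the square of \<open>f\<close> occur
  later.\<close>

lemma truncation_L1:
  fixes f g :: "'a::euclidean_space \<Rightarrow> real"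
  assumes f: "f \<in> borel_measurable borel" and g: "g \<in> borel_measurable borel" "integrable lborel g"
  shows "(\<lambda>m. LINT x|lborel. \<bar>if \<bar>f x\<bar> \<le> real m \<and> norm x \<le> real m then 0 else g x\<bar>) \<longlonglongrightarrow> 0"
proof -
  have "(\<lambda>m. LINT x|lborel. \<bar>if \<bar>f x\<bar> \<le> real m \<and> norm x \<le> real m then 0 else g x\<bar>) \<longlonglongrightarrow> (LINT x|(lborel::'a measure). (0::real))"
  proof (rule integral_dominated_convergence[where w = "\<lambda>x. \<bar>g x\<bar>"])
    show "AE x in lborel. (\<lambda>m. \<bar>if \<bar>f x\<bar> \<le> real m \<and> norm x \<le> real m then 0 else g x\<bar>) \<longlonglongrightarrow> 0"
    proof (rule AE_I2)
      fix x
      obtain k where k: "max \<bar>f x\<bar> (norm x) \<le> real k" using real_arch_simple by blast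
      show "(\<lambda>m. \<bar>if \<bar>f x\<bar> \<le> real m \<and> norm x \<le> real m then 0 else g x\<bar>) \<longlonglongrightarrow> 0"
        by (rule tendsto_eventually, rule eventually_sequentiallyI[of k]) (use k in auto)
    qed
  qed (use f g in \<open>auto simp: integrable_abs\<close>)
  then show ?thesis by simp
qed

text \<open>Density argument: truncate, then approximate by a continuous function of compact
  support. Each replacement costs e/6, and the resulting e/3 counts twice since a shift preserves L1
  distances; the last e/3 is the continuous case.\<close>

lemma tendsto_integral_shift:
  fixes f :: "'a::euclidean_space \<Rightarrow> real"
  assumes f: "f \<in> borel_measurable borel" "integrable lborel f" and a: "a \<longlonglongrightarrow> 0"
  shows "(\<lambda>n. LINT x|lborel. \<bar>f (x + a n) - f x\<bar>) \<longlonglongrightarrow> 0"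
proof (rule LIMSEQ_I)
  fix e :: real assume e: "e > 0"
  define fm where "fm m x = (if \<bar>f x\<bar> \<le> real m \<and> norm x \<le> real m then f x else 0)" for m x
  have fmm: "fm m \<in> borel_measurable borel" for m
    unfolding fm_def using f by measurable
  from order_tendstoD(2)[OF truncation_L1[OF f(1) f], of "e/6"] e
  obtain m where "(LINT x|lborel. \<bar>if \<bar>f x\<bar> \<le> real m \<and> norm x \<le> real m then 0 else f x\<bar>) < e/6"
    by (auto simp: eventually_sequentially)
  moreover have "(if \<bar>f x\<bar> \<le> real m \<and> norm x \<le> real m then 0 else f x) = f x - fm m x" for x
    by (simp add: fm_def)
  ultimately have m: "(LINT x|lborel. \<bar>f x - fm m x\<bar>) < e/6" by simp
  obtain g S where g: "continuous_on UNIV g" "compact S" "\<And>x. x \<notin> S \<Longrightarrow> g x = 0"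
    and fg: "(LINT x|lborel. \<bar>fm m x - g x\<bar>) < e/6"
    by (rule bounded_approx_continuous[OF fmm, of m "real m" "real m" "e/6"]) (use e in \<open>auto simp: fm_def\<close>)
  have fmi: "integrable lborel (fm m)"
    by (rule Bochner_Integration.integrable_bound[OF f(2)]) (use fmm in \<open>auto simp: fm_def\<close>)
  have gi: "integrable lborel g" by (rule integrable_continuous_compact_support[OF g])
  have gm: "g \<in> borel_measurable borel" using g(1) by (rule borel_measurable_continuous_onI)
  have "(LINT x|lborel. \<bar>f x - g x\<bar>) \<le> (LINT x|lborel. \<bar>f x - fm m x\<bar> + \<bar>fm m x - g x\<bar>)"
    using f fmi gi by (intro integral_mono) auto
  also have "\<dots> < e/3" using f fmi gi m fg by simp
  finally have d: "(LINT x|lborel. \<bar>f x - g x\<bar>) < e/3" .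
  have main: "(LINT x|lborel. \<bar>f (x + b) - f x\<bar>) \<le> 2 * (LINT x|lborel. \<bar>f x - g x\<bar>) + (LINT x|lborel. \<bar>g (x + b) - g x\<bar>)" for b
  proof -
    note [simp] = integrable_shift[OF f(2)] integrable_shift[OF gi] f(2) gi
    have "(LINT x|lborel. \<bar>f (x + b) - f x\<bar>)
      \<le> (LINT x|lborel. \<bar>f (x + b) - g (x + b)\<bar> + \<bar>g (x + b) - g x\<bar> + \<bar>f x - g x\<bar>)"
      by (intro integral_mono) auto
    also have "\<dots> = (LINT x|lborel. \<bar>f (x + b) - g (x + b)\<bar>) + (LINT x|lborel. \<bar>g (x + b) - g x\<bar>) + (LINT x|lborel. \<bar>f x - g x\<bar>)"
      by simp
    also have "(LINT x|lborel. \<bar>f (x + b) - g (x + b)\<bar>) = (LINT x|lborel. \<bar>f x - g x\<bar>)"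
      using lborel_integral_shift[of "\<lambda>x. \<bar>f x - g x\<bar>" b] f gm by simp
    finally show ?thesis by simp
  qed
  from order_tendstoD(2)[OF tendsto_integral_shift_continuous[OF g a], of "e/3"] e
  obtain n0 where n0: "\<And>n. n \<ge> n0 \<Longrightarrow> (LINT x|lborel. \<bar>g (x + a n) - g x\<bar>) < e/3"
    by (auto simp: eventually_sequentially)
  have "norm ((LINT x|lborel. \<bar>f (x + a n) - f x\<bar>) - 0) < e" if "n \<ge> n0" for n
    using main[of "a n"] n0[OF that] d by (simp add: abs_of_nonneg)
  then show "\<exists>n0. \<forall>n\<ge>n0. norm ((LINT x|lborel. \<bar>f (x + a n) - f x\<bar>) - 0) < e" by blast
qed

lemma integrable_mult_squares:
  fixes f g :: "'a \<Rightarrow> real"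
  assumes "f \<in> borel_measurable M" "g \<in> borel_measurable M"
    "integrable M (\<lambda>x. (f x)\<^sup>2)" "integrable M (\<lambda>x. (g x)\<^sup>2)"
  shows "integrable M (\<lambda>x. f x * g x)"
proof (rule Bochner_Integration.integrable_bound[of M "\<lambda>x. (f x)\<^sup>2 + (g x)\<^sup>2"])
  have "\<bar>a * b\<bar> \<le> a\<^sup>2 + b\<^sup>2" for a b :: real
  proof -
    have "2 * (\<bar>a\<bar> * \<bar>b\<bar>) \<le> a\<^sup>2 + b\<^sup>2" using sum_squares_bound[of "\<bar>a\<bar>" "\<bar>b\<bar>"] by simp
    then show ?thesis by (simp add: abs_mult) (smt (verit) abs_ge_zero mult_nonneg_nonneg)
  qed
  then show "AE x in M. norm (f x * g x) \<le> norm ((f x)\<^sup>2 + (g x)\<^sup>2)" by simp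
qed (use assms in auto)

text \<open>Only L1 continuity of translations is used. The weight splits into a part bounded by
  \<open>m\<close>, handled in L1, and a tail \<open>r m\<close> with small square integral, handled
  by Young's inequality with parameter \<open>t\<close>.\<close>

lemma tendsto_integral_shift_weighted:
  fixes p Z :: "'a::euclidean_space \<Rightarrow> real"
  assumes p: "p \<in> borel_measurable borel" "integrable lborel p" "integrable lborel (\<lambda>x. (p x)\<^sup>2)"
    and Z: "Z \<in> borel_measurable borel" "integrable lborel (\<lambda>x. (Z x)\<^sup>2)" and a: "a \<longlonglongrightarrow> 0"
  shows "(\<lambda>n. LINT x|lborel. \<bar>Z x\<bar> * \<bar>p (x + a n) - p x\<bar>) \<longlonglongrightarrow> 0"
proof (rule LIMSEQ_I)
  fix e :: real assume e: "e > 0"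
  define P where "P = (LINT x|lborel. (p x)\<^sup>2)"
  have P0: "P \<ge> 0" unfolding P_def by simp
  \<comment> \<open>With this \<open>t\<close> the term \<open>1 / t * (P + P)\<close> is at most
    e/3, and the summand 1 keeps \<open>t\<close> positive when \<open>P = 0\<close>. The tail is
    chosen after \<open>t\<close>.\<close>
  define t where "t = 6 * (P + 1) / e"
  have t: "t > 0" using P0 e by (simp add: t_def)
  define r where "r m x = (if \<bar>Z x\<bar> \<le> real m \<and> norm x \<le> real m then 0 else Z x)" for m x
  have rm: "r m \<in> borel_measurable borel" for m unfolding r_def using Z by measurable
  have "(\<lambda>m. LINT x|lborel. \<bar>if \<bar>Z x\<bar> \<le> real m \<and> norm x \<le> real m then 0 else (Z x)\<^sup>2\<bar>) \<longlonglongrightarrow> 0"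
    by (rule truncation_L1) (use Z in measurable)
  moreover have "\<bar>if \<bar>Z x\<bar> \<le> real m \<and> norm x \<le> real m then 0 else (Z x)\<^sup>2\<bar> = (r m x)\<^sup>2" for m x
    by (simp add: r_def)
  ultimately have "(\<lambda>m. LINT x|lborel. (r m x)\<^sup>2) \<longlonglongrightarrow> 0" by simp
  from order_tendstoD(2)[OF this, of "2 * e / (3 * t)"] e t
  obtain m where "(LINT x|lborel. (r m x)\<^sup>2) < 2 * e / (3 * t)"
    by (auto simp: eventually_sequentially)
  then have m: "t / 2 * (LINT x|lborel. (r m x)\<^sup>2) < e / 3" using t by (simp add: field_simps)
  have "\<bar>(r m x)\<^sup>2\<bar> \<le> \<bar>(Z x)\<^sup>2\<bar>" for x by (simp add: r_def)
  moreover have "(\<lambda>x. (r m x)\<^sup>2) \<in> borel_measurable lborel" using rm by simp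
  ultimately have ri: "integrable lborel (\<lambda>x. (r m x)\<^sup>2)"
    by (intro Bochner_Integration.integrable_bound[OF Z(2)]) auto
  note [simp] = integrable_shift[OF p(2)] integrable_shift[OF p(3)] p(2,3) ri
  \<comment> \<open>Here \<open>q\<close> plays the role of the tail of \<open>z\<close>: either
    \<open>z\<close> is below the threshold, or \<open>q = z\<close> and Young's inequality
    applies.\<close>
  have pt: "\<bar>z\<bar> * \<bar>b - c\<bar> \<le> real m * \<bar>b - c\<bar> + (t / 2 * q\<^sup>2 + 1 / t * (b\<^sup>2 + c\<^sup>2))" 
    if "\<bar>z\<bar> \<le> real m \<or> q = z" for z b c q :: real
  proof -
    have 0: "0 \<le> t / 2 * q\<^sup>2 + 1 / t * (b\<^sup>2 + c\<^sup>2)" using t by simp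
    show ?thesis
    proof (cases "\<bar>z\<bar> \<le> real m")
      case True
      then show ?thesis using 0 mult_right_mono[OF True, of "\<bar>b - c\<bar>"] by simp
    next
      case False
      then have q: "q = z" using that by simp
      have "0 \<le> (t * \<bar>z\<bar> - \<bar>b - c\<bar>)\<^sup>2" by simp
      then have "2 * t * (\<bar>z\<bar> * \<bar>b - c\<bar>) \<le> t\<^sup>2 * z\<^sup>2 + (b - c)\<^sup>2"
        by (simp add: power2_diff power_mult_distrib algebra_simps)
      also have "(b - c)\<^sup>2 \<le> 2 * (b\<^sup>2 + c\<^sup>2)" using zero_le_power2[of "b + c"] by (simp add: power2_diff power2_sum)
      finally have "2 * t * (\<bar>z\<bar> * \<bar>b - c\<bar>) \<le> t\<^sup>2 * z\<^sup>2 + 2 * (b\<^sup>2 + c\<^sup>2)" by simp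
      also have "\<dots> = 2 * t * (t / 2 * z\<^sup>2 + 1 / t * (b\<^sup>2 + c\<^sup>2))"
        using t by (simp add: distrib_left power2_eq_square)
      finally have "2 * t * (\<bar>z\<bar> * \<bar>b - c\<bar>) \<le> 2 * t * (t / 2 * z\<^sup>2 + 1 / t * (b\<^sup>2 + c\<^sup>2))" .
      then have "\<bar>z\<bar> * \<bar>b - c\<bar> \<le> t / 2 * z\<^sup>2 + 1 / t * (b\<^sup>2 + c\<^sup>2)" using t by simp
      then show ?thesis using q by (smt (verit) mult_nonneg_nonneg of_nat_0_le_iff abs_ge_zero)
    qed
  qed
  have main: "(LINT x|lborel. \<bar>Z x\<bar> * \<bar>p (x + b) - p x\<bar>)
     \<le> real m * (LINT x|lborel. \<bar>p (x + b) - p x\<bar>) + e/3 + e/3" for b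
  proof -
    have zi: "integrable lborel (\<lambda>x. \<bar>Z x\<bar> * \<bar>p (x + b) - p x\<bar>)"
    proof -
      have "integrable lborel (\<lambda>x. Z x * p (x + b))" "integrable lborel (\<lambda>x. Z x * p x)"
        by (intro integrable_mult_squares; use p(1) Z in simp)+
      then have "integrable lborel (\<lambda>x. \<bar>Z x * p (x + b) - Z x * p x\<bar>)" by auto
      then show ?thesis by (simp add: abs_mult[symmetric] right_diff_distrib)
    qed
    have ineq: "\<bar>Z x\<bar> * \<bar>p (x + b) - p x\<bar>
      \<le> real m * \<bar>p (x + b) - p x\<bar> + (t / 2 * (r m x)\<^sup>2 + 1 / t * ((p (x + b))\<^sup>2 + (p x)\<^sup>2))" for x
      by (rule pt) (auto simp: r_def)
    have "(LINT x|lborel. \<bar>Z x\<bar> * \<bar>p (x + b) - p x\<bar>)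
      \<le> (LINT x|lborel. real m * \<bar>p (x + b) - p x\<bar> + (t / 2 * (r m x)\<^sup>2 + 1 / t * ((p (x + b))\<^sup>2 + (p x)\<^sup>2)))"
      by (intro integral_mono zi ineq) simp
    also have "\<dots> = real m * (LINT x|lborel. \<bar>p (x + b) - p x\<bar>) + (t / 2 * (LINT x|lborel. (r m x)\<^sup>2) + 1 / t * (P + P))"
      using lborel_integral_shift[of "\<lambda>x. (p x)\<^sup>2" b] p(1) by (simp add: P_def)
    also have "1 / t * (P + P) \<le> e / 3"
      using e P0 by (simp add: t_def field_simps)
    finally show ?thesis using m by linarith
  qed
  have "(\<lambda>n. real m * (LINT x|lborel. \<bar>p (x + a n) - p x\<bar>)) \<longlonglongrightarrow> real m * 0"
    by (intro tendsto_intros tendsto_integral_shift p a)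
  from order_tendstoD(2)[OF this, of "e/3"] e
  obtain n0 where n0: "\<And>n. n \<ge> n0 \<Longrightarrow> real m * (LINT x|lborel. \<bar>p (x + a n) - p x\<bar>) < e/3"
    by (auto simp: eventually_sequentially)
  have "norm ((LINT x|lborel. \<bar>Z x\<bar> * \<bar>p (x + a n) - p x\<bar>) - 0) < e" if "n \<ge> n0" for n
  proof -
    have "(LINT x|lborel. \<bar>Z x\<bar> * \<bar>p (x + a n) - p x\<bar>) \<ge> 0" by simp
    then show ?thesis using main[of "a n"] n0[OF that] by simp
  qed
  then show "\<exists>n0. \<forall>n\<ge>n0. norm ((LINT x|lborel. \<bar>Z x\<bar> * \<bar>p (x + a n) - p x\<bar>) - 0) < e" by blast
qed

section \<open>Mollification\<close>

text \<open>The integral is over \<open>lebesgue\<close> because Sobolev functions are only Lebesgue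
  measurable. Fubini arguments run over \<open>lborel\<close> after passing to a Borel
  representative, which leaves every value of the mollification unchanged.\<close>

definition mollify :: "nat \<Rightarrow> ('a::euclidean_space \<Rightarrow> real) \<Rightarrow> 'a \<Rightarrow> real" where
  "mollify n f x = (LINT y|lebesgue. f y * mollifier n (x - y))"

lemma lborel_distr_reflect:
  fixes x :: "'a::euclidean_space"
  shows "distr lborel borel (\<lambda>z. x - z) = lborel"
proof -
  have "lborel = density (distr lborel borel (\<lambda>z::'a. x + (- 1) *\<^sub>R z)) (\<lambda>_. ennreal (\<bar>- 1\<bar> ^ DIM('a)))"
    using lborel_affine[of "-1" x] by simp
  then have "lborel = density (distr lborel borel (\<lambda>z. x - z)) (\<lambda>_. 1)"
    by simp
  then show ?thesis by (simp add: density_1)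
qed

lemma mollifier_continuous: "continuous_on UNIV (mollifier n)"
  using C_k_mollifier[of 0 n] by simp

lemma mollifier_measurable [measurable]: "mollifier n \<in> borel_measurable borel"
  using mollifier_continuous by (rule borel_measurable_continuous_onI)

lemma mollifier_bounded:
  obtains B where "B > 0" "\<And>x::'a::euclidean_space. \<bar>mollifier n x\<bar> \<le> B"
proof (rule continuous_compact_support_bounded[OF mollifier_continuous[where 'a='a], of "cball 0 (DIM('a) / Suc n)" n])
  show "compact (cball (0::'a) (DIM('a) / Suc n))" by simp
  show "mollifier n x = 0" if "x \<notin> cball 0 (DIM('a) / Suc n)" for x :: 'a
    using mollifier_support[of n x] that by auto
qed (use that in blast)

text \<open>After the reflection y = x - z, unit mass of the kernel writes f(x) as an average too,
  so the error is an average of translation differences.\<close>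

lemma mollify_diff:
  fixes f :: "'a::euclidean_space \<Rightarrow> real"
  assumes f: "f \<in> borel_measurable borel" "integrable lborel f"
  shows "mollify n f x - f x = (LINT z|lborel. (f (x - z) - f x) * mollifier n z)"
    and "integrable lborel (\<lambda>z. (f (x - z) - f x) * mollifier n z)"
proof -
  obtain B where B: "B > 0" "\<And>z::'a. \<bar>mollifier n z\<bar> \<le> B" using mollifier_bounded[where 'a='a] by blast
  have i1: "integrable lborel (\<lambda>y. f y * mollifier n (x - y))"
  proof (rule Bochner_Integration.integrable_bound[of _ "\<lambda>y. B * \<bar>f y\<bar>"])
    show "AE y in lborel. norm (f y * mollifier n (x - y)) \<le> norm (B * \<bar>f y\<bar>)"
    proof (rule AE_I2)
      fix y
      have "\<bar>f y\<bar> * \<bar>mollifier n (x - y)\<bar> \<le> \<bar>f y\<bar> * B" by (rule mult_left_mono) (use B in auto)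
      then show "norm (f y * mollifier n (x - y)) \<le> norm (B * \<bar>f y\<bar>)"
        using B(1) by (simp add: abs_mult mult.commute)
    qed
  qed (use f in auto)
  have m1: "(\<lambda>y. f y * mollifier n (x - y)) \<in> borel_measurable borel" using f by measurable
  have "mollify n f x = (LINT y|lborel. f y * mollifier n (x - y))"
    unfolding mollify_def using m1 by (simp add: integral_completion)
  also have "\<dots> = (LINT y|distr lborel borel (\<lambda>z. x - z). f y * mollifier n (x - y))"
    by (simp add: lborel_distr_reflect)
  also have "\<dots> = (LINT z|lborel. f (x - z) * mollifier n z)"
    using m1 by (subst integral_distr) auto
  finally have e: "mollify n f x = (LINT z|lborel. f (x - z) * mollifier n z)" .
  have "integrable (distr lborel borel (\<lambda>z. x - z)) (\<lambda>y. f y * mollifier n (x - y))"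
    using i1 by (simp add: lborel_distr_reflect)
  then have i2: "integrable lborel (\<lambda>z. f (x - z) * mollifier n z)"
    using m1 by (subst (asm) integrable_distr_eq) auto
  have i3: "integrable lborel (\<lambda>z. f x * mollifier n z)"
    by (simp add: integrable_mollifier)
  show "mollify n f x - f x = (LINT z|lborel. (f (x - z) - f x) * mollifier n z)"
    unfolding left_diff_distrib Bochner_Integration.integral_diff[OF i2 i3]
    by (simp add: e integral_mollifier)
  show "integrable lborel (\<lambda>z. (f (x - z) - f x) * mollifier n z)"
    unfolding left_diff_distrib by (rule Bochner_Integration.integrable_diff[OF i2 i3])
qed

lemma mollify_measurable:
  fixes f :: "'a::euclidean_space \<Rightarrow> real"
  assumes "f \<in> borel_measurable borel" "integrable lborel f"
  shows "mollify n f \<in> borel_measurable borel"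
proof -
  have "(\<lambda>(x::'a, z::'a). (f (x - z) - f x) * mollifier n z) \<in> borel_measurable (borel \<Otimes>\<^sub>M lborel)"
    using assms by measurable
  then have "(\<lambda>x. LINT z|lborel. (f (x - z) - f x) * mollifier n z) \<in> borel_measurable borel"
    using lborel.borel_measurable_lebesgue_integral[of "\<lambda>x z. (f (x - z) - f x) * mollifier n z" borel] by simp
  then have "(\<lambda>x. f x + (LINT z|lborel. (f (x - z) - f x) * mollifier n z)) \<in> borel_measurable borel"
    using assms by simp
  moreover have "f x + (LINT z|lborel. (f (x - z) - f x) * mollifier n z) = mollify n f x" for x
    using mollify_diff(1)[OF assms, of n x] by linarith
  ultimately show ?thesis by (simp cong: measurable_cong)
qed

text \<open>Tonelli bounds the weighted error by the average of \<open>W (- z)\<close> against the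
  kernel, whose support shrinks to 0. The weight is abstract to serve both Z = 1 and square
  integrable Z. Nonnegative integrals give the bound and the integrability at once.\<close>

lemma mollify_weighted:
  fixes p Z :: "'a::euclidean_space \<Rightarrow> real"
  assumes p: "p \<in> borel_measurable borel" "integrable lborel p"
    and Z: "Z \<in> borel_measurable borel"
    and int: "\<And>a. integrable lborel (\<lambda>x. \<bar>Z x\<bar> * \<bar>p (x + a) - p x\<bar>)"
    and lim: "\<And>a. a \<longlonglongrightarrow> 0 \<Longrightarrow> (\<lambda>n. LINT x|lborel. \<bar>Z x\<bar> * \<bar>p (x + a n) - p x\<bar>) \<longlonglongrightarrow> 0"
  shows "(\<lambda>n. LINT x|lborel. \<bar>Z x * (mollify n p x - p x)\<bar>) \<longlonglongrightarrow> 0"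
    and "\<forall>\<^sub>F n in sequentially. integrable lborel (\<lambda>x. Z x * (mollify n p x - p x))"
proof -
  define W where "W a = (LINT x|lborel. \<bar>Z x\<bar> * \<bar>p (x + a) - p x\<bar>)" for a
  have key: "\<forall>\<^sub>F n in sequentially. (\<integral>\<^sup>+x. ennreal \<bar>Z x * (mollify n p x - p x)\<bar> \<partial>lborel) \<le> ennreal e" if e: "e > 0" for e
  proof -
    have "(W \<longlongrightarrow> 0) (at 0)"
      using lim by (intro tendsto_at_0_sequentiallyI) (auto simp: W_def)
    then have "\<forall>\<^sub>F a in at 0. W a < e" using e by (rule order_tendstoD)
    then obtain d where d: "d > 0" "\<And>a. a \<noteq> 0 \<Longrightarrow> norm a < d \<Longrightarrow> W a < e"
      by (auto simp: eventually_at dist_norm)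
    have W: "W a \<le> e" if "norm a < d" for a
      using d(2)[of a] that e by (cases "a = 0") (auto simp: W_def)
    have "(\<lambda>n. real DIM('a) / Suc n) \<longlonglongrightarrow> 0" by (rule LIMSEQ_Suc, rule lim_const_over_n)
    then have "\<forall>\<^sub>F n in sequentially. real DIM('a) / Suc n < d" using d(1) by (rule order_tendstoD)
    then show ?thesis
    proof eventually_elim
      case (elim n)
      have "(\<integral>\<^sup>+x. ennreal \<bar>Z x * (mollify n p x - p x)\<bar> \<partial>lborel)
        \<le> (\<integral>\<^sup>+x. (\<integral>\<^sup>+z. ennreal (\<bar>Z x\<bar> * \<bar>p (x - z) - p x\<bar> * mollifier n z) \<partial>lborel) \<partial>lborel)"
      proof (rule nn_integral_mono)
        fix x
        have i: "integrable lborel (\<lambda>z. \<bar>Z x\<bar> * \<bar>p (x - z) - p x\<bar> * mollifier n z)"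
          using integrable_mult_right[OF integrable_abs[OF mollify_diff(2)[OF p, of x n]], of "\<bar>Z x\<bar>"]
          by (simp add: abs_mult mollifier_nonneg mult.assoc)
        have "\<bar>Z x * (mollify n p x - p x)\<bar> = \<bar>Z x\<bar> * \<bar>LINT z|lborel. (p (x - z) - p x) * mollifier n z\<bar>"
          by (simp add: abs_mult mollify_diff(1)[OF p])
        also have "\<dots> \<le> \<bar>Z x\<bar> * (LINT z|lborel. \<bar>(p (x - z) - p x) * mollifier n z\<bar>)"
          by (intro mult_left_mono integral_abs_bound) simp
        also have "\<dots> = (LINT z|lborel. \<bar>Z x\<bar> * \<bar>p (x - z) - p x\<bar> * mollifier n z)"
          by (subst integral_mult_right_zero[symmetric]) (simp add: abs_mult mollifier_nonneg mult.assoc)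
        finally have "ennreal \<bar>Z x * (mollify n p x - p x)\<bar> \<le> ennreal (LINT z|lborel. \<bar>Z x\<bar> * \<bar>p (x - z) - p x\<bar> * mollifier n z)"
          by (rule ennreal_leI)
        also have "\<dots> = (\<integral>\<^sup>+z. ennreal (\<bar>Z x\<bar> * \<bar>p (x - z) - p x\<bar> * mollifier n z) \<partial>lborel)"
          by (rule nn_integral_eq_integral[symmetric]) (use i in \<open>auto simp: mollifier_nonneg\<close>)
        finally show "ennreal \<bar>Z x * (mollify n p x - p x)\<bar> \<le> (\<integral>\<^sup>+z. ennreal (\<bar>Z x\<bar> * \<bar>p (x - z) - p x\<bar> * mollifier n z) \<partial>lborel)" .
      qed
      \<comment> \<open>Exchanging the order leaves an inner integral in x for one fixed shift,
        which is \<open>W (- z)\<close> times the kernel value.\<close>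
      also have "\<dots> = (\<integral>\<^sup>+z. (\<integral>\<^sup>+x. ennreal (\<bar>Z x\<bar> * \<bar>p (x - z) - p x\<bar> * mollifier n z) \<partial>lborel) \<partial>lborel)"
        using p Z by (intro lborel_pair.Fubini'[symmetric]) (simp add: case_prod_unfold, measurable)
      also have "\<dots> \<le> (\<integral>\<^sup>+z. ennreal (mollifier n (z::'a) * e) \<partial>lborel)"
      proof (rule nn_integral_mono)
        fix z :: 'a
        have "integrable lborel (\<lambda>x. mollifier n z * (\<bar>Z x\<bar> * \<bar>p (x + (- z)) - p x\<bar>))"
          using int by (rule integrable_mult_right)
        then have "(\<integral>\<^sup>+x. ennreal (\<bar>Z x\<bar> * \<bar>p (x - z) - p x\<bar> * mollifier n z) \<partial>lborel) = ennreal (mollifier n z * W (- z))"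
          unfolding W_def
          by (subst nn_integral_eq_integral) (auto simp: mollifier_nonneg mult.commute)
        also have "\<dots> \<le> ennreal (mollifier n z * e)"
        \<comment> \<open>Smallness of \<open>W\<close> is known for short shifts only; for long
          ones the kernel factor is 0.\<close>
        proof (cases "mollifier n z = 0")
          case False
          then have "norm (- z) < d" using mollifier_support[of n z] elim by simp
          then show ?thesis using W mollifier_nonneg by (intro ennreal_leI mult_left_mono) auto
        qed simp
        finally show "(\<integral>\<^sup>+x. ennreal (\<bar>Z x\<bar> * \<bar>p (x - z) - p x\<bar> * mollifier n z) \<partial>lborel) \<le> ennreal (mollifier n z * e)" .
      qed
      also have "\<dots> = ennreal (LINT z|lborel. mollifier n (z::'a) * e)"
        using e by (intro nn_integral_eq_integral integrable_mult_left integrable_mollifier) (auto simp: mollifier_nonneg)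
      also have "\<dots> = ennreal e" by (simp add: integral_mollifier)
      finally show ?case .
    qed
  qed
  have meas: "(\<lambda>x. Z x * (mollify n p x - p x)) \<in> borel_measurable borel" for n
    using mollify_measurable[OF p] Z p by measurable
  show ev: "\<forall>\<^sub>F n in sequentially. integrable lborel (\<lambda>x. Z x * (mollify n p x - p x))"
    using key[OF zero_less_one]
  proof eventually_elim
    case (elim n)
    show ?case
      by (rule integrableI_bounded) (use meas[of n] elim in \<open>auto intro: le_less_trans\<close>)
  qed
  show "(\<lambda>n. LINT x|lborel. \<bar>Z x * (mollify n p x - p x)\<bar>) \<longlonglongrightarrow> 0"
  proof (rule tendstoI)
    fix e :: real assume e: "e > 0"
    show "\<forall>\<^sub>F n in sequentially. dist (LINT x|lborel. \<bar>Z x * (mollify n p x - p x)\<bar>) 0 < e"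
      using ev key[OF half_gt_zero[OF e]]
    proof eventually_elim
      case (elim n)
      have "ennreal (LINT x|lborel. \<bar>Z x * (mollify n p x - p x)\<bar>) \<le> ennreal (e / 2)"
        using elim by (subst nn_integral_eq_integral[symmetric]) auto
      then have "(LINT x|lborel. \<bar>Z x * (mollify n p x - p x)\<bar>) \<le> e / 2"
        using e by (simp add: ennreal_le_iff)
      moreover have "(LINT x|lborel. \<bar>Z x * (mollify n p x - p x)\<bar>) \<ge> 0" by simp
      ultimately show ?case using e by (simp add: dist_real_def)
    qed
  qed
qed

lemma mollify_cong_AE:
  assumes "AE x in lebesgue. f x = g x" "f \<in> borel_measurable lebesgue" "g \<in> borel_measurable lebesgue"
  shows "mollify n f x = mollify n g x"
proof -
  have [measurable]: "(\<lambda>y. mollifier n (x - y)) \<in> borel_measurable lebesgue"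
    by (rule measurable_completion) simp
  show ?thesis
    unfolding mollify_def using assms by (intro integral_cong_AE) auto
qed

lemma borel_representative:
  fixes f :: "'a::euclidean_space \<Rightarrow> real"
  assumes "f \<in> borel_measurable lebesgue"
  obtains g where "g \<in> borel_measurable borel" "AE x in lebesgue. f x = g x"
    "g \<in> borel_measurable lebesgue"
proof -
  obtain g where "g \<in> borel_measurable lborel" "AE x in lborel. f x = g x"
    using completion_ex_borel_measurable_real[OF assms] by blast
  then show ?thesis
    using that[of g] by (simp add: AE_completion measurable_completion)
qed

lemma mollify_L1:
  fixes f :: "'a::euclidean_space \<Rightarrow> real"
  assumes f: "integrable lebesgue f"
  shows "(\<lambda>n. LINT x|lebesgue. \<bar>mollify n f x - f x\<bar>) \<longlonglongrightarrow> 0"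
    and "\<forall>\<^sub>F n in sequentially. integrable lebesgue (\<lambda>x. mollify n f x - f x)"
proof -
  have fm: "f \<in> borel_measurable lebesgue" using f by auto
  obtain g where g: "g \<in> borel_measurable borel" and fg: "AE x in lebesgue. f x = g x"
    and gm: "g \<in> borel_measurable lebesgue"
    using borel_representative[OF fm] by blast
  have "integrable lebesgue g" using f fg gm fm by (simp add: integrable_cong_AE[of f _ g])
  then have gi: "integrable lborel g" using g by (simp add: integrable_completion)
  have i: "integrable lborel (\<lambda>x. \<bar>1::real\<bar> * \<bar>g (x + a) - g x\<bar>)" for a
    using integrable_shift[OF gi] gi by simp
  have l: "(\<lambda>n. LINT x|lborel. \<bar>1::real\<bar> * \<bar>g (x + a n) - g x\<bar>) \<longlonglongrightarrow> 0" if "a \<longlonglongrightarrow> 0" for a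
    using tendsto_integral_shift[OF g gi that] by simp
  have W: "(\<lambda>n. LINT x|lborel. \<bar>1 * (mollify n g x - g x)\<bar>) \<longlonglongrightarrow> 0"
    "\<forall>\<^sub>F n in sequentially. integrable lborel (\<lambda>x. 1 * (mollify n g x - g x))"
    by (rule mollify_weighted[OF g gi _ i l]; simp)+
  have "(LINT x|lebesgue. \<bar>mollify n f x - f x\<bar>) = (LINT x|lborel. \<bar>1 * (mollify n g x - g x)\<bar>)
     \<and> (integrable lborel (\<lambda>x. 1 * (mollify n g x - g x)) \<longrightarrow> integrable lebesgue (\<lambda>x. mollify n f x - f x))" for n
  proof -
    have m0: "mollify n g \<in> borel_measurable borel" by (rule mollify_measurable[OF g gi])
    then have m: "(\<lambda>x. \<bar>mollify n g x - g x\<bar>) \<in> borel_measurable borel" using g by simp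
    have m': "mollify n g \<in> borel_measurable lebesgue"
      using m0 by (simp add: measurable_completion)
    have "(LINT x|lebesgue. \<bar>mollify n f x - f x\<bar>) = (LINT x|lebesgue. \<bar>mollify n g x - f x\<bar>)"
      using mollify_cong_AE[OF fg fm gm] by simp
    also have "\<dots> = (LINT x|lebesgue. \<bar>mollify n g x - g x\<bar>)"
      by (intro integral_cong_AE) (use fg fm gm m' in \<open>auto elim: AE_mp\<close>)
    also have "\<dots> = (LINT x|lborel. \<bar>mollify n g x - g x\<bar>)"
      using m by (simp add: integral_completion)
    finally have 1: "(LINT x|lebesgue. \<bar>mollify n f x - f x\<bar>) = (LINT x|lborel. \<bar>1 * (mollify n g x - g x)\<bar>)" by simp
    have "integrable lebesgue (\<lambda>x. mollify n f x - f x)" if "integrable lborel (\<lambda>x. 1 * (mollify n g x - g x))"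
    proof -
      have "integrable lebesgue (\<lambda>x. mollify n g x - g x)"
        using that m0 g by (simp add: integrable_completion)
      then have "integrable lebesgue (\<lambda>x. mollify n g x - f x)"
        by (rule integrable_cong_AE_imp) (use fg fm m' in \<open>auto elim: AE_mp\<close>)
      then show ?thesis using mollify_cong_AE[OF fg fm gm] by simp
    qed
    with 1 show ?thesis by blast
  qed
  with W show "(\<lambda>n. LINT x|lebesgue. \<bar>mollify n f x - f x\<bar>) \<longlonglongrightarrow> 0"
    "\<forall>\<^sub>F n in sequentially. integrable lebesgue (\<lambda>x. mollify n f x - f x)"
    by (auto elim: eventually_mono)
qed

text \<open>Convergence against one fixed square integrable \<open>Z\<close> is what the limits
  below require, and the weighted estimate gives it directly. Integrability of \<open>p\<close>
  makes the convolution meaningful; its square integrability makes the pairing converge.\<close>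

lemma mollify_pairing:
  fixes p Z :: "'a::euclidean_space \<Rightarrow> real"
  assumes p: "integrable lebesgue p" "integrable lebesgue (\<lambda>x. (p x)\<^sup>2)"
    and Z: "Z \<in> borel_measurable lebesgue" "integrable lebesgue (\<lambda>x. (Z x)\<^sup>2)"
  shows "(\<lambda>n. LINT x|lebesgue. Z x * mollify n p x) \<longlonglongrightarrow> (LINT x|lebesgue. Z x * p x)"
proof -
  have pm: "p \<in> borel_measurable lebesgue" using p by auto
  obtain q where q: "q \<in> borel_measurable borel" and pq: "AE x in lebesgue. p x = q x"
    and qm: "q \<in> borel_measurable lebesgue"
    using borel_representative[OF pm] by blast
  obtain Y where Y: "Y \<in> borel_measurable borel" and ZY: "AE x in lebesgue. Z x = Y x"
    and Ym: "Y \<in> borel_measurable lebesgue"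
    using borel_representative[OF Z(1)] by blast
  have "integrable lebesgue q" 
    using p(1) pq qm pm by (simp add: integrable_cong_AE[of p _ q])
  then have qi: "integrable lborel q" using q by (simp add: integrable_completion)
  have "integrable lebesgue (\<lambda>x. (q x)\<^sup>2)"
    by (rule integrable_cong_AE_imp[OF p(2)]) (use pq qm in auto)
  then have qi2: "integrable lborel (\<lambda>x. (q x)\<^sup>2)" using q by (simp add: integrable_completion)
  have "integrable lebesgue (\<lambda>x. (Y x)\<^sup>2)"
    by (rule integrable_cong_AE_imp[OF Z(2)]) (use ZY Ym in auto)
  then have Yi2: "integrable lborel (\<lambda>x. (Y x)\<^sup>2)" using Y by (simp add: integrable_completion)
  have i: "integrable lborel (\<lambda>x. \<bar>Y x\<bar> * \<bar>q (x + a) - q x\<bar>)" for a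
  proof -
    have "integrable lborel (\<lambda>x. Y x * q (x + a))" "integrable lborel (\<lambda>x. Y x * q x)"
      by (intro integrable_mult_squares; use q Y Yi2 qi2 integrable_shift[OF qi2] in simp)+
    then have "integrable lborel (\<lambda>x. \<bar>Y x * q (x + a) - Y x * q x\<bar>)" by auto
    then show ?thesis by (simp add: abs_mult[symmetric] right_diff_distrib)
  qed
  have l0: "(\<lambda>n. LINT x|lborel. \<bar>Y x\<bar> * \<bar>q (x + a n) - q x\<bar>) \<longlonglongrightarrow> 0" if "a \<longlonglongrightarrow> 0" for a
    by (rule tendsto_integral_shift_weighted[OF q qi qi2 Y Yi2 that])
  have W: "(\<lambda>n. LINT x|lborel. \<bar>Y x * (mollify n q x - q x)\<bar>) \<longlonglongrightarrow> 0"
    "\<forall>\<^sub>F n in sequentially. integrable lborel (\<lambda>x. Y x * (mollify n q x - q x))"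
    by (rule mollify_weighted[OF q qi Y i l0]; assumption)+
  have Yq: "integrable lborel (\<lambda>x. Y x * q x)"
    by (intro integrable_mult_squares; use q Y Yi2 qi2 in simp)
  have "(\<lambda>n. LINT x|lborel. Y x * (mollify n q x - q x)) \<longlonglongrightarrow> 0"
    by (rule Lim_null_comparison[OF _ W(1)]) (auto intro!: always_eventually integral_abs_bound)
  then have l: "(\<lambda>n. (LINT x|lborel. Y x * (mollify n q x - q x)) + (LINT x|lborel. Y x * q x)) \<longlonglongrightarrow> 0 + (LINT x|lborel. Y x * q x)"
    by (intro tendsto_intros)
  have "(\<lambda>n. LINT x|lborel. Y x * mollify n q x) \<longlonglongrightarrow> (LINT x|lborel. Y x * q x)"
  proof (rule Lim_transform_eventually[OF l[unfolded add_0]])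
    show "\<forall>\<^sub>F n in sequentially. (LINT x|lborel. Y x * (mollify n q x - q x)) + (LINT x|lborel. Y x * q x) = (LINT x|lborel. Y x * mollify n q x)"
      using W(2)
    proof eventually_elim
      case (elim n)
      then have "(LINT x|lborel. Y x * (mollify n q x - q x)) + (LINT x|lborel. Y x * q x)
         = (LINT x|lborel. Y x * (mollify n q x - q x) + Y x * q x)"
        using Yq by simp
      then show ?case by (simp add: right_diff_distrib)
    qed
  qed
  moreover have "(LINT x|lebesgue. Z x * mollify n p x) = (LINT x|lborel. Y x * mollify n q x)" for n
  proof -
    have m: "mollify n q \<in> borel_measurable borel" by (rule mollify_measurable[OF q qi])
    then have m': "mollify n q \<in> borel_measurable lebesgue" by (simp add: measurable_completion)
    have "(LINT x|lebesgue. Z x * mollify n p x) = (LINT x|lebesgue. Z x * mollify n q x)"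
      using mollify_cong_AE[OF pq pm qm] by simp
    also have "\<dots> = (LINT x|lebesgue. Y x * mollify n q x)"
      by (intro integral_cong_AE) (use ZY Z Ym m' in \<open>auto elim: AE_mp\<close>)
    also have "\<dots> = (LINT x|lborel. Y x * mollify n q x)"
      using m Y by (simp add: integral_completion)
    finally show ?thesis .
  qed
  moreover have "(LINT x|lebesgue. Z x * p x) = (LINT x|lborel. Y x * q x)"
  proof -
    have "AE x in lebesgue. Z x * p x = Y x * q x" using ZY pq by eventually_elim simp
    then have "(LINT x|lebesgue. Z x * p x) = (LINT x|lebesgue. Y x * q x)"
      using Z pm Ym qm by (intro integral_cong_AE) auto
    then show ?thesis using q Y by (simp add: integral_completion)
  qed
  ultimately show ?thesis by simp
qed

text \<open>The derivative falls on the kernel. Its difference quotients are bounded by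
  \<open>B\<close> through the mean value inequality, so \<open>B\<close> times the absolute value
  of \<open>f\<close> dominates.\<close>

lemma has_partial_convolution:
  fixes f k k' :: "'a::euclidean_space \<Rightarrow> real"
  assumes f: "integrable lebesgue f" and k: "has_partial i k k'"
    and B: "\<And>x. \<bar>k x\<bar> \<le> B" "\<And>x. \<bar>k' x\<bar> \<le> B"
  shows "has_partial i (\<lambda>x. LINT y|lebesgue. f y * k (x - y)) (\<lambda>x. LINT y|lebesgue. f y * k' (x - y))"
proof -
  have fm[measurable]: "f \<in> borel_measurable lebesgue" using f by auto
  have ck: "continuous_on UNIV k" and ck': "continuous_on UNIV k'" using k by (auto simp: has_partial_def)
  have meas: "(\<lambda>y. g (x - y)) \<in> borel_measurable lebesgue" if "continuous_on UNIV g" for g :: "'a \<Rightarrow> real" and x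
    by (rule measurable_completion) (use borel_measurable_continuous_onI[OF that] in simp)
  have int: "integrable lebesgue (\<lambda>y. f y * g (x - y))" if "continuous_on UNIV g" "\<And>x. \<bar>g x\<bar> \<le> B" for g x
  proof (rule Bochner_Integration.integrable_bound[of _ "\<lambda>y. \<bar>f y\<bar> * B"])
    show "(\<lambda>y. f y * g (x - y)) \<in> borel_measurable lebesgue" using meas[OF that(1)] by measurable
    show "AE y in lebesgue. norm (f y * g (x - y)) \<le> norm (\<bar>f y\<bar> * B)"
    proof (rule AE_I2)
      fix y
      have "\<bar>f y\<bar> * \<bar>g (x - y)\<bar> \<le> \<bar>f y\<bar> * \<bar>B\<bar>"
        using that(2)[of "x - y"] by (intro mult_left_mono) auto
      then show "norm (f y * g (x - y)) \<le> norm (\<bar>f y\<bar> * B)" by (simp add: abs_mult)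
    qed
  qed (use f in simp)
  have cont: "continuous_on UNIV (\<lambda>x. LINT y|lebesgue. f y * g (x - y))"
    if g: "continuous_on UNIV g" "\<And>x. \<bar>g x\<bar> \<le> B" for g
  proof (rule continuous_at_imp_continuous_on, rule ballI)
    fix x :: 'a
    show "isCont (\<lambda>x. LINT y|lebesgue. f y * g (x - y)) x"
      unfolding continuous_at_sequentially
    proof (intro allI impI)
      fix X assume X: "X \<longlonglongrightarrow> x"
      have "(\<lambda>n. LINT y|lebesgue. f y * g (X n - y)) \<longlonglongrightarrow> (LINT y|lebesgue. f y * g (x - y))"
      proof (rule integral_dominated_convergence[where w = "\<lambda>y. \<bar>f y\<bar> * B"])
        show "(\<lambda>y. f y * g (x - y)) \<in> borel_measurable lebesgue" using meas[OF g(1)] by measurable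
        show "(\<lambda>y. f y * g (X n - y)) \<in> borel_measurable lebesgue" for n using meas[OF g(1)] by measurable
        show "AE y in lebesgue. (\<lambda>n. f y * g (X n - y)) \<longlonglongrightarrow> f y * g (x - y)"
        proof (rule AE_I2)
          fix y
          have "(\<lambda>n. g (X n - y)) \<longlonglongrightarrow> g (x - y)"
            by (rule continuous_on_tendsto_compose[OF g(1)]) (auto intro!: tendsto_intros X)
          then show "(\<lambda>n. f y * g (X n - y)) \<longlonglongrightarrow> f y * g (x - y)" by (intro tendsto_intros)
        qed
        show "AE y in lebesgue. norm (f y * g (X n - y)) \<le> \<bar>f y\<bar> * B" for n
          using g(2) by (auto simp: abs_mult intro!: mult_left_mono)
      qed (use f in simp)
      then show "((\<lambda>x. LINT y|lebesgue. f y * g (x - y)) \<circ> X) \<longlonglongrightarrow> (LINT y|lebesgue. f y * g (x - y))"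
        by (simp add: o_def)
    qed
  qed
  have "((\<lambda>t. LINT y|lebesgue. f y * k (x + t *\<^sub>R i - y)) has_real_derivative (LINT y|lebesgue. f y * k' (x - y))) (at 0)" for x
    unfolding has_field_derivative_iff
  proof (rule tendsto_at_0_sequentiallyI)
    fix t :: "nat \<Rightarrow> real" assume t: "t \<longlonglongrightarrow> 0" "\<And>n. t n \<noteq> 0"
    define Q where "Q n y = (k (x + t n *\<^sub>R i - y) - k (x - y)) / t n" for n y
    have Qb: "\<bar>Q n y\<bar> \<le> B" for n y
    proof -
      have D: "((\<lambda>s. k ((x - y) + s *\<^sub>R i)) has_real_derivative k' ((x - y) + s *\<^sub>R i)) (at s)" for s
        by (rule has_partial_line[OF k])
      have "\<bar>k ((x - y) + t n *\<^sub>R i) - k ((x - y) + 0 *\<^sub>R i)\<bar> \<le> B * \<bar>t n - 0\<bar>"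
        using field_differentiable_bound[of UNIV "\<lambda>s. k ((x - y) + s *\<^sub>R i)" "\<lambda>s. k' ((x - y) + s *\<^sub>R i)" B "t n" 0] D B(2)
        by (auto simp: convex_UNIV)
      then show ?thesis using t(2)[of n] by (simp add: Q_def abs_divide field_simps)
    qed
    have "(\<lambda>n. LINT y|lebesgue. f y * Q n y) \<longlonglongrightarrow> (LINT y|lebesgue. f y * k' (x - y))"
    proof (rule integral_dominated_convergence[where w = "\<lambda>y. \<bar>f y\<bar> * B"])
      show "(\<lambda>y. f y * k' (x - y)) \<in> borel_measurable lebesgue" using meas[OF ck'] by measurable
      show "(\<lambda>y. f y * Q n y) \<in> borel_measurable lebesgue" for n
        unfolding Q_def using meas[OF ck] by measurable
      show "AE y in lebesgue. (\<lambda>n. f y * Q n y) \<longlonglongrightarrow> f y * k' (x - y)"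
      proof (rule AE_I2)
        fix y
        have "((\<lambda>h. (k ((x - y) + h *\<^sub>R i) - k (x - y)) / h) \<longlongrightarrow> k' (x - y)) (at 0)"
          using k by (auto simp: has_partial_def has_field_derivative_iff)
        then have "(\<lambda>n. Q n y) \<longlonglongrightarrow> k' (x - y)"
          unfolding tendsto_at_iff_sequentially Q_def o_def using t by (auto simp: algebra_simps)
        then show "(\<lambda>n. f y * Q n y) \<longlonglongrightarrow> f y * k' (x - y)" by (intro tendsto_intros)
      qed
      show "AE y in lebesgue. norm (f y * Q n y) \<le> \<bar>f y\<bar> * B" for n
        using Qb by (auto simp: abs_mult intro!: mult_left_mono)
    qed (use f in simp)
    moreover have "(LINT y|lebesgue. f y * Q n y)
       = ((LINT y|lebesgue. f y * k (x + (0 + t n) *\<^sub>R i - y)) - (LINT y|lebesgue. f y * k (x + 0 *\<^sub>R i - y))) / t n" for n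
    proof -
      have "(LINT y|lebesgue. f y * Q n y) = (LINT y|lebesgue. (f y * k (x + t n *\<^sub>R i - y) - f y * k (x - y)) / t n)"
        by (simp add: Q_def right_diff_distrib)
      then show ?thesis using int[OF ck B(1)] by simp
    qed
    ultimately show "(\<lambda>n. ((LINT y|lebesgue. f y * k (x + (t n) *\<^sub>R i - y)) - (LINT y|lebesgue. f y * k (x + 0 *\<^sub>R i - y))) / (t n - 0)) \<longlonglongrightarrow> (LINT y|lebesgue. f y * k' (x - y))"
      by simp
  qed
  with cont[OF ck B(1)] cont[OF ck' B(2)] show ?thesis
    unfolding has_partial_def by simp
qed

section \<open>Weak partial derivatives\<close>

text \<open>The gradient is treated one direction at a time because integration by parts, truncation
  and the crossed integrals each concern single components.\<close>

definition weak_partial :: "'a::euclidean_space set \<Rightarrow> 'a \<Rightarrow> ('a \<Rightarrow> real) \<Rightarrow> ('a \<Rightarrow> real) \<Rightarrow> bool" where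
  "weak_partial \<Omega> i u d \<longleftrightarrow> locally_integrable \<Omega> u \<and> locally_integrable \<Omega> d \<and>
     (\<forall>\<phi>\<in>test_fun \<Omega>. (LINT x|lebesgue_on \<Omega>. u x * frechet_derivative \<phi> (at x) i)
        = - (LINT x|lebesgue_on \<Omega>. d x * \<phi> x))"

lemma has_weak_grad_iff_weak_partial:
  "has_weak_grad \<Omega> u D \<longleftrightarrow> (\<forall>i\<in>Basis. weak_partial \<Omega> i u (\<lambda>x. D x \<bullet> i))"
proof -
  have "locally_integrable \<Omega> D" if "\<forall>i\<in>Basis. locally_integrable \<Omega> (\<lambda>x. D x \<bullet> i)"
    unfolding locally_integrable_def
  proof (intro allI impI)
    fix K assume "compact K \<and> K \<subseteq> \<Omega>"
    then have "integrable (lebesgue_on K) (\<lambda>x. \<Sum>i\<in>Basis. (D x \<bullet> i) *\<^sub>R i)"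
      using that by (intro Bochner_Integration.integrable_sum integrable_scaleR_left) (auto simp: locally_integrable_def)
    then show "integrable (lebesgue_on K) D" by (simp add: euclidean_representation)
  qed
  moreover have "locally_integrable \<Omega> (\<lambda>x. D x \<bullet> i)" if "locally_integrable \<Omega> D" for i
    using that by (auto simp: locally_integrable_def)
  moreover have "Basis \<noteq> {}" by simp
  ultimately show ?thesis
    unfolding has_weak_grad_def weak_partial_def by blast
qed

lemma test_fun_support:
  assumes "\<phi> \<in> test_fun \<Omega>"
  obtains K where "compact K" "K \<subseteq> \<Omega>" "\<And>x. x \<notin> K \<Longrightarrow> \<phi> x = 0"
    "\<And>i x. i \<in> Basis \<Longrightarrow> x \<notin> K \<Longrightarrow> frechet_derivative \<phi> (at x) i = 0"
proof
  let ?K = "closure {x. \<phi> x \<noteq> 0}"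
  show K: "compact ?K" "?K \<subseteq> \<Omega>" using assms by (auto simp: test_fun_def)
  show 0: "\<phi> x = 0" if "x \<notin> ?K" for x
    using that closure_subset[of "{x. \<phi> x \<noteq> 0}"] by auto
  have C: "\<And>k. C_k k \<phi>" using assms by (simp add: test_fun_def)
  show "frechet_derivative \<phi> (at x) i = 0" if "i \<in> Basis" "x \<notin> ?K" for i x
    by (rule has_partial_zero_outside[OF has_partial_C_k[OF C that(1)] _ 0 that(2)]) auto
qed

lemma test_fun_partial:
  "\<phi> \<in> test_fun \<Omega> \<Longrightarrow> i \<in> Basis \<Longrightarrow> has_partial i \<phi> (\<lambda>x. frechet_derivative \<phi> (at x) i)"
  by (rule has_partial_C_k) (auto simp: test_fun_def)

lemma test_fun_partial_support:
  assumes "\<phi> \<in> test_fun \<Omega>" "i \<in> Basis"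
  obtains K where "compact K" "K \<subseteq> \<Omega>" "\<And>x. x \<notin> K \<Longrightarrow> \<phi> x = 0" "\<And>x. x \<notin> K \<Longrightarrow> frechet_derivative \<phi> (at x) i = 0"
    "continuous_on UNIV \<phi>" "continuous_on UNIV (\<lambda>x. frechet_derivative \<phi> (at x) i)"
  using test_fun_support[OF assms(1)] test_fun_partial[OF assms] assms(2) unfolding has_partial_def by metis

section \<open>Integrals over subsets, and products of convergent sequences\<close>

lemma compact_lebesgue_sets: "compact K \<Longrightarrow> K \<in> sets lebesgue"
  and open_lebesgue_sets: "open U \<Longrightarrow> U \<in> sets lebesgue"
  for K U :: "'a::euclidean_space set"
  by (auto simp: borel_compact)

lemma integral_on_support:
  fixes g :: "'a::euclidean_space \<Rightarrow> real"
  assumes "S \<in> sets lebesgue" "T \<in> sets lebesgue" "S \<subseteq> T" "\<And>x. x \<in> T \<Longrightarrow> x \<notin> S \<Longrightarrow> g x = 0"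
  shows "(LINT x|lebesgue_on T. g x) = (LINT x|lebesgue_on S. g x)"
proof -
  have "indicator T x *\<^sub>R g x = indicator S x *\<^sub>R g x" for x
    using assms(3,4) by (auto simp: indicator_def)
  then have "(LINT x|lebesgue. indicator T x *\<^sub>R g x) = (LINT x|lebesgue. indicator S x *\<^sub>R g x)"
    by presburger
  then show ?thesis
    using assms(1,2) integral_restrict_space[of S lebesgue g] integral_restrict_space[of T lebesgue g] by simp
qed

lemma continuous_integrable_on_compact:
  fixes g :: "'a::euclidean_space \<Rightarrow> real"
  assumes "continuous_on UNIV g" "compact K"
  shows "integrable (lebesgue_on K) g"
proof -
  have "integrable lborel (\<lambda>x. indicator K x *\<^sub>R g x)"
    by (rule borel_integrable_compact[OF assms(2) continuous_on_subset[OF assms(1)]]) simp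
  then have "integrable lebesgue (\<lambda>x. indicator K x *\<^sub>R g x)"
    using assms by (subst integrable_completion) (auto simp: borel_measurable_continuous_onI borel_compact)
  then show ?thesis using assms by (simp add: integrable_restrict_space compact_lebesgue_sets)
qed

lemma continuous_measurable_lebesgue_on:
  fixes g :: "'a::euclidean_space \<Rightarrow> real"
  assumes "continuous_on UNIV g"
  shows "g \<in> borel_measurable (lebesgue_on S)"
proof (rule measurable_restrict_space1)
  show "g \<in> borel_measurable lebesgue"
    by (rule measurable_completion) (simp add: borel_measurable_continuous_onI assms)
qed

lemma integral_partial_zero_on:
  fixes f :: "'a::euclidean_space \<Rightarrow> real"
  assumes p: "has_partial i f g" and S: "compact S" "\<And>x. x \<notin> S \<Longrightarrow> f x = 0"
  shows "(LINT x|lebesgue_on S. g x) = 0"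
proof -
  have g0: "g x = 0" if "x \<notin> S" for x
    by (rule has_partial_zero_outside[OF p compact_imp_closed[OF S(1)] S(2) that])
  have "(LINT x|lebesgue_on S. g x) = (LINT x|lebesgue_on UNIV. g x)"
    using g0 S(1) by (intro integral_on_support[symmetric]) (auto simp: compact_lebesgue_sets)
  also have "\<dots> = (LINT x|lborel. g x)"
    using p by (simp add: lebesgue_on_UNIV_eq integral_completion has_partial_def borel_measurable_continuous_onI)
  also have "\<dots> = 0" by (rule integral_partial_zero[OF p S g0])
  finally show ?thesis .
qed

text \<open>Write the error as \<open>c n * (f n - f0) + (c n - c0) * f0\<close>: the uniform bound
  on \<open>c n\<close> handles the first term, dominated convergence the second. Since gradients of
  the approximating functions converge in L1 alone, this is where boundedness of the other factors
  is consumed.\<close>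

lemma L1_tendsto_mult:
  fixes c :: "nat \<Rightarrow> 'a \<Rightarrow> real"
  assumes f: "\<And>n. integrable M (f n)" "integrable M f0" "(\<lambda>n. LINT x|M. \<bar>f n x - f0 x\<bar>) \<longlonglongrightarrow> 0"
    and c: "\<And>n. c n \<in> borel_measurable M" "c0 \<in> borel_measurable M"
      "\<And>n x. x \<in> space M \<Longrightarrow> \<bar>c n x\<bar> \<le> B" "AE x in M. (\<lambda>n. c n x) \<longlonglongrightarrow> c0 x"
  shows "(\<lambda>n. LINT x|M. \<bar>c n x * f n x - c0 x * f0 x\<bar>) \<longlonglongrightarrow> 0"
    and "\<And>n. integrable M (\<lambda>x. c n x * f n x)" and "integrable M (\<lambda>x. c0 x * f0 x)"
    and "(\<lambda>n. LINT x|M. c n x * f n x) \<longlonglongrightarrow> (LINT x|M. c0 x * f0 x)"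
proof -
  have [measurable]: "f n \<in> borel_measurable M" "f0 \<in> borel_measurable M" for n using f by auto
  note [measurable] = c(1,2)
  have c0B: "AE x in M. \<bar>c0 x\<bar> \<le> B"
    using c(4) AE_space
  proof eventually_elim
    case (elim x)
    show ?case
      by (rule LIMSEQ_le_const2[OF tendsto_rabs[OF elim(1)]]) (use c(3) elim in auto)
  qed
  show i1: "integrable M (\<lambda>x. c n x * f n x)" for n
  proof (rule Bochner_Integration.integrable_bound[of M "\<lambda>x. B * \<bar>f n x\<bar>"])
    have "\<bar>c n x\<bar> * \<bar>f n x\<bar> \<le> \<bar>B\<bar> * \<bar>f n x\<bar>" if "x \<in> space M" for x
      using c(3)[of x n] that by (intro mult_right_mono) auto
    then show "AE x in M. norm (c n x * f n x) \<le> norm (B * \<bar>f n x\<bar>)" by (auto simp: abs_mult)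
  qed (use f in auto)
  show i2: "integrable M (\<lambda>x. c0 x * f0 x)"
  proof (rule Bochner_Integration.integrable_bound[of M "\<lambda>x. B * \<bar>f0 x\<bar>"])
    show "AE x in M. norm (c0 x * f0 x) \<le> norm (B * \<bar>f0 x\<bar>)"
      using c0B by eventually_elim (auto simp: abs_mult intro!: mult_right_mono)
  qed (use f in auto)
  have i3: "integrable M (\<lambda>x. \<bar>c n x - c0 x\<bar> * \<bar>f0 x\<bar>)" for n
  proof (rule Bochner_Integration.integrable_bound[of M "\<lambda>x. (2 * B) * \<bar>f0 x\<bar>"])
    show "AE x in M. norm (\<bar>c n x - c0 x\<bar> * \<bar>f0 x\<bar>) \<le> norm ((2 * B) * \<bar>f0 x\<bar>)"
      using c0B AE_space
    proof eventually_elim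
      case (elim x)
      then have "\<bar>c n x - c0 x\<bar> \<le> \<bar>2 * B\<bar>" using c(3)[of x n] by linarith
      then show ?case by (simp add: abs_mult mult_right_mono)
    qed
  qed (use f in auto)
  have "(\<lambda>n. LINT x|M. \<bar>c n x - c0 x\<bar> * \<bar>f0 x\<bar>) \<longlonglongrightarrow> (LINT x|M. 0)"
  proof (rule integral_dominated_convergence[where w = "\<lambda>x. (2 * B) * \<bar>f0 x\<bar>"])
    show "AE x in M. (\<lambda>n. \<bar>c n x - c0 x\<bar> * \<bar>f0 x\<bar>) \<longlonglongrightarrow> 0"
      using c(4)
    proof eventually_elim
      case (elim x)
      then have "(\<lambda>n. \<bar>c n x - c0 x\<bar> * \<bar>f0 x\<bar>) \<longlonglongrightarrow> \<bar>c0 x - c0 x\<bar> * \<bar>f0 x\<bar>" by (intro tendsto_intros)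
      then show ?case by simp
    qed
    show "AE x in M. norm (\<bar>c n x - c0 x\<bar> * \<bar>f0 x\<bar>) \<le> (2 * B) * \<bar>f0 x\<bar>" for n
      using c0B AE_space
    proof eventually_elim
      case (elim x)
      then have "\<bar>c n x - c0 x\<bar> \<le> 2 * B" using c(3)[of x n] by linarith
      then show ?case by (simp add: abs_mult mult_right_mono)
    qed
  qed (use f in auto)
  then have l1: "(\<lambda>n. B * (LINT x|M. \<bar>f n x - f0 x\<bar>) + (LINT x|M. \<bar>c n x - c0 x\<bar> * \<bar>f0 x\<bar>)) \<longlonglongrightarrow> B * 0 + 0"
    using f(3) by (intro tendsto_intros) auto
  have le: "(LINT x|M. \<bar>c n x * f n x - c0 x * f0 x\<bar>)
     \<le> B * (LINT x|M. \<bar>f n x - f0 x\<bar>) + (LINT x|M. \<bar>c n x - c0 x\<bar> * \<bar>f0 x\<bar>)" for n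
  proof -
    have "(LINT x|M. \<bar>c n x * f n x - c0 x * f0 x\<bar>)
      \<le> (LINT x|M. B * \<bar>f n x - f0 x\<bar> + \<bar>c n x - c0 x\<bar> * \<bar>f0 x\<bar>)"
    proof (rule integral_mono)
      fix x assume x: "x \<in> space M"
      have "c n x * f n x - c0 x * f0 x = c n x * (f n x - f0 x) + (c n x - c0 x) * f0 x"
        by (simp add: algebra_simps)
      then have "\<bar>c n x * f n x - c0 x * f0 x\<bar> \<le> \<bar>c n x\<bar> * \<bar>f n x - f0 x\<bar> + \<bar>c n x - c0 x\<bar> * \<bar>f0 x\<bar>"
        by (metis abs_mult abs_triangle_ineq)
      also have "\<dots> \<le> B * \<bar>f n x - f0 x\<bar> + \<bar>c n x - c0 x\<bar> * \<bar>f0 x\<bar>"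
        using c(3)[OF x, of n] by (intro add_right_mono mult_right_mono) auto
      finally show "\<bar>c n x * f n x - c0 x * f0 x\<bar> \<le> B * \<bar>f n x - f0 x\<bar> + \<bar>c n x - c0 x\<bar> * \<bar>f0 x\<bar>" .
    qed (use i1 i2 i3 f in auto)
    also have "\<dots> = B * (LINT x|M. \<bar>f n x - f0 x\<bar>) + (LINT x|M. \<bar>c n x - c0 x\<bar> * \<bar>f0 x\<bar>)"
      using f i3 by simp
    finally show ?thesis .
  qed
  show L: "(\<lambda>n. LINT x|M. \<bar>c n x * f n x - c0 x * f0 x\<bar>) \<longlonglongrightarrow> 0"
    by (rule tendsto_sandwich[OF _ _ tendsto_const l1[simplified]]) (use le in \<open>auto intro!: always_eventually\<close>)
  have "(\<lambda>n. (LINT x|M. c n x * f n x) - (LINT x|M. c0 x * f0 x)) \<longlonglongrightarrow> 0"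
  proof (rule Lim_null_comparison[OF always_eventually L], rule allI)
    fix n
    have "(LINT x|M. c n x * f n x) - (LINT x|M. c0 x * f0 x) = (LINT x|M. c n x * f n x - c0 x * f0 x)"
      using i1 i2 by simp
    then show "norm ((LINT x|M. c n x * f n x) - (LINT x|M. c0 x * f0 x)) \<le> (LINT x|M. \<bar>c n x * f n x - c0 x * f0 x\<bar>)"
      using integral_abs_bound[of M "\<lambda>x. c n x * f n x - c0 x * f0 x"] by simp
  qed
  then show "(\<lambda>n. LINT x|M. c n x * f n x) \<longlonglongrightarrow> (LINT x|M. c0 x * f0 x)"
    by (simp add: LIM_zero_iff)
qed

lemma test_fun_mollifier_reflect:
  fixes x :: "'a::euclidean_space"
  assumes "cball x (DIM('a) / Suc n) \<subseteq> \<Omega>"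
  shows "(\<lambda>y. mollifier n (x - y)) \<in> test_fun \<Omega>"
proof -
  have "{y. mollifier n (x - y) \<noteq> 0} \<subseteq> cball x (DIM('a) / Suc n)"
    using mollifier_support[of n "x - _"] by (auto simp: dist_norm)
  then have s: "closure {y. mollifier n (x - y) \<noteq> 0} \<subseteq> cball x (DIM('a) / Suc n)"
    by (rule closure_minimal) simp
  have "compact (closure {y. mollifier n (x - y) \<noteq> 0})"
    using s by (meson bounded_cball bounded_subset closed_closure compact_eq_bounded_closed)
  then show ?thesis
    using s assms by (auto simp: test_fun_def intro: C_k_reflect C_k_mollifier)
qed

lemma frechet_derivative_mollifier_reflect:
  "frechet_derivative (\<lambda>y. mollifier n (x - y)) (at y) i = - mollifier_deriv n i (x - y)"
proof -
  have d: "mollifier n differentiable (at (x - y))" by (rule C_k_diffD[OF C_k_mollifier])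
  have "((\<lambda>y. mollifier n (x - y)) has_derivative (\<lambda>i. frechet_derivative (mollifier n) (at (x - y)) (- i))) (at y)"
  proof (rule has_derivative_compose[of "\<lambda>y. x - y" "\<lambda>i. - i" y UNIV "mollifier n", simplified])
    show "((-) x has_derivative uminus) (at y)" by (auto intro!: derivative_eq_intros)
  qed (use d in \<open>simp add: frechet_derivative_works\<close>)
  then show ?thesis
    using d by (simp add: frechet_derivative_eqI linear_frechet_derivative linear_neg)
qed

lemma mollifier_deriv_bounded:
  assumes "i \<in> Basis"
  obtains B where "\<And>x::'a::euclidean_space. \<bar>mollifier n x\<bar> \<le> B" "\<And>x::'a. \<bar>mollifier_deriv n i x\<bar> \<le> B"
proof -
  let ?S = "cball (0::'a) (DIM('a) / Suc n)"
  have p: "has_partial i (mollifier n) (mollifier_deriv n i)"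
    by (rule has_partial_C_k[OF C_k_mollifier assms])
  have z: "mollifier n x = 0" if "x \<notin> ?S" for x
    using mollifier_support[of n x] that by auto
  have z': "mollifier_deriv n i x = 0" if "x \<notin> ?S" for x
    by (rule has_partial_zero_outside[OF p _ z that]) auto
  obtain B where "\<And>x::'a. \<bar>mollifier n x\<bar> \<le> B"
    using continuous_compact_support_bounded[OF mollifier_continuous compact_cball z] by blast
  moreover have "continuous_on UNIV (mollifier_deriv n i)" using p by (simp add: has_partial_def)
  then obtain B' where "\<And>x::'a. \<bar>mollifier_deriv n i x\<bar> \<le> B'"
    by (rule continuous_compact_support_bounded[OF _ compact_cball z']) blast+
  ultimately show ?thesis using that[of "max B B'"] by (meson max.coboundedI1 max.coboundedI2)
qed

lemma mollify_partial:
  fixes f :: "'a::euclidean_space \<Rightarrow> real"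
  assumes f: "integrable lebesgue f" and i: "i \<in> Basis"
  shows "has_partial i (mollify n f) (\<lambda>x. LINT y|lebesgue. f y * mollifier_deriv n i (x - y))"
proof -
  obtain B where "\<And>x::'a. \<bar>mollifier n x\<bar> \<le> B" "\<And>x::'a. \<bar>mollifier_deriv n i x\<bar> \<le> B"
    using mollifier_deriv_bounded[OF i] by blast
  from has_partial_convolution[OF f has_partial_C_k[OF C_k_mollifier i] this]
  show ?thesis unfolding mollify_def[abs_def] .
qed

lemma integrable_indicator_lebesgue:
  fixes u :: "'a::euclidean_space \<Rightarrow> real"
  assumes "K \<in> sets lebesgue"
  shows "integrable lebesgue (\<lambda>x. indicator K x * u x) \<longleftrightarrow> integrable (lebesgue_on K) u"
  using assms by (simp add: integrable_restrict_space)

section \<open>Local approximation of weakly differentiable functions\<close>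

lemma compact_thicken:
  fixes K :: "'a::euclidean_space set"
  assumes "open \<Omega>" "compact K" "K \<subseteq> \<Omega>"
  obtains L r where "r > 0" "compact L" "L \<subseteq> \<Omega>" "\<And>x. x \<in> K \<Longrightarrow> cball x r \<subseteq> L"
proof -
  obtain e where e: "e > 0" "(\<Union>x\<in>K. cball x e) \<subseteq> \<Omega>"
    using compact_subset_open_imp_cball_epsilon_subset[OF assms(2,1,3)] by blast
  have "{x + y | x y. x \<in> K \<and> y \<in> cball 0 e} = (\<Union>x\<in>K. cball x e)"
  proof (intro set_eqI iffI)
    fix z assume "z \<in> (\<Union>x\<in>K. cball x e)"
    then obtain x where "x \<in> K" "dist x z \<le> e" by auto
    then show "z \<in> {x + y | x y. x \<in> K \<and> y \<in> cball 0 e}"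
      by (intro CollectI exI[of _ x] exI[of _ "z - x"]) (auto simp: dist_norm norm_minus_commute)
  next
    fix z assume "z \<in> {x + y | x y. x \<in> K \<and> y \<in> cball 0 e}"
    then obtain x y where "z = x + y" "x \<in> K" "norm y \<le> e" by auto
    then show "z \<in> (\<Union>x\<in>K. cball x e)" by (intro UN_I[of x]) (auto simp: dist_norm)
  qed
  then have "compact (\<Union>x\<in>K. cball x e)"
    using compact_sums[OF assms(2) compact_cball[of 0 e]] by simp
  then show ?thesis using e by (intro that[of e "\<Union>x\<in>K. cball x e"]) auto
qed

text \<open>Restricting to \<open>L\<close> makes the functions integrable on the whole space. The
  jump this creates is invisible from \<open>K\<close>: once the kernels are narrower than the
  thickening, their supports around points of \<open>K\<close> stay inside \<open>L\<close>, where
  they are test functions.\<close>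

lemma mollify_weak_partial:
  fixes u :: "'a::euclidean_space \<Rightarrow> real"
  assumes \<Omega>: "open \<Omega>" and w: "weak_partial \<Omega> i u d" and i: "i \<in> Basis" and K: "compact K" "K \<subseteq> \<Omega>"
  obtains L where "compact L" "K \<subseteq> L" "L \<subseteq> \<Omega>"
    "\<forall>\<^sub>F n in sequentially. \<forall>x\<in>K. (LINT y|lebesgue. indicator L y * u y * mollifier_deriv n i (x - y))
        = mollify n (\<lambda>y. indicator L y * d y) x"
proof -
  obtain L r where L: "r > 0" "compact L" "L \<subseteq> \<Omega>" "\<And>x. x \<in> K \<Longrightarrow> cball x r \<subseteq> L"
    by (rule compact_thicken[OF \<Omega> K]) (rule that)
  have "(\<lambda>n. real DIM('a) / Suc n) \<longlonglongrightarrow> 0" by (rule LIMSEQ_Suc, rule lim_const_over_n)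
  then have "\<forall>\<^sub>F n in sequentially. real DIM('a) / Suc n < r" using L(1) by (rule order_tendstoD)
  then have "\<forall>\<^sub>F n in sequentially. \<forall>x\<in>K. (LINT y|lebesgue. indicator L y * u y * mollifier_deriv n i (x - y))
        = mollify n (\<lambda>y. indicator L y * d y) x"
  proof eventually_elim
    case (elim n)
    show ?case
    proof
      fix x assume x: "x \<in> K"
      have sub: "cball x (DIM('a) / Suc n) \<subseteq> L" using elim L(4)[OF x] by (auto simp: subset_iff)
      have m0: "mollifier n (x - y) = 0" if "y \<notin> L" for y
      proof (rule ccontr)
        assume "mollifier n (x - y) \<noteq> 0"
        then have "y \<in> cball x (DIM('a) / Suc n)" using mollifier_support[of n "x - y"] by (simp add: dist_norm)
        then show False using sub that by blast
      qed
      have t: "(\<lambda>y. mollifier n (x - y)) \<in> test_fun \<Omega>"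
        by (rule test_fun_mollifier_reflect[OF order_trans[OF sub L(3)]])
      have int: "(LINT y|lebesgue. indicator L y * g y * h y) = (LINT y|lebesgue_on \<Omega>. g y * h y)"
        if "\<And>y. y \<notin> L \<Longrightarrow> h y = 0" for g h :: "'a \<Rightarrow> real"
      proof -
        have "(LINT y|lebesgue_on \<Omega>. g y * h y) = (LINT y|lebesgue_on L. g y * h y)"
          using L \<Omega> that by (intro integral_on_support) (auto simp: compact_lebesgue_sets open_lebesgue_sets)
        then show ?thesis using L(2) by (simp add: integral_restrict_space compact_lebesgue_sets mult.assoc)
      qed
      show "(LINT y|lebesgue. indicator L y * u y * mollifier_deriv n i (x - y))
        = mollify n (\<lambda>y. indicator L y * d y) x"
      proof -
        have fr: "mollifier_deriv n i (x - y) = - frechet_derivative (\<lambda>y. mollifier n (x - y)) (at y) i" for y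
          by (simp add: frechet_derivative_mollifier_reflect)
        have d0: "mollifier_deriv n i (x - y) = 0" if "y \<notin> L" for y
          using has_partial_zero_outside[OF has_partial_reflect[OF has_partial_C_k[OF C_k_mollifier i]] compact_imp_closed[OF L(2)] m0 that]
          by simp
        have "(LINT y|lebesgue. indicator L y * u y * mollifier_deriv n i (x - y))
          = (LINT y|lebesgue_on \<Omega>. u y * mollifier_deriv n i (x - y))"
          by (rule int) (rule d0)
        also have "\<dots> = - (LINT y|lebesgue_on \<Omega>. u y * frechet_derivative (\<lambda>y. mollifier n (x - y)) (at y) i)"
          by (simp add: fr)
        also have "\<dots> = (LINT y|lebesgue_on \<Omega>. d y * mollifier n (x - y))"
          using w t by (simp add: weak_partial_def)
        also have "\<dots> = mollify n (\<lambda>y. indicator L y * d y) x"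
          unfolding mollify_def by (rule int[symmetric]) (rule m0)
        finally show ?thesis .
      qed
    qed
  qed
  moreover have "K \<subseteq> L" using L(1,4) by force
  ultimately show ?thesis using that[OF L(2) _ L(3)] by simp
qed

lemma mollify_L1_on:
  fixes u :: "'a::euclidean_space \<Rightarrow> real"
  assumes L: "compact L" and u: "integrable (lebesgue_on L) u" and K: "compact K" "K \<subseteq> L" 
  shows "(\<lambda>n. LINT x|lebesgue_on K. \<bar>mollify n (\<lambda>y. indicator L y * u y) x - u x\<bar>) \<longlonglongrightarrow> 0"
proof -
  let ?u = "\<lambda>y. indicator L y * u y"
  have ui: "integrable lebesgue ?u"
    using u L by (simp add: integrable_indicator_lebesgue compact_lebesgue_sets)
  have l: "(\<lambda>n. LINT x|lebesgue. \<bar>mollify n ?u x - ?u x\<bar>) \<longlonglongrightarrow> 0" by (rule mollify_L1[OF ui])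
  have le: "(LINT x|lebesgue_on K. \<bar>mollify n ?u x - u x\<bar>) \<le> (LINT x|lebesgue. \<bar>mollify n ?u x - ?u x\<bar>)"
    if "integrable lebesgue (\<lambda>x. mollify n ?u x - ?u x)" for n
  proof -
    have "indicator K x *\<^sub>R \<bar>mollify n ?u x - u x\<bar> = indicator K x *\<^sub>R \<bar>mollify n ?u x - ?u x\<bar>" for x
      using K(2) by (auto simp: indicator_def)
    then have eq: "(LINT x|lebesgue. indicator K x *\<^sub>R \<bar>mollify n ?u x - u x\<bar>) = (LINT x|lebesgue. indicator K x *\<^sub>R \<bar>mollify n ?u x - ?u x\<bar>)"
      by presburger
    have "(LINT x|lebesgue_on K. \<bar>mollify n ?u x - u x\<bar>) = (LINT x|lebesgue. indicator K x *\<^sub>R \<bar>mollify n ?u x - ?u x\<bar>)"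
      using eq K(1) integral_restrict_space[of K lebesgue "\<lambda>x. \<bar>mollify n ?u x - u x\<bar>"]
      by (simp add: compact_lebesgue_sets)
    also have "\<dots> \<le> (LINT x|lebesgue. \<bar>mollify n ?u x - ?u x\<bar>)"
    proof (rule integral_mono)
      show "integrable lebesgue (\<lambda>x. \<bar>mollify n ?u x - ?u x\<bar>)" using that by (rule integrable_abs)
      then show "integrable lebesgue (\<lambda>x. indicator K x *\<^sub>R \<bar>mollify n ?u x - ?u x\<bar>)"
        by (rule integrable_mult_indicator[OF compact_lebesgue_sets[OF K(1)]])
      show "indicator K x *\<^sub>R \<bar>mollify n ?u x - ?u x\<bar> \<le> \<bar>mollify n ?u x - ?u x\<bar>" for x
        by (cases "x \<in> K") auto
    qed
    finally show ?thesis .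
  qed
  show ?thesis
  proof (rule tendsto_sandwich[OF _ _ tendsto_const l])
    show "\<forall>\<^sub>F n in sequentially. (LINT x|lebesgue_on K. \<bar>mollify n ?u x - u x\<bar>) \<le> (LINT x|lebesgue. \<bar>mollify n ?u x - ?u x\<bar>)"
      using mollify_L1(2)[OF ui] by eventually_elim (rule le)
  qed simp
qed

text \<open>The source of the calculus rules for weak derivatives: each rule is proved for
  \<open>f n\<close> classically and carried over. Pointwise convergence is included because the
  chain rule needs convergence of h'(f n).\<close>

lemma weak_partial_approx:
  fixes u :: "'a::euclidean_space \<Rightarrow> real"
  assumes \<Omega>: "open \<Omega>" and w: "weak_partial \<Omega> i u d" and i: "i \<in> Basis" and K: "compact K" "K \<subseteq> \<Omega>"
  obtains f g where "\<And>n. has_partial i (f n) (g n)"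
    "(\<lambda>n. LINT x|lebesgue_on K. \<bar>f n x - u x\<bar>) \<longlonglongrightarrow> 0"
    "(\<lambda>n. LINT x|lebesgue_on K. \<bar>g n x - d x\<bar>) \<longlonglongrightarrow> 0"
    "AE x in lebesgue_on K. (\<lambda>n. f n x) \<longlonglongrightarrow> u x"
proof (rule mollify_weak_partial[OF \<Omega> w i K])
  fix L assume L: "compact L" "K \<subseteq> L" "L \<subseteq> \<Omega>"
    and ev: "\<forall>\<^sub>F n in sequentially. \<forall>x\<in>K. (LINT y|lebesgue. indicator L y * u y * mollifier_deriv n i (x - y))
        = mollify n (\<lambda>y. indicator L y * d y) x"
  define f where "f n = mollify n (\<lambda>y. indicator L y * u y)" for n
  define g where "g n x = (LINT y|lebesgue. indicator L y * u y * mollifier_deriv n i (x - y))" for n x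
  have li: "integrable (lebesgue_on L) u" "integrable (lebesgue_on L) d"
    using w L by (auto simp: weak_partial_def locally_integrable_def)
  have Ki: "integrable (lebesgue_on K) u" "integrable (lebesgue_on K) d"
    using w K by (auto simp: weak_partial_def locally_integrable_def)
  have "integrable lebesgue (\<lambda>y. indicator L y * u y)"
    using li(1) L(1) by (simp add: integrable_indicator_lebesgue compact_lebesgue_sets)
  from mollify_partial[OF this i] have p: "has_partial i (f n) (g n)" for n
    unfolding f_def g_def .
  have l1: "(\<lambda>n. LINT x|lebesgue_on K. \<bar>f n x - u x\<bar>) \<longlonglongrightarrow> 0"
    unfolding f_def by (rule mollify_L1_on[OF L(1) li(1) K(1) L(2)])
  have l2: "(\<lambda>n. LINT x|lebesgue_on K. \<bar>g n x - d x\<bar>) \<longlonglongrightarrow> 0"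
  proof (rule Lim_transform_eventually[OF mollify_L1_on[OF L(1) li(2) K(1) L(2)]])
    show "\<forall>\<^sub>F n in sequentially. (LINT x|lebesgue_on K. \<bar>mollify n (\<lambda>y. indicator L y * d y) x - d x\<bar>) = (LINT x|lebesgue_on K. \<bar>g n x - d x\<bar>)"
      using ev by eventually_elim (auto simp: g_def intro!: Bochner_Integration.integral_cong)
  qed
  have fi: "integrable (lebesgue_on K) (f n)" for n
    using p K(1) by (intro continuous_integrable_on_compact) (auto simp: has_partial_def)
  \<comment> \<open>L1 convergence yields pointwise convergence only along a subsequence; both L1
    limits survive the passage to it.\<close>
  have "\<exists>r::nat\<Rightarrow>nat. strict_mono r \<and> (AE x in lebesgue_on K. (\<lambda>n. f (r n) x - u x) \<longlonglongrightarrow> 0)"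
    by (rule tendsto_L1_AE_subseq[where u = "\<lambda>n x. f n x - u x"]) (use fi Ki l1 in auto)
  then obtain r where r: "strict_mono r" "AE x in lebesgue_on K. (\<lambda>n. f (r n) x - u x) \<longlonglongrightarrow> 0"
    by blast
  show thesis
  proof (rule that[of "\<lambda>n. f (r n)" "\<lambda>n. g (r n)"])
    show "(\<lambda>n. LINT x|lebesgue_on K. \<bar>f (r n) x - u x\<bar>) \<longlonglongrightarrow> 0"
      using LIMSEQ_subseq_LIMSEQ[OF l1 r(1)] by (simp add: o_def)
    show "(\<lambda>n. LINT x|lebesgue_on K. \<bar>g (r n) x - d x\<bar>) \<longlonglongrightarrow> 0"
      using LIMSEQ_subseq_LIMSEQ[OF l2 r(1)] by (simp add: o_def)
    show "AE x in lebesgue_on K. (\<lambda>n. f (r n) x) \<longlonglongrightarrow> u x"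
      using r(2) by (simp add: LIM_zero_iff)
  qed (rule p)
qed

lemma AE_compact_exhaustion:
  fixes \<Omega> :: "'a::euclidean_space set"
  assumes "open \<Omega>" "\<And>K. compact K \<Longrightarrow> K \<subseteq> \<Omega> \<Longrightarrow> AE x in lebesgue_on K. P x"
  shows "AE x in lebesgue_on \<Omega>. P x"
proof (rule open_Union_compact_subsets[OF assms(1)])
  fix C :: "nat \<Rightarrow> 'a set"
  assume C: "\<And>n. compact (C n)" "\<And>n. C n \<subseteq> \<Omega>" "\<Union> (range C) = \<Omega>"
  have "AE x in lebesgue. x \<in> C n \<longrightarrow> P x" for n
    using assms(2)[OF C(1,2), of n] C(1) by (simp add: AE_restrict_space_iff compact_lebesgue_sets)
  then have "AE x in lebesgue. \<forall>n. x \<in> C n \<longrightarrow> P x" by (subst AE_all_countable) simp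
  then have "AE x in lebesgue. x \<in> \<Omega> \<longrightarrow> P x"
  proof eventually_elim
    case (elim x)
    then show ?case unfolding C(3)[symmetric] by auto
  qed
  then show ?thesis using assms(1) by (simp add: AE_restrict_space_iff open_lebesgue_sets)
qed

lemma locally_integrable_measurable:
  fixes u :: "'a::euclidean_space \<Rightarrow> real"
  assumes "open \<Omega>" "locally_integrable \<Omega> u"
  shows "u \<in> borel_measurable (lebesgue_on \<Omega>)"
proof (rule open_Union_compact_subsets[OF assms(1)])
  fix C :: "nat \<Rightarrow> 'a set"
  assume C: "\<And>n. compact (C n)" "\<And>n. C n \<subseteq> \<Omega>" "\<Union> (range C) = \<Omega>"
    and CS: "\<And>n. C n \<subseteq> interior (C (Suc n))"
  have mono: "C m \<subseteq> C n" if "m \<le> n" for m n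
    by (rule lift_Suc_mono_le[OF _ that]) (use CS interior_subset in blast)
  have "(\<lambda>x. indicator (C n) x *\<^sub>R u x) \<in> borel_measurable (lebesgue_on \<Omega>)" for n
  proof -
    have "integrable (lebesgue_on (C n)) u" using assms C by (auto simp: locally_integrable_def)
    then have "integrable lebesgue (\<lambda>x. indicator (C n) x *\<^sub>R u x)"
      using C(1) by (simp add: integrable_restrict_space compact_lebesgue_sets)
    then show ?thesis by (intro measurable_restrict_space1) auto
  qed
  then show ?thesis
  proof (rule borel_measurable_LIMSEQ_metric)
    fix x assume "x \<in> space (lebesgue_on \<Omega>)"
    then obtain m where m: "x \<in> C m" using C(3) by auto
    show "(\<lambda>n. indicator (C n) x *\<^sub>R u x) \<longlonglongrightarrow> u x"
      by (rule tendsto_eventually, rule eventually_sequentiallyI[of m]) (use m mono in \<open>auto simp: indicator_def\<close>)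
  qed
qed

lemma weak_partial_measurable:
  fixes u :: "'a::euclidean_space \<Rightarrow> real"
  assumes "open \<Omega>" "weak_partial \<Omega> i u d"
  shows "u \<in> borel_measurable (lebesgue_on \<Omega>)" "d \<in> borel_measurable (lebesgue_on \<Omega>)"
  using assms by (auto simp: weak_partial_def intro: locally_integrable_measurable)

lemma locally_integrable_bound:
  fixes u :: "'a::euclidean_space \<Rightarrow> real"
  assumes "open \<Omega>" "locally_integrable \<Omega> v" "u \<in> borel_measurable (lebesgue_on \<Omega>)"
    "\<And>x. x \<in> \<Omega> \<Longrightarrow> \<bar>u x\<bar> \<le> \<bar>v x\<bar>"
  shows "locally_integrable \<Omega> u"
  unfolding locally_integrable_def
proof (intro allI impI)
  fix K assume K: "compact K \<and> K \<subseteq> \<Omega>"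
  show "integrable (lebesgue_on K) u"
  proof (rule Bochner_Integration.integrable_bound[of _ v])
    show "integrable (lebesgue_on K) v" using K assms by (auto simp: locally_integrable_def)
    show "u \<in> borel_measurable (lebesgue_on K)"
      using K assms(3) measurable_restrict_mono[OF assms(3), of K] by auto
    show "AE x in lebesgue_on K. norm (u x) \<le> norm (v x)"
      using K assms(4) by (intro AE_I2) auto
  qed
qed

lemma locally_integrable_add:
  fixes u v :: "'a::euclidean_space \<Rightarrow> real"
  shows "locally_integrable \<Omega> u \<Longrightarrow> locally_integrable \<Omega> v \<Longrightarrow> locally_integrable \<Omega> (\<lambda>x. u x + v x)"
  by (auto simp: locally_integrable_def)

lemma integrable_mult_continuous:
  fixes u :: "'a::euclidean_space \<Rightarrow> real"
  assumes "integrable (lebesgue_on K) u" "continuous_on UNIV g" "compact K"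
  shows "integrable (lebesgue_on K) (\<lambda>x. u x * g x)"
proof -
  have "compact (g ` K)"
    using assms by (meson compact_continuous_image continuous_on_subset subset_UNIV)
  then obtain B where B: "\<forall>x\<in>K. norm (g x) \<le> B"
    by (meson bounded_iff compact_imp_bounded image_eqI)
  show ?thesis
  proof (rule Bochner_Integration.integrable_bound[of _ "\<lambda>x. B * \<bar>u x\<bar>"])
    show "(\<lambda>x. u x * g x) \<in> borel_measurable (lebesgue_on K)"
      using assms continuous_measurable_lebesgue_on[OF assms(2)] by (intro borel_measurable_times) auto
    show "AE x in lebesgue_on K. norm (u x * g x) \<le> norm (B * \<bar>u x\<bar>)"
    proof (rule AE_I2)
      fix x assume "x \<in> space (lebesgue_on K)"
      then have "\<bar>u x\<bar> * \<bar>g x\<bar> \<le> \<bar>u x\<bar> * \<bar>B\<bar>" using B by (intro mult_left_mono) auto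
      then show "norm (u x * g x) \<le> norm (B * \<bar>u x\<bar>)" by (simp add: abs_mult mult.commute)
    qed
  qed (use assms in auto)
qed

section \<open>Calculus of weak partial derivatives\<close>

text \<open>Enlarges the class of test functions from smooth ones to those that are C^1 in one
  direction. The functions tested later, h(\<phi> n) times a factor, are of this kind because h is
  merely C^1.\<close>

lemma weak_partial_integral:
  fixes u :: "'a::euclidean_space \<Rightarrow> real"
  assumes \<Omega>: "open \<Omega>" and w: "weak_partial \<Omega> i u d" and i: "i \<in> Basis"
    and p: "has_partial i \<eta> \<eta>'" and K: "compact K" "K \<subseteq> \<Omega>" "\<And>x. x \<notin> K \<Longrightarrow> \<eta> x = 0"
  shows "(LINT x|lebesgue_on \<Omega>. u x * \<eta>' x) = - (LINT x|lebesgue_on \<Omega>. d x * \<eta> x)"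
proof (rule weak_partial_approx[OF \<Omega> w i K(1,2)])
  fix f g assume fg: "\<And>n. has_partial i (f n) (g n)"
    and l1: "(\<lambda>n. LINT x|lebesgue_on K. \<bar>f n x - u x\<bar>) \<longlonglongrightarrow> 0"
    and l2: "(\<lambda>n. LINT x|lebesgue_on K. \<bar>g n x - d x\<bar>) \<longlonglongrightarrow> 0"
  have \<eta>'0: "\<eta>' x = 0" if "x \<notin> K" for x
    by (rule has_partial_zero_outside[OF p compact_imp_closed[OF K(1)] K(3) that])
  have Ki: "integrable (lebesgue_on K) u" "integrable (lebesgue_on K) d"
    using w K by (auto simp: weak_partial_def locally_integrable_def)
  have c: "continuous_on UNIV \<eta>" "continuous_on UNIV \<eta>'" using p by (auto simp: has_partial_def)
  have cf: "continuous_on UNIV (f n)" "continuous_on UNIV (g n)" for n using fg by (auto simp: has_partial_def)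
  note fi = continuous_integrable_on_compact[OF cf(1) K(1)] continuous_integrable_on_compact[OF cf(2) K(1)]
  obtain B where B: "\<And>x. \<bar>\<eta> x\<bar> \<le> B" using continuous_compact_support_bounded[OF c(1) K(1,3)] by blast
  obtain B' where B': "\<And>x. \<bar>\<eta>' x\<bar> \<le> B'" using continuous_compact_support_bounded[OF c(2) K(1) \<eta>'0] by blast
  have t1: "(\<lambda>n. LINT x|lebesgue_on K. \<eta>' x * f n x) \<longlonglongrightarrow> (LINT x|lebesgue_on K. \<eta>' x * u x)"
    by (rule L1_tendsto_mult(4)[OF fi(1) Ki(1) l1, where B = B'])
       (use B' c in \<open>auto simp: continuous_measurable_lebesgue_on\<close>)
  have t2: "(\<lambda>n. LINT x|lebesgue_on K. \<eta> x * g n x) \<longlonglongrightarrow> (LINT x|lebesgue_on K. \<eta> x * d x)"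
    by (rule L1_tendsto_mult(4)[OF fi(2) Ki(2) l2, where B = B])
       (use B c in \<open>auto simp: continuous_measurable_lebesgue_on\<close>)
  have "(LINT x|lebesgue_on K. \<eta>' x * f n x) = - (LINT x|lebesgue_on K. \<eta> x * g n x)" for n
  proof -
    have "(LINT x|lebesgue_on K. \<eta>' x * f n x + \<eta> x * g n x) = 0"
      by (rule integral_partial_zero_on[OF has_partial_mult[OF p fg] K(1)]) (simp add: K(3))
    moreover have "integrable (lebesgue_on K) (\<lambda>x. \<eta>' x * f n x)" "integrable (lebesgue_on K) (\<lambda>x. \<eta> x * g n x)"
      using c cf K(1) by (auto intro!: continuous_integrable_on_compact continuous_intros)
    ultimately show ?thesis by simp
  qed
  then have "(LINT x|lebesgue_on K. \<eta>' x * u x) = - (LINT x|lebesgue_on K. \<eta> x * d x)"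
    using LIMSEQ_unique[OF t1] tendsto_minus[OF t2] by simp
  moreover have "(LINT x|lebesgue_on \<Omega>. u x * \<eta>' x) = (LINT x|lebesgue_on K. u x * \<eta>' x)"
    "(LINT x|lebesgue_on \<Omega>. d x * \<eta> x) = (LINT x|lebesgue_on K. d x * \<eta> x)"
    using K \<eta>'0 \<Omega> by (auto intro!: integral_on_support simp: compact_lebesgue_sets open_lebesgue_sets)
  ultimately show ?thesis by (simp add: mult.commute)
qed

lemma weak_partial_diff:
  fixes u v :: "'a::euclidean_space \<Rightarrow> real"
  assumes \<Omega>: "open \<Omega>" and w: "weak_partial \<Omega> i u d" "weak_partial \<Omega> i v e" and i: "i \<in> Basis"
  shows "weak_partial \<Omega> i (\<lambda>x. u x - v x) (\<lambda>x. d x - e x)"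
  unfolding weak_partial_def
proof (intro conjI ballI)
  have li: "locally_integrable \<Omega> u" "locally_integrable \<Omega> d" "locally_integrable \<Omega> v" "locally_integrable \<Omega> e"
    using w by (auto simp: weak_partial_def)
  then show "locally_integrable \<Omega> (\<lambda>x. u x - v x)" "locally_integrable \<Omega> (\<lambda>x. d x - e x)"
    by (auto simp: locally_integrable_def)
  fix \<phi> assume \<phi>: "\<phi> \<in> test_fun \<Omega>"
  let ?\<phi>' = "\<lambda>x. frechet_derivative \<phi> (at x) i"
  obtain K where K: "compact K" "K \<subseteq> \<Omega>" "\<And>x. x \<notin> K \<Longrightarrow> \<phi> x = 0"
    and \<phi>'0: "\<And>x. x \<notin> K \<Longrightarrow> ?\<phi>' x = 0" and c: "continuous_on UNIV \<phi>" "continuous_on UNIV ?\<phi>'"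
    by (rule test_fun_partial_support[OF \<phi> i]) (rule that)
  have d: "(LINT x|lebesgue_on \<Omega>. (f x - g x) * \<eta> x) = (LINT x|lebesgue_on \<Omega>. f x * \<eta> x) - (LINT x|lebesgue_on \<Omega>. g x * \<eta> x)"
    if "continuous_on UNIV \<eta>" "\<And>x. x \<notin> K \<Longrightarrow> \<eta> x = 0" "locally_integrable \<Omega> f" "locally_integrable \<Omega> g"
    for f g \<eta> :: "'a \<Rightarrow> real"
  proof -
    have r: "(LINT x|lebesgue_on \<Omega>. h x * \<eta> x) = (LINT x|lebesgue_on K. h x * \<eta> x)" for h
      using K that \<Omega> by (intro integral_on_support) (auto simp: compact_lebesgue_sets open_lebesgue_sets)
    have "integrable (lebesgue_on K) f" "integrable (lebesgue_on K) g"
      using that K by (auto simp: locally_integrable_def)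
    from this[THEN integrable_mult_continuous[OF _ that(1) K(1)]] show ?thesis
      unfolding r by (simp add: left_diff_distrib)
  qed
  show "(LINT x|lebesgue_on \<Omega>. (u x - v x) * ?\<phi>' x) = - (LINT x|lebesgue_on \<Omega>. (d x - e x) * \<phi> x)"
    using w \<phi> d[OF c(1) K(3) li(2,4)] d[OF c(2) \<phi>'0 li(1,3)] by (simp add: weak_partial_def)
qed

text \<open>The difference of the two candidates is a weak derivative of 0. Near \<open>K\<close>
  its mollification is therefore 0 convolved with a kernel derivative, and the mollifications
  converge to the difference itself.\<close>

lemma weak_partial_unique:
  fixes u :: "'a::euclidean_space \<Rightarrow> real"
  assumes \<Omega>: "open \<Omega>" and w: "weak_partial \<Omega> i u d" "weak_partial \<Omega> i u d'" and i: "i \<in> Basis"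
  shows "AE x in lebesgue_on \<Omega>. d x = d' x"
proof (rule AE_compact_exhaustion[OF \<Omega>])
  fix K assume K: "compact K" "K \<subseteq> \<Omega>"
  have Ki: "integrable (lebesgue_on K) d" "integrable (lebesgue_on K) d'" if "compact K" "K \<subseteq> \<Omega>" for K
    using w that by (auto simp: weak_partial_def locally_integrable_def)
  have w0: "weak_partial \<Omega> i (\<lambda>x. 0) (\<lambda>x. d x - d' x)"
    using weak_partial_diff[OF \<Omega> w i] by simp
  show "AE x in lebesgue_on K. d x = d' x"
  proof (rule mollify_weak_partial[OF \<Omega> w0 i K])
    fix L assume L: "compact L" "K \<subseteq> L" "L \<subseteq> \<Omega>"
    and ev: "\<forall>\<^sub>F n in sequentially. \<forall>x\<in>K. (LINT y|lebesgue. indicator L y * 0 * mollifier_deriv n i (x - y))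
        = mollify n (\<lambda>y. indicator L y * (d y - d' y)) x"
    have "integrable (lebesgue_on L) (\<lambda>y. d y - d' y)" using Ki[OF L(1,3)] by simp
    from mollify_L1_on[OF L(1) this K(1) L(2)]
    have l: "(\<lambda>n. LINT x|lebesgue_on K. \<bar>mollify n (\<lambda>y. indicator L y * (d y - d' y)) x - (d x - d' x)\<bar>) \<longlonglongrightarrow> 0" .
    have "(\<lambda>n::nat. LINT x|lebesgue_on K. \<bar>d x - d' x\<bar>) \<longlonglongrightarrow> 0"
    proof (rule Lim_transform_eventually[OF l])
      show "\<forall>\<^sub>F n in sequentially. (LINT x|lebesgue_on K. \<bar>mollify n (\<lambda>y. indicator L y * (d y - d' y)) x - (d x - d' x)\<bar>) = (LINT x|lebesgue_on K. \<bar>d x - d' x\<bar>)"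
        using ev by eventually_elim (auto intro!: Bochner_Integration.integral_cong)
    qed
    then have "(LINT x|lebesgue_on K. \<bar>d x - d' x\<bar>) = 0" by (simp add: LIMSEQ_const_iff)
    then have "AE x in lebesgue_on K. \<bar>d x - d' x\<bar> = 0"
      using integral_nonneg_eq_0_iff_AE[of "lebesgue_on K" "\<lambda>x. \<bar>d x - d' x\<bar>"] Ki[OF K] by simp
    then show ?thesis by eventually_elim simp
  qed
qed

text \<open>The bound on h' serves twice: it makes h Lipschitz, so that h(f n) converges in L1, and
  it keeps h'(f n) bounded beside the derivatives, which converge in L1 only.\<close>

lemma weak_partial_compose:
  fixes u :: "'a::euclidean_space \<Rightarrow> real"
  assumes \<Omega>: "open \<Omega>" and w: "weak_partial \<Omega> i u d" and i: "i \<in> Basis"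
    and h: "\<And>t. (h has_real_derivative h' t) (at t)" "continuous_on UNIV h'" "\<And>t. \<bar>h' t\<bar> \<le> B"
  shows "weak_partial \<Omega> i (\<lambda>x. h (u x)) (\<lambda>x. h' (u x) * d x)"
proof -
  have hm: "h \<in> borel_measurable borel" "h' \<in> borel_measurable borel"
    using h by (auto intro!: borel_measurable_continuous_onI continuous_at_imp_continuous_on DERIV_isCont)
  note m = weak_partial_measurable[OF \<Omega> w]
  have um: "(\<lambda>x. h (u x)) \<in> borel_measurable (lebesgue_on \<Omega>)" "(\<lambda>x. h' (u x)) \<in> borel_measurable (lebesgue_on \<Omega>)"
    using measurable_compose[OF m(1) hm(1)] measurable_compose[OF m(1) hm(2)] by auto
  have Lip: "\<bar>h s - h t\<bar> \<le> B * \<bar>s - t\<bar>" for s t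
    using field_differentiable_bound[of UNIV h h' B s t] h by (auto simp: convex_UNIV)
  have lu: "locally_integrable \<Omega> u" "locally_integrable \<Omega> d" using w by (auto simp: weak_partial_def)
  have B0: "B \<ge> 0" using h(3)[of 0] by linarith
  have "locally_integrable \<Omega> (\<lambda>x. h (u x))"
  proof (rule locally_integrable_bound[OF \<Omega> _ um(1), of "\<lambda>x. \<bar>h 0\<bar> + B * \<bar>u x\<bar>"])
    show "locally_integrable \<Omega> (\<lambda>x. \<bar>h 0\<bar> + B * \<bar>u x\<bar>)"
    proof (rule locally_integrable_add)
      show "locally_integrable \<Omega> (\<lambda>x. \<bar>h 0\<bar>)"
        by (auto simp: locally_integrable_def intro!: continuous_integrable_on_compact)
    qed (use lu in \<open>auto simp: locally_integrable_def\<close>)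
    show "\<bar>h (u x)\<bar> \<le> \<bar>\<bar>h 0\<bar> + B * \<bar>u x\<bar>\<bar>" for x
    proof -
      have "\<bar>h (u x) - h 0\<bar> \<le> B * \<bar>u x\<bar>" using Lip[of "u x" 0] by simp
      then show ?thesis by linarith
    qed
  qed
  moreover have "locally_integrable \<Omega> (\<lambda>x. h' (u x) * d x)"
  proof (rule locally_integrable_bound[OF \<Omega>, of "\<lambda>x. B * d x"])
    show "locally_integrable \<Omega> (\<lambda>x. B * d x)" using lu by (auto simp: locally_integrable_def)
    show "\<bar>h' (u x) * d x\<bar> \<le> \<bar>B * d x\<bar>" for x
      using h(3)[of "u x"] B0 by (simp add: abs_mult mult_right_mono)
  qed (use um m in simp)
  moreover have "(LINT x|lebesgue_on \<Omega>. h (u x) * frechet_derivative \<phi> (at x) i) = - (LINT x|lebesgue_on \<Omega>. h' (u x) * d x * \<phi> x)"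
    if \<phi>: "\<phi> \<in> test_fun \<Omega>" for \<phi>
  proof -
    let ?\<phi>' = "\<lambda>x. frechet_derivative \<phi> (at x) i"
    obtain K where K: "compact K" "K \<subseteq> \<Omega>" "\<And>x. x \<notin> K \<Longrightarrow> \<phi> x = 0"
      and \<phi>'0: "\<And>x. x \<notin> K \<Longrightarrow> ?\<phi>' x = 0" using test_fun_support[OF \<phi>] i by metis
    have p: "has_partial i \<phi> ?\<phi>'" by (rule test_fun_partial[OF \<phi> i])
    then have c: "continuous_on UNIV \<phi>" "continuous_on UNIV ?\<phi>'" by (auto simp: has_partial_def)
    obtain b where b: "\<And>x. \<bar>\<phi> x\<bar> \<le> b" "b > 0" using continuous_compact_support_bounded[OF c(1) K(1,3)] by blast
    obtain b' where b': "\<And>x. \<bar>?\<phi>' x\<bar> \<le> b'" using continuous_compact_support_bounded[OF c(2) K(1) \<phi>'0] by blast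
    have Ki: "integrable (lebesgue_on K) u" "integrable (lebesgue_on K) d"
      using lu K by (auto simp: locally_integrable_def)
    have umK: "(\<lambda>x. h (u x)) \<in> borel_measurable (lebesgue_on K)" "(\<lambda>x. h' (u x)) \<in> borel_measurable (lebesgue_on K)"
      using Ki hm by (auto intro: measurable_compose[OF borel_measurable_integrable])
    show ?thesis
    proof (rule weak_partial_approx[OF \<Omega> w i K(1,2)])
      fix f g assume fg: "\<And>n. has_partial i (f n) (g n)"
        and l1: "(\<lambda>n. LINT x|lebesgue_on K. \<bar>f n x - u x\<bar>) \<longlonglongrightarrow> 0"
        and l2: "(\<lambda>n. LINT x|lebesgue_on K. \<bar>g n x - d x\<bar>) \<longlonglongrightarrow> 0"
        and l3: "AE x in lebesgue_on K. (\<lambda>n. f n x) \<longlonglongrightarrow> u x"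
      have cf: "continuous_on UNIV (f n)" "continuous_on UNIV (g n)" for n using fg by (auto simp: has_partial_def)
      note hp = has_partial_compose[OF fg h(1,2)]
      then have chf: "continuous_on UNIV (\<lambda>x. h (f n x))" for n by (auto simp: has_partial_def)
      have chf': "continuous_on UNIV (\<lambda>x. h' (f n x))" for n
        using continuous_on_compose2[OF h(2) cf(1)] by simp
      have hi: "integrable (lebesgue_on K) (\<lambda>x. h (u x))"
        using \<open>locally_integrable \<Omega> (\<lambda>x. h (u x))\<close> K by (auto simp: locally_integrable_def)
      have fi: "integrable (lebesgue_on K) (f n)" "integrable (lebesgue_on K) (g n)" "integrable (lebesgue_on K) (\<lambda>x. h (f n x))" for n
        using continuous_integrable_on_compact[OF cf(1) K(1)] continuous_integrable_on_compact[OF cf(2) K(1)] continuous_integrable_on_compact[OF chf K(1)] by auto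
      have lh: "(\<lambda>n. LINT x|lebesgue_on K. \<bar>h (f n x) - h (u x)\<bar>) \<longlonglongrightarrow> 0"
      proof (rule tendsto_sandwich[OF _ _ tendsto_const])
        show "(\<lambda>n. B * (LINT x|lebesgue_on K. \<bar>f n x - u x\<bar>)) \<longlonglongrightarrow> 0"
          using tendsto_mult_left[OF l1, of B] by simp
        show "\<forall>\<^sub>F n in sequentially. (LINT x|lebesgue_on K. \<bar>h (f n x) - h (u x)\<bar>) \<le> B * (LINT x|lebesgue_on K. \<bar>f n x - u x\<bar>)"
        proof (rule always_eventually, rule allI)
          fix n
          have "(LINT x|lebesgue_on K. \<bar>h (f n x) - h (u x)\<bar>) \<le> (LINT x|lebesgue_on K. B * \<bar>f n x - u x\<bar>)"
            using fi hi Ki Lip by (intro integral_mono) auto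
          then show "(LINT x|lebesgue_on K. \<bar>h (f n x) - h (u x)\<bar>) \<le> B * (LINT x|lebesgue_on K. \<bar>f n x - u x\<bar>)" by simp
        qed
      qed simp
      have t1: "(\<lambda>n. LINT x|lebesgue_on K. ?\<phi>' x * h (f n x)) \<longlonglongrightarrow> (LINT x|lebesgue_on K. ?\<phi>' x * h (u x))"
        by (rule L1_tendsto_mult(4)[OF fi(3) hi lh, where B = b'])
           (use b' c in \<open>auto simp: continuous_measurable_lebesgue_on\<close>)
      have t2: "(\<lambda>n. LINT x|lebesgue_on K. (\<phi> x * h' (f n x)) * g n x) \<longlonglongrightarrow> (LINT x|lebesgue_on K. (\<phi> x * h' (u x)) * d x)"
      proof (rule L1_tendsto_mult(4)[OF fi(2) Ki(2) l2, where B = "b * B"])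
        show "(\<lambda>x. \<phi> x * h' (f n x)) \<in> borel_measurable (lebesgue_on K)" for n
          using c chf' by (intro continuous_measurable_lebesgue_on continuous_intros) auto
        show "(\<lambda>x. \<phi> x * h' (u x)) \<in> borel_measurable (lebesgue_on K)"
          using umK continuous_measurable_lebesgue_on[OF c(1)] by simp
        show "\<bar>\<phi> x * h' (f n x)\<bar> \<le> b * B" for n x
          unfolding abs_mult using b h(3) by (intro mult_mono) (auto intro: less_imp_le)
        show "AE x in lebesgue_on K. (\<lambda>n. \<phi> x * h' (f n x)) \<longlonglongrightarrow> \<phi> x * h' (u x)"
          using l3
        proof eventually_elim
          case (elim x)
          have "(\<lambda>n. h' (f n x)) \<longlonglongrightarrow> h' (u x)"
            by (rule continuous_on_tendsto_compose[OF h(2) elim]) auto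
          then show ?case by (intro tendsto_intros)
        qed
      qed
      have "(LINT x|lebesgue_on K. ?\<phi>' x * h (f n x)) = - (LINT x|lebesgue_on K. (\<phi> x * h' (f n x)) * g n x)" for n
      proof -
        have "(LINT x|lebesgue_on K. ?\<phi>' x * h (f n x) + \<phi> x * (h' (f n x) * g n x)) = 0"
          by (rule integral_partial_zero_on[OF has_partial_mult[OF p hp] K(1)]) (simp add: K(3))
        moreover have "integrable (lebesgue_on K) (\<lambda>x. ?\<phi>' x * h (f n x))" "integrable (lebesgue_on K) (\<lambda>x. \<phi> x * (h' (f n x) * g n x))"
          using c cf chf chf' K(1) by (auto intro!: continuous_integrable_on_compact continuous_intros)
        ultimately show ?thesis by (simp add: mult.assoc)
      qed
      then have "(LINT x|lebesgue_on K. ?\<phi>' x * h (u x)) = - (LINT x|lebesgue_on K. (\<phi> x * h' (u x)) * d x)"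
        using LIMSEQ_unique[OF t1] tendsto_minus[OF t2] by simp
      moreover have "(LINT x|lebesgue_on \<Omega>. h (u x) * ?\<phi>' x) = (LINT x|lebesgue_on K. h (u x) * ?\<phi>' x)"
        "(LINT x|lebesgue_on \<Omega>. h' (u x) * d x * \<phi> x) = (LINT x|lebesgue_on K. h' (u x) * d x * \<phi> x)"
        using K \<phi>'0 \<Omega> by (auto intro!: integral_on_support simp: compact_lebesgue_sets open_lebesgue_sets)
      ultimately show ?thesis by (simp add: mult_ac)
    qed
  qed
  ultimately show ?thesis unfolding weak_partial_def by blast
qed

text \<open>Dominated convergence on the compact support of each test function. It leads from C^1
  compositions to the positive part, which is not C^1.\<close>

lemma weak_partial_dominated_limit:
  fixes u d :: "nat \<Rightarrow> 'a::euclidean_space \<Rightarrow> real" and u0 d0 :: "'a \<Rightarrow> real"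
  assumes \<Omega>: "open \<Omega>" and w: "\<And>n. weak_partial \<Omega> i (u n) (d n)" and i: "i \<in> Basis"
    and l: "\<And>x. x \<in> \<Omega> \<Longrightarrow> (\<lambda>n. u n x) \<longlonglongrightarrow> u0 x" "\<And>x. x \<in> \<Omega> \<Longrightarrow> (\<lambda>n. d n x) \<longlonglongrightarrow> d0 x"
    and b: "\<And>n x. x \<in> \<Omega> \<Longrightarrow> \<bar>u n x\<bar> \<le> \<bar>U x\<bar>" "\<And>n x. x \<in> \<Omega> \<Longrightarrow> \<bar>d n x\<bar> \<le> \<bar>D x\<bar>"
    and U: "locally_integrable \<Omega> U" "locally_integrable \<Omega> D"
  shows "weak_partial \<Omega> i u0 d0"
proof -
  note m = weak_partial_measurable[OF \<Omega> w]
  have m0: "u0 \<in> borel_measurable (lebesgue_on \<Omega>)" "d0 \<in> borel_measurable (lebesgue_on \<Omega>)"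
    using borel_measurable_LIMSEQ_metric[of u, OF m(1)] borel_measurable_LIMSEQ_metric[of d, OF m(2)] l by auto
  have b0: "\<bar>u0 x\<bar> \<le> \<bar>U x\<bar>" "\<bar>d0 x\<bar> \<le> \<bar>D x\<bar>" if x: "x \<in> \<Omega>" for x
  proof -
    show "\<bar>u0 x\<bar> \<le> \<bar>U x\<bar>"
      by (rule LIMSEQ_le_const2[OF tendsto_rabs[OF l(1)[OF x]]]) (intro exI[of _ 0] allI impI b(1)[OF x])
    show "\<bar>d0 x\<bar> \<le> \<bar>D x\<bar>"
      by (rule LIMSEQ_le_const2[OF tendsto_rabs[OF l(2)[OF x]]]) (intro exI[of _ 0] allI impI b(2)[OF x])
  qed
  have lim: "(\<lambda>n. LINT x|lebesgue_on \<Omega>. f n x * \<eta> x) \<longlonglongrightarrow> (LINT x|lebesgue_on \<Omega>. f0 x * \<eta> x)"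
    if f: "\<And>n. f n \<in> borel_measurable (lebesgue_on \<Omega>)" "f0 \<in> borel_measurable (lebesgue_on \<Omega>)"
      "\<And>x. x \<in> \<Omega> \<Longrightarrow> (\<lambda>n. f n x) \<longlonglongrightarrow> f0 x" "\<And>n x. x \<in> \<Omega> \<Longrightarrow> \<bar>f n x\<bar> \<le> \<bar>V x\<bar>" "locally_integrable \<Omega> V"
      and \<eta>: "continuous_on UNIV \<eta>" and K: "compact K" "K \<subseteq> \<Omega>" "\<And>x. x \<notin> K \<Longrightarrow> \<eta> x = 0"
    for f :: "nat \<Rightarrow> 'a \<Rightarrow> real" and f0 V \<eta> K
  proof -
    have r: "(LINT x|lebesgue_on \<Omega>. h x * \<eta> x) = (LINT x|lebesgue_on K. h x * \<eta> x)" for h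
      using K \<Omega> by (intro integral_on_support) (auto simp: compact_lebesgue_sets open_lebesgue_sets)
    have mK: "f n \<in> borel_measurable (lebesgue_on K)" "f0 \<in> borel_measurable (lebesgue_on K)" for n
      using f(1)[of n] f(2) K(2) by (auto intro: measurable_restrict_mono)
    note [measurable] = mK continuous_measurable_lebesgue_on[OF \<eta>, of K]
    have Vi: "integrable (lebesgue_on K) V" using f(5) K by (auto simp: locally_integrable_def)
    show ?thesis unfolding r
    proof (rule integral_dominated_convergence[where w = "\<lambda>x. \<bar>V x * \<eta> x\<bar>"])
      show "integrable (lebesgue_on K) (\<lambda>x. \<bar>V x * \<eta> x\<bar>)"
        using integrable_mult_continuous[OF Vi \<eta> K(1)] by simp
      show "AE x in lebesgue_on K. (\<lambda>n. f n x * \<eta> x) \<longlonglongrightarrow> f0 x * \<eta> x"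
        using f(3) K(2) by (intro AE_I2 tendsto_intros) auto
      show "AE x in lebesgue_on K. norm (f n x * \<eta> x) \<le> \<bar>V x * \<eta> x\<bar>" for n
        using f(4) K(2) by (intro AE_I2) (auto simp: abs_mult intro!: mult_right_mono)
    qed measurable
  qed
  show ?thesis unfolding weak_partial_def
  proof (intro conjI ballI)
    show "locally_integrable \<Omega> u0" "locally_integrable \<Omega> d0"
      using locally_integrable_bound[OF \<Omega> U(1) m0(1)] locally_integrable_bound[OF \<Omega> U(2) m0(2)] b0 by auto
    fix \<phi> assume \<phi>: "\<phi> \<in> test_fun \<Omega>"
    let ?\<phi>' = "\<lambda>x. frechet_derivative \<phi> (at x) i"
    obtain K where K: "compact K" "K \<subseteq> \<Omega>" "\<And>x. x \<notin> K \<Longrightarrow> \<phi> x = 0"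
      and \<phi>'0: "\<And>x. x \<notin> K \<Longrightarrow> ?\<phi>' x = 0" and c: "continuous_on UNIV \<phi>" "continuous_on UNIV ?\<phi>'"
      by (rule test_fun_partial_support[OF \<phi> i]) (rule that)
    have t1: "(\<lambda>n. LINT x|lebesgue_on \<Omega>. u n x * ?\<phi>' x) \<longlonglongrightarrow> (LINT x|lebesgue_on \<Omega>. u0 x * ?\<phi>' x)"
      by (rule lim[OF m(1) m0(1) l(1) b(1) U(1) c(2) K(1,2) \<phi>'0])
    have t2: "(\<lambda>n. LINT x|lebesgue_on \<Omega>. d n x * \<phi> x) \<longlonglongrightarrow> (LINT x|lebesgue_on \<Omega>. d0 x * \<phi> x)"
      by (rule lim[OF m(2) m0(2) l(2) b(2) U(2) c(1) K(1,2,3)])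
    have "(LINT x|lebesgue_on \<Omega>. u n x * ?\<phi>' x) = - (LINT x|lebesgue_on \<Omega>. d n x * \<phi> x)" for n
      using w \<phi> by (simp add: weak_partial_def)
    then show "(LINT x|lebesgue_on \<Omega>. u0 x * ?\<phi>' x) = - (LINT x|lebesgue_on \<Omega>. d0 x * \<phi> x)"
      using LIMSEQ_unique[OF t1] tendsto_minus[OF t2] by simp
  qed
qed

lemma has_partial_imp_weak_partial:
  fixes \<phi> \<phi>' :: "'a::euclidean_space \<Rightarrow> real"
  assumes \<Omega>: "open \<Omega>" and p: "has_partial i \<phi> \<phi>'" and i: "i \<in> Basis"
  shows "weak_partial \<Omega> i \<phi> \<phi>'"
  unfolding weak_partial_def
proof (intro conjI ballI)
  show "locally_integrable \<Omega> \<phi>" "locally_integrable \<Omega> \<phi>'"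
    using p by (auto simp: locally_integrable_def has_partial_def intro!: continuous_integrable_on_compact)
  fix \<psi> assume \<psi>: "\<psi> \<in> test_fun \<Omega>"
  let ?\<psi>' = "\<lambda>x. frechet_derivative \<psi> (at x) i"
  obtain K where K: "compact K" "K \<subseteq> \<Omega>" "\<And>x. x \<notin> K \<Longrightarrow> \<psi> x = 0"
    and \<psi>'0: "\<And>x. x \<notin> K \<Longrightarrow> ?\<psi>' x = 0" using test_fun_support[OF \<psi>] i by metis
  have q: "has_partial i \<psi> ?\<psi>'" by (rule test_fun_partial[OF \<psi> i])
  have "(LINT x|lebesgue_on K. \<phi>' x * \<psi> x + \<phi> x * ?\<psi>' x) = 0"
    by (rule integral_partial_zero_on[OF has_partial_mult[OF p q] K(1)]) (simp add: K(3))
  moreover have "integrable (lebesgue_on K) (\<lambda>x. \<phi>' x * \<psi> x)" "integrable (lebesgue_on K) (\<lambda>x. \<phi> x * ?\<psi>' x)"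
    using p q K(1) by (auto simp: has_partial_def intro!: continuous_integrable_on_compact continuous_intros)
  moreover have "(LINT x|lebesgue_on \<Omega>. \<phi> x * ?\<psi>' x) = (LINT x|lebesgue_on K. \<phi> x * ?\<psi>' x)"
    "(LINT x|lebesgue_on \<Omega>. \<phi>' x * \<psi> x) = (LINT x|lebesgue_on K. \<phi>' x * \<psi> x)"
    using K \<psi>'0 \<Omega> by (auto intro!: integral_on_support simp: compact_lebesgue_sets open_lebesgue_sets)
  ultimately show "(LINT x|lebesgue_on \<Omega>. \<phi> x * ?\<psi>' x) = - (LINT x|lebesgue_on \<Omega>. \<phi>' x * \<psi> x)"
    by simp
qed

text \<open>Simplest C^1 function that is zero on the negative half-line and not identically zero.
  Its shifted differences give all the one-variable functions used: the smoothed positive part and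
  the cut-off step.\<close>

definition pos_square :: "real \<Rightarrow> real" where
  "pos_square t = (max t 0)\<^sup>2"

lemma pos_square_deriv: "(pos_square has_real_derivative 2 * max t 0) (at t)"
proof -
  consider "t > 0" | "t < 0" | "t = 0" by linarith
  then show ?thesis
  proof cases
    case 1
    have "((\<lambda>t. t\<^sup>2) has_real_derivative 2 * max t 0) (at t)"
      using 1 by (auto intro!: derivative_eq_intros)
    then show ?thesis
      by (rule has_field_derivative_transform_within[where d = t]) (use 1 in \<open>auto simp: pos_square_def dist_real_def max_def\<close>)
  next
    case 2
    have "((\<lambda>t. 0) has_real_derivative 2 * max t 0) (at t)"
      using 2 by auto
    then show ?thesis
      by (rule has_field_derivative_transform_within[where d = "-t"]) (use 2 in \<open>auto simp: pos_square_def dist_real_def max_def\<close>)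
  next
    case 3
    have "((\<lambda>h. pos_square h / h) \<longlongrightarrow> 0) (at 0)"
    proof (rule Lim_null_comparison)
      show "((\<lambda>h. \<bar>h\<bar>) \<longlongrightarrow> 0) (at (0::real))" by (auto intro!: tendsto_eq_intros)
      show "\<forall>\<^sub>F h in at 0. norm (pos_square h / h) \<le> \<bar>h\<bar>"
        by (rule always_eventually) (auto simp: pos_square_def max_def power2_eq_square)
    qed
    with 3 show ?thesis by (simp add: has_field_derivative_iff pos_square_def)
  qed
qed

text \<open>Every approximant \<open>h n\<close> and its derivative vanish for t \<le> 0, so the
  pointwise limit of the derivatives is 0 on the whole set where \<open>u\<close> is at most 0, its
  zero level included.\<close>

lemma weak_partial_pos_part:
  fixes u :: "'a::euclidean_space \<Rightarrow> real"
  assumes \<Omega>: "open \<Omega>" and w: "weak_partial \<Omega> i u d" and i: "i \<in> Basis"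
  shows "weak_partial \<Omega> i (\<lambda>x. max (u x) 0) (\<lambda>x. if u x > 0 then d x else 0)"
proof -
  define r where "r n = inverse (real (Suc n))" for n
  have r: "r n > 0" for n by (simp add: r_def)
  have r0: "r \<longlonglongrightarrow> 0" unfolding r_def by (rule LIMSEQ_inverse_real_of_nat)
  \<comment> \<open>A backward difference quotient of half of \<open>pos_square\<close>, whose
    derivative is \<open>max t 0\<close>. Its own derivative is a ramp from 0 to 1 across the
    interval from 0 to \<open>r n\<close>.\<close>
  define h where "h n t = (pos_square t - pos_square (t - r n)) / (2 * r n)" for n t
  define h' where "h' n t = (max t 0 - max (t - r n) 0) / r n" for n t
  have hd: "(h n has_real_derivative h' n t) (at t)" for n t
  proof -
    have "((\<lambda>t. pos_square (t - r n)) has_real_derivative 2 * max (t - r n) 0) (at t)"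
    proof -
      have "((\<lambda>t. t - r n) has_real_derivative 1) (at t)" by (auto intro!: derivative_eq_intros)
      from DERIV_chain2[OF pos_square_deriv this] show ?thesis by simp
    qed
    then have "((\<lambda>t. (pos_square t - pos_square (t - r n)) / (2 * r n)) has_real_derivative
        (2 * max t 0 - 2 * max (t - r n) 0) / (2 * r n)) (at t)"
      by (intro DERIV_cdivide DERIV_diff pos_square_deriv)
    moreover have "(2 * a - 2 * b) / (2 * c) = (a - b) / c" for a b c :: real
      by (simp add: diff_divide_distrib)
    ultimately show ?thesis
      unfolding h_def[abs_def] h'_def by metis
  qed
  have hc: "continuous_on UNIV (h' n)" for n
    unfolding h'_def using r[of n] by (intro continuous_intros) auto
  have hb: "\<bar>h' n t\<bar> \<le> 1" for n t
  proof -
    have "0 \<le> max t 0 - max (t - r n) 0" "max t 0 - max (t - r n) 0 \<le> r n" using r[of n] by auto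
    then show ?thesis using r[of n] by (simp add: h'_def)
  qed
  have h0: "h n 0 = 0" for n using r[of n] by (simp add: h_def pos_square_def)
  have hbd: "\<bar>h n t\<bar> \<le> \<bar>t\<bar>" for n t
  proof -
    have "norm (h n t - h n 0) \<le> 1 * norm (t - 0)"
      by (rule field_differentiable_bound[of UNIV]) (use hd hb in \<open>auto simp: convex_UNIV\<close>)
    then show ?thesis by (simp add: h0)
  qed
  have hval: "h n t = t - r n / 2" if "t \<ge> r n" for n t
    using that r[of n] by (simp add: h_def pos_square_def power2_eq_square field_simps)
  have ev: "\<forall>\<^sub>F n in sequentially. t \<ge> r n" if "t > 0" for t
    using order_tendstoD(2)[OF r0 that] by (rule eventually_mono) simp
  have l1: "(\<lambda>n. h n t) \<longlonglongrightarrow> max t 0" for t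
  proof (cases "t > 0")
    case True
    have "(\<lambda>n. t - r n / 2) \<longlonglongrightarrow> t - 0 / 2" by (intro tendsto_intros r0) simp
    then have "(\<lambda>n. t - r n / 2) \<longlonglongrightarrow> max t 0" using True by simp
    then show ?thesis
      by (rule Lim_transform_eventually) (use ev[OF True] hval in \<open>auto elim: eventually_mono\<close>)
  next
    case False
    then have "h n t = 0" for n using r[of n] by (simp add: h_def pos_square_def)
    then show ?thesis using False by simp
  qed
  have l2: "(\<lambda>n. h' n t) \<longlonglongrightarrow> (if t > 0 then 1 else 0)" for t
  proof (rule tendsto_eventually)
    show "\<forall>\<^sub>F n in sequentially. h' n t = (if t > 0 then 1 else 0)"
    proof (cases "t > 0")
      case True
      show ?thesis using ev[OF True]
        
        proof eventually_elim
          case (elim n)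
          then show ?case using True r[of n] by (simp add: h'_def)
        qed
    next
      case False
      have "h' n t = 0" for n
      proof -
        have "max t 0 = 0" "max (t - r n) 0 = 0" using False r[of n] by auto
        then show ?thesis by (simp add: h'_def)
      qed
      then show ?thesis using False by simp
    qed
  qed
  show ?thesis
  proof (rule weak_partial_dominated_limit[OF \<Omega> weak_partial_compose[OF \<Omega> w i hd hc hb] i, where U = u and D = d])
    show "(\<lambda>n. h n (u x)) \<longlonglongrightarrow> max (u x) 0" for x by (rule l1)
    show "(\<lambda>n. h' n (u x) * d x) \<longlonglongrightarrow> (if u x > 0 then d x else 0)" for x
      using tendsto_mult_right[OF l2[of "u x"], of "d x"] by (simp split: if_splits)
    show "\<bar>h n (u x)\<bar> \<le> \<bar>u x\<bar>" for n x by (rule hbd)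
    show "\<bar>h' n (u x) * d x\<bar> \<le> \<bar>d x\<bar>" for n x
      using hb[of n "u x"] mult_right_mono[of "\<bar>h' n (u x)\<bar>" 1 "\<bar>d x\<bar>"] by (simp add: abs_mult)
  qed (use w in \<open>auto simp: weak_partial_def\<close>)
qed

section \<open>Sobolev functions vanishing on the boundary\<close>

lemma integrable_compact_support_on:
  fixes g :: "'a::euclidean_space \<Rightarrow> real"
  assumes "continuous_on UNIV g" "compact S" "\<And>x. x \<notin> S \<Longrightarrow> g x = 0" "T \<in> sets lebesgue"
  shows "integrable (lebesgue_on T) g"
proof -
  have "integrable lebesgue g"
    using integrable_continuous_compact_support[OF assms(1-3)] assms(1)
    by (subst integrable_completion) (auto simp: borel_measurable_continuous_onI)
  then have "integrable lebesgue (\<lambda>x. indicator T x *\<^sub>R g x)"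
    by (rule integrable_mult_indicator[OF assms(4)])
  then show ?thesis using assms(4) by (simp add: integrable_restrict_space)
qed

section \<open>The chosen weak gradient and the Sobolev classes\<close>

lemma has_weak_grad_choice: "has_weak_grad \<Omega> u D \<Longrightarrow> has_weak_grad \<Omega> u (weak_grad \<Omega> u)"
  unfolding weak_grad_def by (rule someI[where P = "has_weak_grad \<Omega> u"])

lemma has_weak_grad_weak_grad: "u \<in> sobolev p \<Omega> \<Longrightarrow> has_weak_grad \<Omega> u (weak_grad \<Omega> u)"
  by (auto simp: sobolev_def intro: has_weak_grad_choice)

lemma has_weak_grad_unique:
  assumes "open \<Omega>" "has_weak_grad \<Omega> u D" "has_weak_grad \<Omega> u E"
  shows "AE x in lebesgue_on \<Omega>. D x = E x"
proof -
  have "\<forall>i\<in>Basis. AE x in lebesgue_on \<Omega>. D x \<bullet> i = E x \<bullet> i"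
    using assms weak_partial_unique[OF assms(1)] unfolding has_weak_grad_iff_weak_partial by blast
  then have "AE x in lebesgue_on \<Omega>. \<forall>i\<in>Basis. D x \<bullet> i = E x \<bullet> i"
    by (intro AE_finite_allI) auto
  then show ?thesis by eventually_elim (rule euclidean_eqI, blast)
qed

lemma has_weak_grad_measurable:
  fixes D :: "'a::euclidean_space \<Rightarrow> 'a"
  assumes "open \<Omega>" "has_weak_grad \<Omega> u D"
  shows "D \<in> borel_measurable (lebesgue_on \<Omega>)"
proof -
  have "(\<lambda>x. D x \<bullet> i) \<in> borel_measurable (lebesgue_on \<Omega>)" if "i \<in> Basis" for i
    using weak_partial_measurable(2)[OF assms(1), of i u "\<lambda>x. D x \<bullet> i"] assms(2) that
    by (simp add: has_weak_grad_iff_weak_partial)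
  then show ?thesis by (subst borel_measurable_euclidean_space) blast
qed

text \<open>Membership provides some weak gradient in the Lebesgue class; almost everywhere
  uniqueness transfers this to the representative fixed by \<open>weak_grad\<close>.\<close>

lemma sobolev_in_Lp:
  assumes "open \<Omega>" "u \<in> sobolev p \<Omega>"
  shows "in_Lp p \<Omega> u" "in_Lp p \<Omega> (weak_grad \<Omega> u)"
proof -
  obtain D where D: "in_Lp p \<Omega> u" "has_weak_grad \<Omega> u D" "in_Lp p \<Omega> D"
    using assms(2) by (auto simp: sobolev_def)
  show "in_Lp p \<Omega> u" by (rule D)
  note w = has_weak_grad_weak_grad[OF assms(2)]
  have e: "AE x in lebesgue_on \<Omega>. D x = weak_grad \<Omega> u x" by (rule has_weak_grad_unique[OF assms(1) D(2) w])
  have m: "weak_grad \<Omega> u \<in> borel_measurable (lebesgue_on \<Omega>)" by (rule has_weak_grad_measurable[OF assms(1) w])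
  have "integrable (lebesgue_on \<Omega>) (\<lambda>x. norm (weak_grad \<Omega> u x) powr p)"
    by (rule integrable_cong_AE_imp[of _ "\<lambda>x. norm (D x) powr p"])
       (use D(3) m e in \<open>auto simp: in_Lp_def elim: AE_mp\<close>)
  with m show "in_Lp p \<Omega> (weak_grad \<Omega> u)" by (simp add: in_Lp_def)
qed

lemma in_Lp_1_integrable: "in_Lp 1 \<Omega> f \<Longrightarrow> integrable (lebesgue_on \<Omega>) f"
  unfolding in_Lp_def using integrable_norm_iff[of f "lebesgue_on \<Omega>"] by simp

lemma norm_powr_2: "norm x powr 2 = (norm x)\<^sup>2"
  by (cases "norm x = 0") (auto simp: powr_numeral)

lemma in_Lp_2_component:
  fixes D :: "'a::euclidean_space \<Rightarrow> 'b::euclidean_space"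
  assumes "in_Lp 2 \<Omega> D" "i \<in> Basis"
  shows "(\<lambda>x. D x \<bullet> i) \<in> borel_measurable (lebesgue_on \<Omega>)"
    "integrable (lebesgue_on \<Omega>) (\<lambda>x. (D x \<bullet> i)\<^sup>2)"
proof -
  have m[measurable]: "D \<in> borel_measurable (lebesgue_on \<Omega>)" using assms(1) by (simp add: in_Lp_def)
  show m': "(\<lambda>x. D x \<bullet> i) \<in> borel_measurable (lebesgue_on \<Omega>)" by measurable
  show "integrable (lebesgue_on \<Omega>) (\<lambda>x. (D x \<bullet> i)\<^sup>2)"
  proof (rule Bochner_Integration.integrable_bound)
    show "integrable (lebesgue_on \<Omega>) (\<lambda>x. (norm (D x))\<^sup>2)"
      using assms(1) by (simp add: in_Lp_def norm_powr_2)
    have "(D x \<bullet> i)\<^sup>2 \<le> (norm (D x))\<^sup>2" for x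
      using Basis_le_norm[OF assms(2), of "D x"] by (simp add: abs_le_square_iff[symmetric])
    then show "AE x in lebesgue_on \<Omega>. norm ((D x \<bullet> i)\<^sup>2) \<le> norm ((norm (D x))\<^sup>2)" by simp
  qed (use m' in simp)
qed

lemma sobolev_2_facts:
  fixes u :: "'a::euclidean_space \<Rightarrow> real"
  assumes "open \<Omega>" "u \<in> sobolev 2 \<Omega>" "i \<in> Basis"
  shows "weak_partial \<Omega> i u (\<lambda>x. weak_grad \<Omega> u x \<bullet> i)"
    "u \<in> borel_measurable (lebesgue_on \<Omega>)" "integrable (lebesgue_on \<Omega>) (\<lambda>x. (u x)\<^sup>2)"
    "(\<lambda>x. weak_grad \<Omega> u x \<bullet> i) \<in> borel_measurable (lebesgue_on \<Omega>)"
    "integrable (lebesgue_on \<Omega>) (\<lambda>x. (weak_grad \<Omega> u x \<bullet> i)\<^sup>2)"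
  using has_weak_grad_weak_grad[OF assms(2)] assms(3) sobolev_in_Lp[OF assms(1,2)] in_Lp_2_component[OF _ assms(3)]
    in_Lp_2_component[of \<Omega> u 1]
  by (auto simp: has_weak_grad_iff_weak_partial)

lemma finite_measure_bounded_open:
  fixes \<Omega> :: "'a::euclidean_space set"
  assumes "open \<Omega>" "bounded \<Omega>"
  shows "finite_measure (lebesgue_on \<Omega>)"
  using assms by (intro finite_measure_lebesgue_on lmeasurable_open)

lemma integrable_square_imp_integrable:
  fixes f :: "'a \<Rightarrow> real"
  assumes "finite_measure M" "f \<in> borel_measurable M" "integrable M (\<lambda>x. (f x)\<^sup>2)"
  shows "integrable M f"
  using integrable_mult_squares[of "\<lambda>x. 1" M f] assms
  by (simp add: finite_measure.integrable_const)

definition gradient :: "('a::euclidean_space \<Rightarrow> real) \<Rightarrow> 'a \<Rightarrow> 'a" where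
  "gradient \<phi> x = (\<Sum>i\<in>Basis. frechet_derivative \<phi> (at x) i *\<^sub>R i)"

lemma gradient_component: "i \<in> Basis \<Longrightarrow> gradient \<phi> x \<bullet> i = frechet_derivative \<phi> (at x) i"
  by (simp add: gradient_def)

text \<open>Replaces the closure in the Sobolev norm by one sequence with explicit componentwise
  convergence; a subsequence adds pointwise convergence.\<close>

lemma sobolev0_approx:
  fixes w :: "'a::euclidean_space \<Rightarrow> real"
  assumes \<Omega>: "open \<Omega>" and w: "w \<in> sobolev0 1 \<Omega>"
  obtains \<phi> where "\<And>n. \<phi> n \<in> test_fun \<Omega>" "AE x in lebesgue_on \<Omega>. (\<lambda>n. \<phi> n x) \<longlonglongrightarrow> w x"
    "\<And>i. i \<in> Basis \<Longrightarrow> (\<lambda>n. LINT x|lebesgue_on \<Omega>. \<bar>frechet_derivative (\<phi> n) (at x) i - weak_grad \<Omega> w x \<bullet> i\<bar>) \<longlonglongrightarrow> 0"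
proof -
  have ws: "w \<in> sobolev 1 \<Omega>" using w by (simp add: sobolev0_def)
  let ?W = "weak_grad \<Omega> w"
  note hw = has_weak_grad_weak_grad[OF ws]
  have "in_Lp 1 \<Omega> w" "in_Lp 1 \<Omega> ?W" using sobolev_in_Lp[OF \<Omega> ws] .
  then have mw: "w \<in> borel_measurable (lebesgue_on \<Omega>)" "?W \<in> borel_measurable (lebesgue_on \<Omega>)"
    and iw: "integrable (lebesgue_on \<Omega>) w" "integrable (lebesgue_on \<Omega>) ?W"
    using in_Lp_1_integrable[of \<Omega> w] in_Lp_1_integrable[of \<Omega> ?W] unfolding in_Lp_def by blast+
  have "\<exists>\<phi>. \<phi> \<in> test_fun \<Omega> \<and> sobolev_norm 1 \<Omega> (\<lambda>x. w x - \<phi> x) < inverse (real (Suc n))" for n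
    using w unfolding sobolev0_def by (auto simp: Bex_def)
  then obtain \<phi> where \<phi>: "\<And>n. \<phi> n \<in> test_fun \<Omega>"
    and \<phi>n: "\<And>n. sobolev_norm 1 \<Omega> (\<lambda>x. w x - \<phi> n x) < inverse (real (Suc n))" by metis
  have c: "continuous_on UNIV (\<phi> n)" "continuous_on UNIV (\<lambda>x. frechet_derivative (\<phi> n) (at x) i)"
    if "i \<in> Basis" for n i
    using test_fun_partial[OF \<phi> that] by (auto simp: has_partial_def)
  have i\<phi>: "integrable (lebesgue_on \<Omega>) (\<phi> n)" "integrable (lebesgue_on \<Omega>) (\<lambda>x. frechet_derivative (\<phi> n) (at x) i)"
    if "i \<in> Basis" for n i
  proof -
    obtain K where K: "compact K" "\<And>x. x \<notin> K \<Longrightarrow> \<phi> n x = 0"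
      and K0: "\<And>i x. i \<in> Basis \<Longrightarrow> x \<notin> K \<Longrightarrow> frechet_derivative (\<phi> n) (at x) i = 0"
      using test_fun_support[OF \<phi>[of n]] by metis
    show "integrable (lebesgue_on \<Omega>) (\<phi> n)" "integrable (lebesgue_on \<Omega>) (\<lambda>x. frechet_derivative (\<phi> n) (at x) i)"
      using integrable_compact_support_on[OF c(1)[OF that] K(1,2)] integrable_compact_support_on[OF c(2)[OF that] K(1) K0[OF that]]
        open_lebesgue_sets[OF \<Omega>] by auto
  qed
  have i\<phi>1: "integrable (lebesgue_on \<Omega>) (\<phi> n)" for n using i\<phi>(1)[OF SOME_Basis] .
  have ig: "integrable (lebesgue_on \<Omega>) (gradient (\<phi> n))" for n
    unfolding gradient_def[abs_def] by (intro Bochner_Integration.integrable_sum integrable_scaleR_left) (use i\<phi> in auto)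
  \<comment> \<open>For p = 1 the norm is the plain sum of two integrals. Its gradient is the one
    chosen for \<open>w - \<phi> n\<close>, which uniqueness matches with the difference of the
    gradients.\<close>
  have bd: "(LINT x|lebesgue_on \<Omega>. \<bar>\<phi> n x - w x\<bar>) + (LINT x|lebesgue_on \<Omega>. norm (gradient (\<phi> n) x - ?W x)) < inverse (real (Suc n))" for n
  proof -
    have g: "has_weak_grad \<Omega> (\<lambda>x. w x - \<phi> n x) (\<lambda>x. ?W x - gradient (\<phi> n) x)"
      unfolding has_weak_grad_iff_weak_partial
    proof
      fix i :: 'a assume i: "i \<in> Basis"
      have "weak_partial \<Omega> i (\<lambda>x. w x - \<phi> n x) (\<lambda>x. ?W x \<bullet> i - frechet_derivative (\<phi> n) (at x) i)"
        using hw i by (intro weak_partial_diff[OF \<Omega> _ has_partial_imp_weak_partial[OF \<Omega> test_fun_partial[OF \<phi> i] i] i])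
          (simp add: has_weak_grad_iff_weak_partial)
      then show "weak_partial \<Omega> i (\<lambda>x. w x - \<phi> n x) (\<lambda>x. (?W x - gradient (\<phi> n) x) \<bullet> i)"
        by (simp add: inner_diff_left gradient_component[OF i])
    qed
    then have g': "has_weak_grad \<Omega> (\<lambda>x. w x - \<phi> n x) (weak_grad \<Omega> (\<lambda>x. w x - \<phi> n x))"
      by (rule has_weak_grad_choice)
    have "(LINT x|lebesgue_on \<Omega>. norm (weak_grad \<Omega> (\<lambda>x. w x - \<phi> n x) x)) = (LINT x|lebesgue_on \<Omega>. norm (gradient (\<phi> n) x - ?W x))"
    proof (rule integral_cong_AE)
      show "AE x in lebesgue_on \<Omega>. norm (weak_grad \<Omega> (\<lambda>x. w x - \<phi> n x) x) = norm (gradient (\<phi> n) x - ?W x)"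
        using has_weak_grad_unique[OF \<Omega> g g'] by eventually_elim (simp add: norm_minus_commute flip: )
    qed (use has_weak_grad_measurable[OF \<Omega> g'] has_weak_grad_measurable[OF \<Omega> g] ig mw in auto)
    then show ?thesis
      using \<phi>n[of n] by (simp add: sobolev_norm_def abs_minus_commute)
  qed
  have nn: "(LINT x|lebesgue_on \<Omega>. \<bar>\<phi> n x - w x\<bar>) \<ge> 0" "(LINT x|lebesgue_on \<Omega>. norm (gradient (\<phi> n) x - ?W x)) \<ge> 0" for n
    by auto
  have l1: "(\<lambda>n. LINT x|lebesgue_on \<Omega>. \<bar>\<phi> n x - w x\<bar>) \<longlonglongrightarrow> 0"
  proof (rule tendsto_sandwich[OF _ _ tendsto_const LIMSEQ_inverse_real_of_nat])
    show "\<forall>\<^sub>F n in sequentially. (LINT x|lebesgue_on \<Omega>. \<bar>\<phi> n x - w x\<bar>) \<le> inverse (real (Suc n))"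
      using bd nn by (intro always_eventually allI) (smt (verit))
  qed simp
  have l2: "(\<lambda>n. LINT x|lebesgue_on \<Omega>. \<bar>frechet_derivative (\<phi> n) (at x) i - ?W x \<bullet> i\<bar>) \<longlonglongrightarrow> 0"
    if i: "i \<in> Basis" for i
  proof (rule tendsto_sandwich[OF _ _ tendsto_const LIMSEQ_inverse_real_of_nat])
    show "\<forall>\<^sub>F n in sequentially. (LINT x|lebesgue_on \<Omega>. \<bar>frechet_derivative (\<phi> n) (at x) i - ?W x \<bullet> i\<bar>) \<le> inverse (real (Suc n))"
    proof (intro always_eventually allI)
      fix n
      have "(LINT x|lebesgue_on \<Omega>. \<bar>frechet_derivative (\<phi> n) (at x) i - ?W x \<bullet> i\<bar>)
        \<le> (LINT x|lebesgue_on \<Omega>. norm (gradient (\<phi> n) x - ?W x))"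
      proof (rule integral_mono)
        show "\<bar>frechet_derivative (\<phi> n) (at x) i - ?W x \<bullet> i\<bar> \<le> norm (gradient (\<phi> n) x - ?W x)" for x
          using Basis_le_norm[OF i, of "gradient (\<phi> n) x - ?W x"] by (simp add: inner_diff_left gradient_component[OF i])
      qed (use i\<phi>(2)[OF i] ig iw in auto)
      then show "(LINT x|lebesgue_on \<Omega>. \<bar>frechet_derivative (\<phi> n) (at x) i - ?W x \<bullet> i\<bar>) \<le> inverse (real (Suc n))"
        using bd[of n] nn[of n] by linarith
    qed
  qed simp
  have "\<exists>r::nat\<Rightarrow>nat. strict_mono r \<and> (AE x in lebesgue_on \<Omega>. (\<lambda>n. \<phi> (r n) x - w x) \<longlonglongrightarrow> 0)"
    by (rule tendsto_L1_AE_subseq[where u = "\<lambda>n x. \<phi> n x - w x"]) (use i\<phi>1 iw l1 in auto)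
  then obtain r where r: "strict_mono r" "AE x in lebesgue_on \<Omega>. (\<lambda>n. \<phi> (r n) x - w x) \<longlonglongrightarrow> 0"
    by blast
  show thesis
  proof (rule that[of "\<lambda>n. \<phi> (r n)"])
    show "\<phi> (r n) \<in> test_fun \<Omega>" for n by (rule \<phi>)
    show "AE x in lebesgue_on \<Omega>. (\<lambda>n. \<phi> (r n) x) \<longlonglongrightarrow> w x" using r(2) by (simp add: LIM_zero_iff)
    show "(\<lambda>n. LINT x|lebesgue_on \<Omega>. \<bar>frechet_derivative (\<phi> (r n)) (at x) i - ?W x \<bullet> i\<bar>) \<longlonglongrightarrow> 0"
      if "i \<in> Basis" for i
      using LIMSEQ_subseq_LIMSEQ[OF l2[OF that] r(1)] by (simp add: o_def)
  qed
qed

text \<open>Vanishing on the closed negative half-line makes h(a) a function of the positive part of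
  a, the only part that test functions approximate. The common bound \<open>B\<close> lets h and h'
  multiply sequences that converge in L1.\<close>

definition cutoff :: "real \<Rightarrow> (real \<Rightarrow> real) \<Rightarrow> (real \<Rightarrow> real) \<Rightarrow> bool" where
  "cutoff B h h' \<longleftrightarrow> (\<forall>t. (h has_real_derivative h' t) (at t)) \<and> continuous_on UNIV h' \<and>
     (\<forall>t. \<bar>h t\<bar> \<le> B \<and> \<bar>h' t\<bar> \<le> B) \<and> (\<forall>t\<le>0. h t = 0 \<and> h' t = 0)"

text \<open>A function \<open>a\<close> whose positive part is the limit in \<open>W\<^sup>1\<^sup>,\<^sup>1\<close> of the test functions \<open>\<phi> n\<close>.\<close>

locale vanishing_pos_part =
  fixes \<Omega> :: "'a::euclidean_space set" and a :: "'a \<Rightarrow> real" and A :: "'a \<Rightarrow> 'a" and \<phi> :: "nat \<Rightarrow> 'a \<Rightarrow> real"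
  assumes open_dom: "open \<Omega>" and bounded_dom: "bounded \<Omega>"
    and grad: "i \<in> Basis \<Longrightarrow> weak_partial \<Omega> i a (\<lambda>x. A x \<bullet> i)"
    and grad_L2: "i \<in> Basis \<Longrightarrow> integrable (lebesgue_on \<Omega>) (\<lambda>x. (A x \<bullet> i)\<^sup>2)"
    and test: "\<phi> n \<in> test_fun \<Omega>"
    and approx: "AE x in lebesgue_on \<Omega>. (\<lambda>n. \<phi> n x) \<longlonglongrightarrow> max (a x) 0"
    and approx_grad: "i \<in> Basis \<Longrightarrow> (\<lambda>n. LINT x|lebesgue_on \<Omega>.
      \<bar>frechet_derivative (\<phi> n) (at x) i - (if a x > 0 then A x \<bullet> i else 0)\<bar>) \<longlonglongrightarrow> 0"
begin

lemma measurable_a [measurable]: "a \<in> borel_measurable (lebesgue_on \<Omega>)"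
  using weak_partial_measurable(1)[OF open_dom grad[OF SOME_Basis]] .

lemma measurable_A [measurable]: "i \<in> Basis \<Longrightarrow> (\<lambda>x. A x \<bullet> i) \<in> borel_measurable (lebesgue_on \<Omega>)"
  using weak_partial_measurable(2)[OF open_dom grad] .

lemma integrable_A: "i \<in> Basis \<Longrightarrow> integrable (lebesgue_on \<Omega>) (\<lambda>x. A x \<bullet> i)"
  by (rule integrable_square_imp_integrable[OF finite_measure_bounded_open[OF open_dom bounded_dom]])
     (auto intro: grad_L2 measurable_A)

lemma cutoff_measurable:
  assumes "cutoff B h h'"
  shows "(\<lambda>x. h (a x)) \<in> borel_measurable (lebesgue_on \<Omega>)" "(\<lambda>x. h' (a x)) \<in> borel_measurable (lebesgue_on \<Omega>)"
proof -
  have "continuous_on UNIV h"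
    using assms by (auto simp: cutoff_def intro!: continuous_at_imp_continuous_on DERIV_isCont)
  moreover have "continuous_on UNIV h'" using assms by (simp add: cutoff_def)
  ultimately have "h \<in> borel_measurable borel" "h' \<in> borel_measurable borel"
    by (simp_all add: borel_measurable_continuous_onI)
  then show "(\<lambda>x. h (a x)) \<in> borel_measurable (lebesgue_on \<Omega>)" "(\<lambda>x. h' (a x)) \<in> borel_measurable (lebesgue_on \<Omega>)"
    using measurable_compose[OF measurable_a] by blast+
qed

text \<open>The factor \<open>q\<close> may be nonzero up to the boundary of \<Omega>: the function
  tested for each n is \<open>h (\<phi> n x) * q x\<close>, compactly supported in \<Omega>, and the
  identity without boundary term survives the limit. \<open>V\<close> is bounded because it
  multiplies the derivatives of \<open>\<phi> n\<close>, which converge in L1.\<close>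

lemma integral_by_parts_cutoff:
  assumes i: "i \<in> Basis" and cut: "cutoff B h h'"
    and V: "weak_partial \<Omega> i V e" "integrable (lebesgue_on \<Omega>) e" "\<And>x. x \<in> \<Omega> \<Longrightarrow> \<bar>V x\<bar> \<le> M"
    and q: "has_partial i q q'" "\<And>x. x \<in> \<Omega> \<Longrightarrow> \<bar>q x\<bar> \<le> b" "\<And>x. x \<in> \<Omega> \<Longrightarrow> \<bar>q' x\<bar> \<le> b"
  shows "(LINT x|lebesgue_on \<Omega>. (h (a x) * e x + V x * (h' (a x) * (A x \<bullet> i))) * q x)
    = - (LINT x|lebesgue_on \<Omega>. V x * h (a x) * q' x)"
proof -
  let ?d = "\<lambda>n x. frechet_derivative (\<phi> n) (at x) i"
  let ?W = "\<lambda>x. if a x > 0 then A x \<bullet> i else 0"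
  interpret finite_measure "lebesgue_on \<Omega>" by (rule finite_measure_bounded_open[OF open_dom bounded_dom])
  have h: "\<And>t. (h has_real_derivative h' t) (at t)" "continuous_on UNIV h'" "\<And>t. \<bar>h t\<bar> \<le> B" "\<And>t. \<bar>h' t\<bar> \<le> B"
    "\<And>t. t \<le> 0 \<Longrightarrow> h t = 0" "\<And>t. t \<le> 0 \<Longrightarrow> h' t = 0" using cut by (auto simp: cutoff_def)
  have hc: "continuous_on UNIV h" using h(1) by (meson DERIV_isCont continuous_at_imp_continuous_on)
  note [measurable] = cutoff_measurable[OF cut] weak_partial_measurable[OF open_dom V(1)]
  have p: "has_partial i (\<phi> n) (?d n)" for n by (rule test_fun_partial[OF test i])
  have c: "continuous_on UNIV (\<phi> n)" "continuous_on UNIV (?d n)" for n using p by (auto simp: has_partial_def)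
  have cq: "continuous_on UNIV q" "continuous_on UNIV q'" using q(1) by (auto simp: has_partial_def)
  note [measurable] = continuous_measurable_lebesgue_on[OF c(1), where S = \<Omega>] continuous_measurable_lebesgue_on[OF c(2), where S = \<Omega>]
    continuous_measurable_lebesgue_on[OF cq(1), where S = \<Omega>] continuous_measurable_lebesgue_on[OF cq(2), where S = \<Omega>]
  have ch: "continuous_on UNIV (\<lambda>x. h (\<phi> n x))" "continuous_on UNIV (\<lambda>x. h' (\<phi> n x))" for n
    using continuous_on_compose2[OF hc c(1)] continuous_on_compose2[OF h(2) c(1)] by auto
  note [measurable] = continuous_measurable_lebesgue_on[OF ch(1), where S = \<Omega>] continuous_measurable_lebesgue_on[OF ch(2), where S = \<Omega>]
  have di: "integrable (lebesgue_on \<Omega>) (?d n)" for n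
  proof -
    obtain K where K: "compact K" "\<And>x. x \<notin> K \<Longrightarrow> ?d n x = 0"
      using test_fun_support[OF test[of n]] i by metis
    show ?thesis by (rule integrable_compact_support_on[OF c(2) K open_lebesgue_sets[OF open_dom]])
  qed
  have Wi: "integrable (lebesgue_on \<Omega>) ?W"
    by (rule Bochner_Integration.integrable_bound[OF integrable_A[OF i]]) (use i in auto)
  have Vi: "integrable (lebesgue_on \<Omega>) V"
    by (rule integrable_const_bound[of _ M]) (use V(3) in \<open>auto intro: AE_I2\<close>)
  have ahl: "AE x in lebesgue_on \<Omega>. (\<lambda>n. h (\<phi> n x)) \<longlonglongrightarrow> h (a x)"
    using approx
  proof eventually_elim
    case (elim x)
    have "(\<lambda>n. h (\<phi> n x)) \<longlonglongrightarrow> h (max (a x) 0)" by (rule continuous_on_tendsto_compose[OF hc elim]) auto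
    moreover have "h (max (a x) 0) = h (a x)" using h(5) by (cases "a x \<le> 0") auto
    ultimately show ?case by simp
  qed
  have ahl': "AE x in lebesgue_on \<Omega>. (\<lambda>n. h' (\<phi> n x)) \<longlonglongrightarrow> h' (a x)"
    using approx
  proof eventually_elim
    case (elim x)
    have "(\<lambda>n. h' (\<phi> n x)) \<longlonglongrightarrow> h' (max (a x) 0)" by (rule continuous_on_tendsto_compose[OF h(2) elim]) auto
    moreover have "h' (max (a x) 0) = h' (a x)" using h(6) by (cases "a x \<le> 0") auto
    ultimately show ?case by simp
  qed
  have W: "h' (a x) * ?W x = h' (a x) * (A x \<bullet> i)" for x using h(6)[of "a x"] by auto
  have t1: "(\<lambda>n. LINT x|lebesgue_on \<Omega>. (V x * q x * h' (\<phi> n x)) * ?d n x) \<longlonglongrightarrow> (LINT x|lebesgue_on \<Omega>. (V x * q x * h' (a x)) * ?W x)"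
  and i1: "\<And>n. integrable (lebesgue_on \<Omega>) (\<lambda>x. (V x * q x * h' (\<phi> n x)) * ?d n x)"
  and i1': "integrable (lebesgue_on \<Omega>) (\<lambda>x. (V x * q x * h' (a x)) * ?W x)"
  proof -
    have bnd: "\<bar>V x * q x * h' (\<phi> n x)\<bar> \<le> M * b * B" if "x \<in> space (lebesgue_on \<Omega>)" for n x
    proof -
      have "x \<in> \<Omega>" using that by simp
      then have "0 \<le> M" "0 \<le> b" using V(3)[of x] q(2)[of x] by linarith+
      then show ?thesis unfolding abs_mult using V(3)[OF \<open>x \<in> \<Omega>\<close>] q(2)[OF \<open>x \<in> \<Omega>\<close>] h(4)
        by (intro mult_mono mult_nonneg_nonneg) auto
    qed
    have lim: "AE x in lebesgue_on \<Omega>. (\<lambda>n. V x * q x * h' (\<phi> n x)) \<longlonglongrightarrow> V x * q x * h' (a x)"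
      using ahl' by eventually_elim (intro tendsto_intros)
    have m1: "(\<lambda>x. V x * q x * h' (\<phi> n x)) \<in> borel_measurable (lebesgue_on \<Omega>)" for n by measurable
    have m2: "(\<lambda>x. V x * q x * h' (a x)) \<in> borel_measurable (lebesgue_on \<Omega>)" by measurable
    note L = L1_tendsto_mult[OF di Wi approx_grad[OF i] m1 m2 bnd lim]
    show "(\<lambda>n. LINT x|lebesgue_on \<Omega>. (V x * q x * h' (\<phi> n x)) * ?d n x) \<longlonglongrightarrow> (LINT x|lebesgue_on \<Omega>. (V x * q x * h' (a x)) * ?W x)"
      "\<And>n. integrable (lebesgue_on \<Omega>) (\<lambda>x. (V x * q x * h' (\<phi> n x)) * ?d n x)"
      "integrable (lebesgue_on \<Omega>) (\<lambda>x. (V x * q x * h' (a x)) * ?W x)"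
      using L by auto
  qed
  have gen: "(\<lambda>n. LINT x|lebesgue_on \<Omega>. (r x * h (\<phi> n x)) * f x) \<longlonglongrightarrow> (LINT x|lebesgue_on \<Omega>. (r x * h (a x)) * f x)"
    "integrable (lebesgue_on \<Omega>) (\<lambda>x. (r x * h (\<phi> n x)) * f x)"
    "integrable (lebesgue_on \<Omega>) (\<lambda>x. (r x * h (a x)) * f x)"
    if f: "integrable (lebesgue_on \<Omega>) f" and r: "continuous_on UNIV r" "\<forall>x\<in>\<Omega>. \<bar>r x\<bar> \<le> b" for f r n
  proof -
    have bnd: "\<bar>r x * h (\<phi> n x)\<bar> \<le> b * B" if "x \<in> space (lebesgue_on \<Omega>)" for n x
    proof -
      have "x \<in> \<Omega>" using that by simp
      then show ?thesis unfolding abs_mult using bspec[OF r(2) \<open>x \<in> \<Omega>\<close>] h(3)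
        by (intro mult_mono) auto
    qed
    note [measurable] = continuous_measurable_lebesgue_on[OF r(1), where S = \<Omega>]
    have lim: "AE x in lebesgue_on \<Omega>. (\<lambda>n. r x * h (\<phi> n x)) \<longlonglongrightarrow> r x * h (a x)"
      using ahl by eventually_elim (intro tendsto_intros)
    have m1: "(\<lambda>x. r x * h (\<phi> n x)) \<in> borel_measurable (lebesgue_on \<Omega>)" for n by measurable
    have m2: "(\<lambda>x. r x * h (a x)) \<in> borel_measurable (lebesgue_on \<Omega>)" by measurable
    have z: "(\<lambda>n::nat. LINT x|lebesgue_on \<Omega>. \<bar>f x - f x\<bar>) \<longlonglongrightarrow> 0" by simp
    note L = L1_tendsto_mult[OF f f z m1 m2 bnd lim]
    show "(\<lambda>n. LINT x|lebesgue_on \<Omega>. (r x * h (\<phi> n x)) * f x) \<longlonglongrightarrow> (LINT x|lebesgue_on \<Omega>. (r x * h (a x)) * f x)"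
      "integrable (lebesgue_on \<Omega>) (\<lambda>x. (r x * h (\<phi> n x)) * f x)"
      "integrable (lebesgue_on \<Omega>) (\<lambda>x. (r x * h (a x)) * f x)"
      using L by auto
  qed
  have qb: "\<forall>x\<in>\<Omega>. \<bar>q x\<bar> \<le> b" "\<forall>x\<in>\<Omega>. \<bar>q' x\<bar> \<le> b" using q by auto
  note t2 = gen[OF Vi cq(2) qb(2)] and t3 = gen[OF V(2) cq(1) qb(1)]
  \<comment> \<open>The weak derivative of \<open>V\<close> is tested with
    \<open>h (\<phi> n x) * q x\<close>. It is supported where \<open>\<phi> n\<close> is, since
    h(0) = 0, and has only the regularity of \<open>has_partial\<close>.\<close>
  have id: "(LINT x|lebesgue_on \<Omega>. (V x * q x * h' (\<phi> n x)) * ?d n x) + (LINT x|lebesgue_on \<Omega>. (q' x * h (\<phi> n x)) * V x)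
    = - (LINT x|lebesgue_on \<Omega>. (q x * h (\<phi> n x)) * e x)" for n
  proof -
    obtain K where K: "compact K" "K \<subseteq> \<Omega>" "\<And>x. x \<notin> K \<Longrightarrow> \<phi> n x = 0"
      using test_fun_support[OF test[of n]] by metis
    have "(LINT x|lebesgue_on \<Omega>. V x * (h' (\<phi> n x) * ?d n x * q x + h (\<phi> n x) * q' x)) = - (LINT x|lebesgue_on \<Omega>. e x * (h (\<phi> n x) * q x))"
      by (rule weak_partial_integral[OF open_dom V(1) i has_partial_mult[OF has_partial_compose[OF p h(1,2)] q(1)] K(1,2)])
         (simp add: K(3) h(5))
    moreover have "V x * (h' (\<phi> n x) * ?d n x * q x + h (\<phi> n x) * q' x) = (V x * q x * h' (\<phi> n x)) * ?d n x + (q' x * h (\<phi> n x)) * V x" for x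
      by (simp add: algebra_simps)
    moreover have "e x * (h (\<phi> n x) * q x) = (q x * h (\<phi> n x)) * e x" for x by simp
    ultimately show ?thesis using i1[of n] t2(2)[of n] by simp
  qed
  have "(LINT x|lebesgue_on \<Omega>. (V x * q x * h' (a x)) * ?W x) + (LINT x|lebesgue_on \<Omega>. (q' x * h (a x)) * V x)
    = - (LINT x|lebesgue_on \<Omega>. (q x * h (a x)) * e x)"
    by (rule LIMSEQ_unique[OF tendsto_add[OF t1 t2(1)]]) (unfold id, rule tendsto_minus[OF t3(1)])
  then have "(LINT x|lebesgue_on \<Omega>. (V x * q x * h' (a x)) * ?W x) + (LINT x|lebesgue_on \<Omega>. (q x * h (a x)) * e x)
    = - (LINT x|lebesgue_on \<Omega>. (q' x * h (a x)) * V x)" by linarith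
  moreover have "(LINT x|lebesgue_on \<Omega>. (V x * q x * h' (a x)) * ?W x) + (LINT x|lebesgue_on \<Omega>. (q x * h (a x)) * e x)
    = (LINT x|lebesgue_on \<Omega>. (V x * q x * h' (a x)) * ?W x + (q x * h (a x)) * e x)"
    using i1' t3(3) by simp
  moreover have "(V x * q x * h' (a x)) * ?W x + (q x * h (a x)) * e x = (h (a x) * e x + V x * (h' (a x) * (A x \<bullet> i))) * q x" for x
  proof -
    have "(V x * q x * h' (a x)) * ?W x = V x * q x * (h' (a x) * (A x \<bullet> i))"
      unfolding mult.assoc[of _ "h' (a x)"] W ..
    then show ?thesis by (simp only: algebra_simps)
  qed
  moreover have "(q' x * h (a x)) * V x = V x * h (a x) * q' x" for x by simp
  ultimately show ?thesis by simp
qed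

end

section \<open>Integration by parts for cut-off functions\<close>

text \<open>A truncation of the identity at height of order m that is C^1, so the chain rule
  applies. Its derivative lies between 0 and 1, so neither the function nor its gradient grows and
  the untruncated integrands dominate as m tends to infinity.\<close>

definition atan_trunc :: "nat \<Rightarrow> real \<Rightarrow> real" where
  "atan_trunc m t = real (Suc m) * arctan (t / real (Suc m))"

definition atan_trunc' :: "nat \<Rightarrow> real \<Rightarrow> real" where
  "atan_trunc' m t = inverse (1 + (t / real (Suc m))\<^sup>2)"

lemma atan_trunc_deriv: "(atan_trunc m has_real_derivative atan_trunc' m t) (at t)"
proof -
  have "((\<lambda>t. t / real (Suc m)) has_real_derivative 1 / real (Suc m)) (at t)"
    by (auto intro!: derivative_eq_intros)
  from DERIV_cmult[OF DERIV_chain2[OF DERIV_arctan this], of "real (Suc m)"]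
  show ?thesis unfolding atan_trunc_def[abs_def] atan_trunc'_def by simp
qed

lemma atan_trunc'_continuous: "continuous_on UNIV (atan_trunc' m)"
proof -
  have "1 + x\<^sup>2 \<noteq> 0" for x :: real using zero_le_power2[of x] by linarith
  then show ?thesis unfolding atan_trunc'_def[abs_def] by (intro continuous_intros) auto
qed

lemma atan_trunc'_bounded: "\<bar>atan_trunc' m t\<bar> \<le> 1"
proof -
  have "1 \<le> 1 + (t / real (Suc m))\<^sup>2" by simp
  then have "inverse (1 + (t / real (Suc m))\<^sup>2) \<le> inverse 1" by (intro le_imp_inverse_le) auto
  then show ?thesis unfolding atan_trunc'_def by simp
qed

lemma atan_trunc_le: "\<bar>atan_trunc m t\<bar> \<le> \<bar>t\<bar>"
proof -
  have "norm (atan_trunc m t - atan_trunc m 0) \<le> 1 * norm (t - 0)"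
    by (rule field_differentiable_bound[of UNIV]) (use atan_trunc_deriv atan_trunc'_bounded in \<open>auto simp: convex_UNIV\<close>)
  then show ?thesis by (simp add: atan_trunc_def)
qed

lemma atan_trunc_bounded: "\<bar>atan_trunc m t\<bar> \<le> real (Suc m) * 2"
proof -
  have "\<bar>arctan (t / real (Suc m))\<bar> < 2"
    using arctan_bounded[of "t / real (Suc m)"] pi_less_4 by (auto simp: abs_less_iff)
  then show ?thesis unfolding atan_trunc_def abs_mult by (intro mult_mono) auto
qed

lemma atan_trunc_tendsto: "(\<lambda>m. atan_trunc m t) \<longlonglongrightarrow> t"
proof (cases "t = 0")
  case False
  have l0: "(\<lambda>m. t / real (Suc m)) \<longlonglongrightarrow> 0" by (rule LIMSEQ_Suc, rule lim_const_over_n)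
  then have "filterlim (\<lambda>m. t / real (Suc m)) (at 0) sequentially"
    using False by (simp add: filterlim_at)
  moreover have "((\<lambda>h. arctan h / h) \<longlongrightarrow> 1) (at 0)"
    using DERIV_arctan[of 0] by (simp add: has_field_derivative_iff)
  ultimately have "(\<lambda>m. arctan (t / real (Suc m)) / (t / real (Suc m))) \<longlonglongrightarrow> 1"
    by (rule filterlim_compose[rotated])
  then have "(\<lambda>m. t * (arctan (t / real (Suc m)) / (t / real (Suc m)))) \<longlonglongrightarrow> t * 1"
    by (rule tendsto_mult_left)
  moreover have "t * (arctan (t / real (Suc m)) / (t / real (Suc m))) = atan_trunc m t" for m
    using False by (simp add: atan_trunc_def del: of_nat_Suc)
  ultimately show ?thesis by simp
qed (simp add: atan_trunc_def)

lemma atan_trunc'_tendsto: "(\<lambda>m. atan_trunc' m t) \<longlonglongrightarrow> 1"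
proof -
  have l0: "(\<lambda>m. t / real (Suc m)) \<longlonglongrightarrow> 0" by (rule LIMSEQ_Suc, rule lim_const_over_n)
  have "(\<lambda>m. inverse (1 + (t / real (Suc m))\<^sup>2)) \<longlonglongrightarrow> inverse (1 + 0\<^sup>2)"
    by (intro tendsto_intros l0) simp
  then show ?thesis by (simp add: atan_trunc'_def)
qed

lemma continuous_bounded_on:
  fixes g :: "'a::euclidean_space \<Rightarrow> real"
  assumes "continuous_on UNIV g" "bounded S"
  obtains b where "\<And>x. x \<in> S \<Longrightarrow> \<bar>g x\<bar> \<le> b"
proof -
  have "compact (g ` closure S)"
    using assms by (meson compact_closure compact_continuous_image continuous_on_subset subset_UNIV)
  then obtain b where "\<forall>x\<in>closure S. norm (g x) \<le> b"
    by (meson bounded_iff compact_imp_bounded image_eqI)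
  then show ?thesis using that[of b] closure_subset[of S] by auto
qed

lemma continuous_bounded_on2:
  fixes f g :: "'a::euclidean_space \<Rightarrow> real"
  assumes "continuous_on UNIV f" "continuous_on UNIV g" "bounded S"
  obtains b where "\<And>x. x \<in> S \<Longrightarrow> \<bar>f x\<bar> \<le> b" "\<And>x. x \<in> S \<Longrightarrow> \<bar>g x\<bar> \<le> b"
proof -
  have "continuous_on UNIV (\<lambda>x. max \<bar>f x\<bar> \<bar>g x\<bar>)" using assms by (intro continuous_intros)
  then obtain b where b: "\<And>x. x \<in> S \<Longrightarrow> \<bar>max \<bar>f x\<bar> \<bar>g x\<bar>\<bar> \<le> b"
    by (rule continuous_bounded_on[OF _ assms(3)]) (rule that)
  show ?thesis by (rule that[of b]) (use b in force)+
qed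

lemma has_partial_const: "has_partial i (\<lambda>x. c) (\<lambda>x. 0)"
  by (simp add: has_partial_def)

context vanishing_pos_part
begin

lemma cutoff_times_integrable:
  assumes "cutoff B h h'" "integrable (lebesgue_on \<Omega>) f"
  shows "integrable (lebesgue_on \<Omega>) (\<lambda>x. h (a x) * f x)" "integrable (lebesgue_on \<Omega>) (\<lambda>x. h' (a x) * f x)"
proof -
  have b: "\<bar>h t\<bar> \<le> B" "\<bar>h' t\<bar> \<le> B" for t using assms(1) by (auto simp: cutoff_def)
  have B: "B \<ge> 0" using b(1)[of 0] by linarith
  note [measurable] = cutoff_measurable[OF assms(1)]
  have [measurable]: "f \<in> borel_measurable (lebesgue_on \<Omega>)" using assms(2) by auto
  have *: "norm (h (a x) * f x) \<le> norm (B * f x)" "norm (h' (a x) * f x) \<le> norm (B * f x)" for x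
    using b[of "a x"] B by (auto simp: abs_mult intro!: mult_right_mono)
  show "integrable (lebesgue_on \<Omega>) (\<lambda>x. h (a x) * f x)"
    by (rule Bochner_Integration.integrable_bound[of _ "\<lambda>x. B * f x"]) (use assms(2) * in auto)
  show "integrable (lebesgue_on \<Omega>) (\<lambda>x. h' (a x) * f x)"
    by (rule Bochner_Integration.integrable_bound[of _ "\<lambda>x. B * f x"]) (use assms(2) * in auto)
qed

lemma cutoff_times_square_integrable:
  assumes "cutoff B h h'" "f \<in> borel_measurable (lebesgue_on \<Omega>)" "integrable (lebesgue_on \<Omega>) (\<lambda>x. (f x)\<^sup>2)"
  shows "integrable (lebesgue_on \<Omega>) (\<lambda>x. (h' (a x) * f x)\<^sup>2)"
proof (rule Bochner_Integration.integrable_bound[of _ "\<lambda>x. B\<^sup>2 * (f x)\<^sup>2"])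
  note [measurable] = cutoff_measurable[OF assms(1)] assms(2)
  show "(\<lambda>x. (h' (a x) * f x)\<^sup>2) \<in> borel_measurable (lebesgue_on \<Omega>)" by measurable
  have "(h' t)\<^sup>2 \<le> B\<^sup>2" for t
    using assms(1) by (auto simp: cutoff_def abs_le_square_iff[symmetric] intro: order_trans[OF _ abs_ge_self])
  then show "AE x in lebesgue_on \<Omega>. norm ((h' (a x) * f x)\<^sup>2) \<le> norm (B\<^sup>2 * (f x)\<^sup>2)"
    by (simp add: power_mult_distrib mult_right_mono)
qed (use assms(3) in auto)

lemma weak_partial_trunc:
  assumes "i \<in> Basis" "weak_partial \<Omega> i f e" "integrable (lebesgue_on \<Omega>) e"
  shows "weak_partial \<Omega> i (\<lambda>x. atan_trunc m (f x)) (\<lambda>x. atan_trunc' m (f x) * e x)"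
    "integrable (lebesgue_on \<Omega>) (\<lambda>x. atan_trunc' m (f x) * e x)"
proof -
  show "weak_partial \<Omega> i (\<lambda>x. atan_trunc m (f x)) (\<lambda>x. atan_trunc' m (f x) * e x)"
    by (rule weak_partial_compose[OF open_dom assms(2,1) atan_trunc_deriv atan_trunc'_continuous atan_trunc'_bounded])
  from weak_partial_measurable(2)[OF open_dom this]
  have m: "(\<lambda>x. atan_trunc' m (f x) * e x) \<in> borel_measurable (lebesgue_on \<Omega>)" .
  have "\<bar>atan_trunc' m (f x) * e x\<bar> \<le> \<bar>e x\<bar>" for x
    unfolding abs_mult using atan_trunc'_bounded by (intro mult_left_le_one_le) auto
  then show "integrable (lebesgue_on \<Omega>) (\<lambda>x. atan_trunc' m (f x) * e x)"
    by (intro Bochner_Integration.integrable_bound[OF assms(3) m]) auto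
qed

text \<open>The case \<open>q = 1\<close>, freed from boundedness: it holds for the truncations of
  \<open>f\<close>, and the limit is dominated because \<open>f\<close> and h'(a) A are both square
  integrable.\<close>

lemma integral_cutoff_component:
  assumes i: "i \<in> Basis" and cut: "cutoff B h h'"
    and f: "weak_partial \<Omega> i f e" "integrable (lebesgue_on \<Omega>) (\<lambda>x. (f x)\<^sup>2)" "integrable (lebesgue_on \<Omega>) e"
  shows "(LINT x|lebesgue_on \<Omega>. h (a x) * e x + f x * (h' (a x) * (A x \<bullet> i))) = 0"
proof -
  note m[measurable] = weak_partial_measurable[OF open_dom f(1)] cutoff_measurable[OF cut] measurable_A[OF i]
  let ?P = "\<lambda>x. h' (a x) * (A x \<bullet> i)"
  have fP: "integrable (lebesgue_on \<Omega>) (\<lambda>x. f x * ?P x)"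
    by (rule integrable_mult_squares) (use f cutoff_times_square_integrable[OF cut measurable_A[OF i] grad_L2[OF i]] in auto)
  have he: "integrable (lebesgue_on \<Omega>) (\<lambda>x. h (a x) * e x)" by (rule cutoff_times_integrable(1)[OF cut f(3)])
  have "(LINT x|lebesgue_on \<Omega>. h (a x) * (atan_trunc' m (f x) * e x) + atan_trunc m (f x) * ?P x) = 0" for m
    using integral_by_parts_cutoff[OF i cut weak_partial_trunc[OF i f(1,3)] atan_trunc_bounded has_partial_const[of i 1], of 1]
    by simp
  moreover have "(\<lambda>m. LINT x|lebesgue_on \<Omega>. h (a x) * (atan_trunc' m (f x) * e x) + atan_trunc m (f x) * ?P x)
    \<longlonglongrightarrow> (LINT x|lebesgue_on \<Omega>. h (a x) * e x + f x * ?P x)"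
  proof (rule integral_dominated_convergence[where w = "\<lambda>x. \<bar>h (a x) * e x\<bar> + \<bar>f x * ?P x\<bar>"])
    show "(\<lambda>x. h (a x) * (atan_trunc' m (f x) * e x) + atan_trunc m (f x) * ?P x) \<in> borel_measurable (lebesgue_on \<Omega>)" for m
      using weak_partial_measurable[OF open_dom weak_partial_trunc(1)[OF i f(1,3)], of m] by measurable
    show "AE x in lebesgue_on \<Omega>. (\<lambda>m. h (a x) * (atan_trunc' m (f x) * e x) + atan_trunc m (f x) * ?P x) \<longlonglongrightarrow> h (a x) * e x + f x * ?P x"
    proof (rule AE_I2)
      fix x
      have "(\<lambda>m. h (a x) * (atan_trunc' m (f x) * e x) + atan_trunc m (f x) * ?P x) \<longlonglongrightarrow> h (a x) * (1 * e x) + f x * ?P x"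
        by (intro tendsto_intros atan_trunc_tendsto atan_trunc'_tendsto)
      then show "(\<lambda>m. h (a x) * (atan_trunc' m (f x) * e x) + atan_trunc m (f x) * ?P x) \<longlonglongrightarrow> h (a x) * e x + f x * ?P x" by simp
    qed
    show "AE x in lebesgue_on \<Omega>. norm (h (a x) * (atan_trunc' m (f x) * e x) + atan_trunc m (f x) * ?P x) \<le> \<bar>h (a x) * e x\<bar> + \<bar>f x * ?P x\<bar>" for m
    proof (rule AE_I2)
      fix x
      have "\<bar>h (a x) * (atan_trunc' m (f x) * e x)\<bar> \<le> \<bar>h (a x) * e x\<bar>"
        using mult_right_mono[OF atan_trunc'_bounded[of m "f x"], of "\<bar>h (a x) * e x\<bar>"] by (simp add: abs_mult mult_ac)
      moreover have "\<bar>atan_trunc m (f x) * ?P x\<bar> \<le> \<bar>f x * ?P x\<bar>"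
        unfolding abs_mult[of _ "?P x"] by (intro mult_right_mono atan_trunc_le) simp
      ultimately show "norm (h (a x) * (atan_trunc' m (f x) * e x) + atan_trunc m (f x) * ?P x) \<le> \<bar>h (a x) * e x\<bar> + \<bar>f x * ?P x\<bar>"
        unfolding real_norm_def by linarith
    qed
  qed (use fP he in auto)
  ultimately show ?thesis by (simp add: LIMSEQ_const_iff)
qed

section \<open>Symmetry of the crossed integrals\<close>

text \<open>Extension of h(a) by zero creates no mass on the boundary of \<Omega>: mollifying its
  gradient inside \<Omega> amounts to differentiating the mollified extension. Hence both
  derivatives end on the kernel, where their order does not matter.\<close>

lemma mollify_cutoff_grad:
  assumes i: "i \<in> Basis" and j: "j \<in> Basis" and cut: "cutoff B h h'"
  shows "has_partial i (mollify n (\<lambda>y. indicator \<Omega> y * (h' (a y) * (A y \<bullet> j))))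
    (\<lambda>x. LINT y|lebesgue_on \<Omega>. h (a y) * frechet_derivative (mollifier_deriv n i) (at (x - y)) j)"
proof -
  let ?p = "\<lambda>y. h' (a y) * (A y \<bullet> j)"
  have pi: "integrable (lebesgue_on \<Omega>) ?p" by (rule cutoff_times_integrable(2)[OF cut integrable_A[OF j]])
  then have "integrable lebesgue (\<lambda>y. indicator \<Omega> y * ?p y)"
    by (simp add: integrable_indicator_lebesgue open_lebesgue_sets open_dom)
  from mollify_partial[OF this i]
  have "has_partial i (mollify n (\<lambda>y. indicator \<Omega> y * ?p y)) (\<lambda>x. LINT y|lebesgue. indicator \<Omega> y * ?p y * mollifier_deriv n i (x - y))" .
  moreover have "(LINT y|lebesgue. indicator \<Omega> y * ?p y * mollifier_deriv n i (x - y))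
     = (LINT y|lebesgue_on \<Omega>. h (a y) * frechet_derivative (mollifier_deriv n i) (at (x - y)) j)" for x
  proof -
    let ?q = "\<lambda>y. mollifier_deriv n i (x - y)" and ?q' = "\<lambda>y. - frechet_derivative (mollifier_deriv n i) (at (x - y)) j"
    have q: "has_partial j ?q ?q'"
      by (rule has_partial_reflect, rule has_partial_C_k[OF _ j]) (rule C_k_partialD[OF C_k_mollifier i])
    then have "continuous_on UNIV ?q" "continuous_on UNIV ?q'" by (auto simp: has_partial_def)
    then obtain b where b: "\<And>y. y \<in> \<Omega> \<Longrightarrow> \<bar>?q y\<bar> \<le> b" "\<And>y. y \<in> \<Omega> \<Longrightarrow> \<bar>?q' y\<bar> \<le> b"
      by (rule continuous_bounded_on2[OF _ _ bounded_dom]) (rule that)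
    \<comment> \<open>Integration by parts with \<open>V = 1\<close> and weak derivative 0. The
      reflected kernel derivative takes the place of \<open>q\<close> and may well be nonzero at the
      boundary.\<close>
    have "(LINT y|lebesgue_on \<Omega>. (h (a y) * 0 + 1 * ?p y) * ?q y) = - (LINT y|lebesgue_on \<Omega>. 1 * h (a y) * ?q' y)"
    proof (rule integral_by_parts_cutoff[OF j cut has_partial_imp_weak_partial[OF open_dom has_partial_const j] _ _ q, where b = b and M = 1])
      show "\<bar>?q y\<bar> \<le> b" "\<bar>?q' y\<bar> \<le> b" if "y \<in> \<Omega>" for y
        using b[OF that] .
    qed auto
    then have "(LINT y|lebesgue_on \<Omega>. ?p y * ?q y) = (LINT y|lebesgue_on \<Omega>. h (a y) * frechet_derivative (mollifier_deriv n i) (at (x - y)) j)"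
      by simp
    moreover have "(LINT y|lebesgue. indicator \<Omega> y * ?p y * ?q y) = (LINT y|lebesgue_on \<Omega>. ?p y * ?q y)"
      by (simp add: integral_restrict_space open_lebesgue_sets open_dom mult.assoc)
    ultimately show ?thesis by simp
  qed
  ultimately show ?thesis by simp
qed

text \<open>Integrated form of the fact that a gradient has no curl. The factor \<kappa>(a) gives
  \<open>V\<close> zero boundary values, so one derivative can be moved onto the mollified gradient
  of h(a); what remains is symmetric in i and j.\<close>

lemma integral_cross_bounded:
  assumes i: "i \<in> Basis" and j: "j \<in> Basis" and cut: "cutoff B h h'" and cut2: "cutoff C \<kappa> \<kappa>'"
    and one: "\<And>t. h' t \<noteq> 0 \<Longrightarrow> \<kappa> t = 1 \<and> \<kappa>' t = 0"
    and V: "\<And>x. x \<in> \<Omega> \<Longrightarrow> \<bar>V x\<bar> \<le> M" "weak_partial \<Omega> i V di" "weak_partial \<Omega> j V dj"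
      "integrable (lebesgue_on \<Omega>) (\<lambda>x. (di x)\<^sup>2)" "integrable (lebesgue_on \<Omega>) (\<lambda>x. (dj x)\<^sup>2)"
  shows "(LINT x|lebesgue_on \<Omega>. di x * (h' (a x) * (A x \<bullet> j))) = (LINT x|lebesgue_on \<Omega>. dj x * (h' (a x) * (A x \<bullet> i)))"
proof -
  let ?p = "\<lambda>j y. h' (a y) * (A y \<bullet> j)"
  \<comment> \<open>\<open>q j n\<close> mollifies the j-th derivative of h(a) extended by zero;
    \<open>Z i d\<close> is the i-th derivative of V \<kappa>(a), where \<open>d\<close> is the i-th
    derivative of \<open>V\<close>.\<close>
  define q where "q j n = mollify n (\<lambda>y. indicator \<Omega> y * ?p j y)" for j n
  define Z where "Z i d x = \<kappa> (a x) * d x + V x * (\<kappa>' (a x) * (A x \<bullet> i))" for i d x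
  have lim: "(\<lambda>n. LINT x|lebesgue_on \<Omega>. Z i d x * q j n x) \<longlonglongrightarrow> (LINT x|lebesgue_on \<Omega>. d x * ?p j x)"
    and by_parts: "\<And>n. (LINT x|lebesgue_on \<Omega>. Z i d x * q j n x)
      = - (LINT x|lebesgue_on \<Omega>. V x * \<kappa> (a x) * (LINT y|lebesgue_on \<Omega>. h (a y) * frechet_derivative (mollifier_deriv n i) (at (x - y)) j))"
    if i: "i \<in> Basis" and j: "j \<in> Basis" and d: "weak_partial \<Omega> i V d" "integrable (lebesgue_on \<Omega>) (\<lambda>x. (d x)\<^sup>2)" for i j d
  proof -
    note [measurable] = weak_partial_measurable[OF open_dom d(1)] cutoff_measurable[OF cut2] measurable_A[OF i]
    have Zm: "Z i d \<in> borel_measurable (lebesgue_on \<Omega>)" unfolding Z_def by measurable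
    have Z2: "integrable (lebesgue_on \<Omega>) (\<lambda>x. (Z i d x)\<^sup>2)"
    proof (rule Bochner_Integration.integrable_bound[of _ "\<lambda>x. 2 * C\<^sup>2 * (d x)\<^sup>2 + 2 * M\<^sup>2 * C\<^sup>2 * (A x \<bullet> i)\<^sup>2"])
      show "AE x in lebesgue_on \<Omega>. norm ((Z i d x)\<^sup>2) \<le> norm (2 * C\<^sup>2 * (d x)\<^sup>2 + 2 * M\<^sup>2 * C\<^sup>2 * (A x \<bullet> i)\<^sup>2)"
      proof (rule AE_I2)
        fix x assume "x \<in> space (lebesgue_on \<Omega>)"
        then have "\<bar>V x\<bar> \<le> \<bar>M\<bar>" using V(1)[of x] by simp
        then have v: "(V x)\<^sup>2 \<le> M\<^sup>2" by (simp add: abs_le_square_iff)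
        have "\<bar>\<kappa> (a x)\<bar> \<le> \<bar>C\<bar>" "\<bar>\<kappa>' (a x)\<bar> \<le> \<bar>C\<bar>" using cut2 by (auto simp: cutoff_def intro: order_trans[OF _ abs_ge_self])
        then have c: "(\<kappa> (a x))\<^sup>2 \<le> C\<^sup>2" "(\<kappa>' (a x))\<^sup>2 \<le> C\<^sup>2" by (simp_all add: abs_le_square_iff)
        have "(s + t)\<^sup>2 \<le> 2 * s\<^sup>2 + 2 * t\<^sup>2" for s t :: real
          using zero_le_power2[of "s - t"] by (simp add: power2_sum power2_diff)
        then have "(Z i d x)\<^sup>2 \<le> 2 * ((\<kappa> (a x))\<^sup>2 * (d x)\<^sup>2) + 2 * ((V x)\<^sup>2 * ((\<kappa>' (a x))\<^sup>2 * (A x \<bullet> i)\<^sup>2))"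
          unfolding Z_def by (metis power_mult_distrib)
        also have "\<dots> \<le> 2 * (C\<^sup>2 * (d x)\<^sup>2) + 2 * (M\<^sup>2 * (C\<^sup>2 * (A x \<bullet> i)\<^sup>2))"
          using v c by (intro add_mono mult_left_mono mult_mono) auto
        finally show "norm ((Z i d x)\<^sup>2) \<le> norm (2 * C\<^sup>2 * (d x)\<^sup>2 + 2 * M\<^sup>2 * C\<^sup>2 * (A x \<bullet> i)\<^sup>2)"
          by (simp add: mult.assoc)
      qed
    qed (use d(2) grad_L2[OF i] Zm in auto)
    have os: "\<Omega> \<in> sets lebesgue" using open_dom by (rule open_lebesgue_sets)
    have ZI: "(\<lambda>x. indicator \<Omega> x * Z i d x) \<in> borel_measurable lebesgue"
      using Zm os by (simp add: borel_measurable_restrict_space_iff)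
    have sq: "(indicator \<Omega> x * (r::real))\<^sup>2 = indicator \<Omega> x * r\<^sup>2" for x r
      by (simp add: indicator_def)
    have Z2I: "integrable lebesgue (\<lambda>x. (indicator \<Omega> x * Z i d x)\<^sup>2)"
      unfolding sq using Z2 by (simp add: integrable_indicator_lebesgue os)
    have pI: "integrable lebesgue (\<lambda>x. indicator \<Omega> x * ?p j x)"
      using cutoff_times_integrable(2)[OF cut integrable_A[OF j]] by (simp add: integrable_indicator_lebesgue os)
    have p2I: "integrable lebesgue (\<lambda>x. (indicator \<Omega> x * ?p j x)\<^sup>2)"
      unfolding sq using cutoff_times_square_integrable[OF cut measurable_A[OF j] grad_L2[OF j]] by (simp add: integrable_indicator_lebesgue os)
    have "(\<lambda>n. LINT x|lebesgue. indicator \<Omega> x * Z i d x * q j n x) \<longlonglongrightarrow> (LINT x|lebesgue. indicator \<Omega> x * Z i d x * (indicator \<Omega> x * ?p j x))"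
      unfolding q_def by (rule mollify_pairing[OF pI p2I ZI Z2I])
    moreover have "(LINT x|lebesgue. indicator \<Omega> x * Z i d x * q j n x) = (LINT x|lebesgue_on \<Omega>. Z i d x * q j n x)" for n
      by (simp add: integral_restrict_space os mult.assoc)
    moreover have "(LINT x|lebesgue. indicator \<Omega> x * Z i d x * (indicator \<Omega> x * ?p j x)) = (LINT x|lebesgue_on \<Omega>. d x * ?p j x)"
    proof -
      \<comment> \<open>In the limit the localization disappears: where h' is nonzero, \<kappa> = 1
        and \<kappa>' = 0, so \<open>Z i d\<close> reduces to \<open>d\<close>.\<close>
      have "indicator \<Omega> x * Z i d x * (indicator \<Omega> x * ?p j x) = indicator \<Omega> x *\<^sub>R (d x * ?p j x)" for x
        using one[of "a x"] by (cases "h' (a x) = 0") (auto simp: Z_def indicator_def)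
      then have "(LINT x|lebesgue. indicator \<Omega> x * Z i d x * (indicator \<Omega> x * ?p j x)) = (LINT x|lebesgue. indicator \<Omega> x *\<^sub>R (d x * ?p j x))"
        by presburger
      then show ?thesis using os by (simp add: integral_restrict_space)
    qed
    ultimately show "(\<lambda>n. LINT x|lebesgue_on \<Omega>. Z i d x * q j n x) \<longlonglongrightarrow> (LINT x|lebesgue_on \<Omega>. d x * ?p j x)"
      by simp
    fix n
    let ?S = "\<lambda>x. LINT y|lebesgue_on \<Omega>. h (a y) * frechet_derivative (mollifier_deriv n i) (at (x - y)) j"
    have hp: "has_partial i (q j n) ?S" unfolding q_def by (rule mollify_cutoff_grad[OF i j cut])
    then have "continuous_on UNIV (q j n)" "continuous_on UNIV ?S" by (auto simp: has_partial_def)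
    then obtain b where b: "\<And>y. y \<in> \<Omega> \<Longrightarrow> \<bar>q j n y\<bar> \<le> b" "\<And>y. y \<in> \<Omega> \<Longrightarrow> \<bar>?S y\<bar> \<le> b"
      by (rule continuous_bounded_on2[OF _ _ bounded_dom]) (rule that)
    have di: "integrable (lebesgue_on \<Omega>) d"
      by (rule integrable_square_imp_integrable[OF finite_measure_bounded_open[OF open_dom bounded_dom]]) (use d(2) in auto)
    show "(LINT x|lebesgue_on \<Omega>. Z i d x * q j n x) = - (LINT x|lebesgue_on \<Omega>. V x * \<kappa> (a x) * ?S x)"
      unfolding Z_def
      by (rule integral_by_parts_cutoff[OF i cut2 d(1) di V(1) hp, where b = b])
         (auto intro: b)
  qed
  \<comment> \<open>The one place where second derivatives are exchanged; by then they act on the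
    explicit kernel, never on u or v.\<close>
  have "frechet_derivative (mollifier_deriv n i) (at x) j = frechet_derivative (mollifier_deriv n j) (at x) i" for n x
    using sym_partials_mollifier[of n] i j unfolding sym_partials_def by blast
  then have "(LINT x|lebesgue_on \<Omega>. Z i di x * q j n x) = (LINT x|lebesgue_on \<Omega>. Z j dj x * q i n x)" for n
    unfolding by_parts[OF i j V(2,4)] by_parts[OF j i V(3,5)] by presburger
  then show ?thesis
    using LIMSEQ_unique[OF lim[OF i j V(2,4)]] lim[OF j i V(3,5)] by simp
qed

text \<open>The bounded case holds for the arctangent truncations of \<open>V\<close>, whose
  gradients stay square integrable. Products of square integrable functions dominate the passage to
  the limit.\<close>

lemma integral_cross:
  assumes i: "i \<in> Basis" and j: "j \<in> Basis" and cut: "cutoff B h h'" and cut2: "cutoff C \<kappa> \<kappa>'"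
    and one: "\<And>t. h' t \<noteq> 0 \<Longrightarrow> \<kappa> t = 1 \<and> \<kappa>' t = 0"
    and V: "weak_partial \<Omega> i V di" "weak_partial \<Omega> j V dj"
      "integrable (lebesgue_on \<Omega>) (\<lambda>x. (di x)\<^sup>2)" "integrable (lebesgue_on \<Omega>) (\<lambda>x. (dj x)\<^sup>2)"
  shows "(LINT x|lebesgue_on \<Omega>. di x * (h' (a x) * (A x \<bullet> j))) = (LINT x|lebesgue_on \<Omega>. dj x * (h' (a x) * (A x \<bullet> i)))"
proof -
  let ?p = "\<lambda>j y. h' (a y) * (A y \<bullet> j)"
  have int: "integrable (lebesgue_on \<Omega>) d" and sq: "\<And>m. integrable (lebesgue_on \<Omega>) (\<lambda>x. (atan_trunc' m (V x) * d x)\<^sup>2)"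
    and lim: "(\<lambda>m. LINT x|lebesgue_on \<Omega>. atan_trunc' m (V x) * d x * ?p j x) \<longlonglongrightarrow> (LINT x|lebesgue_on \<Omega>. d x * ?p j x)"
    if i: "i \<in> Basis" and j: "j \<in> Basis" and d: "weak_partial \<Omega> i V d" "integrable (lebesgue_on \<Omega>) (\<lambda>x. (d x)\<^sup>2)" for i j d
  proof -
    note dm[measurable] = weak_partial_measurable[OF open_dom d(1)] and [measurable] = cutoff_measurable[OF cut] measurable_A[OF j]
    show di: "integrable (lebesgue_on \<Omega>) d"
      by (rule integrable_square_imp_integrable[OF finite_measure_bounded_open[OF open_dom bounded_dom]]) (use d(2) in auto)
    note tm[measurable] = weak_partial_measurable(2)[OF open_dom weak_partial_trunc(1)[OF i d(1) di]]
    have le: "\<bar>atan_trunc' m (V x) * d x\<bar> \<le> \<bar>d x\<bar>" for m x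
      unfolding abs_mult using atan_trunc'_bounded by (intro mult_left_le_one_le) auto
    show "integrable (lebesgue_on \<Omega>) (\<lambda>x. (atan_trunc' m (V x) * d x)\<^sup>2)" for m
      by (rule Bochner_Integration.integrable_bound[OF d(2)]) (use le in \<open>auto simp: abs_le_square_iff[symmetric] intro: borel_measurable_power[OF tm]\<close>)
    show "(\<lambda>m. LINT x|lebesgue_on \<Omega>. atan_trunc' m (V x) * d x * ?p j x) \<longlonglongrightarrow> (LINT x|lebesgue_on \<Omega>. d x * ?p j x)"
    proof (rule integral_dominated_convergence[where w = "\<lambda>x. \<bar>d x * ?p j x\<bar>"])
      show "(\<lambda>x. atan_trunc' m (V x) * d x * ?p j x) \<in> borel_measurable (lebesgue_on \<Omega>)" for m by measurable
      have "integrable (lebesgue_on \<Omega>) (\<lambda>x. d x * ?p j x)"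
        by (rule integrable_mult_squares) (use d cutoff_times_square_integrable[OF cut measurable_A[OF j] grad_L2[OF j]] in auto)
      then show "integrable (lebesgue_on \<Omega>) (\<lambda>x. \<bar>d x * ?p j x\<bar>)" by simp
      show "AE x in lebesgue_on \<Omega>. (\<lambda>m. atan_trunc' m (V x) * d x * ?p j x) \<longlonglongrightarrow> d x * ?p j x"
      proof (rule AE_I2)
        fix x
        have "(\<lambda>m. atan_trunc' m (V x) * d x * ?p j x) \<longlonglongrightarrow> 1 * d x * ?p j x"
          by (intro tendsto_intros atan_trunc'_tendsto)
        then show "(\<lambda>m. atan_trunc' m (V x) * d x * ?p j x) \<longlonglongrightarrow> d x * ?p j x" by simp
      qed
      show "AE x in lebesgue_on \<Omega>. norm (atan_trunc' m (V x) * d x * ?p j x) \<le> \<bar>d x * ?p j x\<bar>" for m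
      proof (rule AE_I2)
        fix x
        show "norm (atan_trunc' m (V x) * d x * ?p j x) \<le> \<bar>d x * ?p j x\<bar>"
          unfolding real_norm_def abs_mult[of _ "?p j x"] by (intro mult_right_mono le) simp
      qed
    qed measurable
  qed
  have "(LINT x|lebesgue_on \<Omega>. atan_trunc' m (V x) * di x * ?p j x) = (LINT x|lebesgue_on \<Omega>. atan_trunc' m (V x) * dj x * ?p i x)" for m
    by (rule integral_cross_bounded[OF i j cut cut2 one atan_trunc_bounded weak_partial_trunc(1)[OF i V(1) int[OF i j V(1,3)]]
        weak_partial_trunc(1)[OF j V(2) int[OF j i V(2,4)]] sq[OF i j V(1,3)] sq[OF j i V(2,4)]])
  then show ?thesis
    using LIMSEQ_unique[OF lim[OF i j V(1,3)]] lim[OF j i V(2,4)] by simp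
qed

end

section \<open>The comparison principle\<close>

text \<open>A second difference of the squared positive part with step 1/2. The factor 2 in front
  makes the derivative a tent over the unit interval with height 2 and area 1, so the function
  climbs from 0 to 1.\<close>

definition smooth_step :: "real \<Rightarrow> real" where
  "smooth_step t = 2 * (pos_square t - 2 * pos_square (t - 1/2) + pos_square (t - 1))"

definition smooth_step' :: "real \<Rightarrow> real" where
  "smooth_step' t = 4 * (max t 0 - 2 * max (t - 1/2) 0 + max (t - 1) 0)"

lemma smooth_step_deriv: "(smooth_step has_real_derivative smooth_step' t) (at t)"
proof -
  have "((\<lambda>t. pos_square (t - c)) has_real_derivative 2 * max (t - c) 0) (at t)" for c
  proof -
    have "((\<lambda>t. t - c) has_real_derivative 1) (at t)" by (auto intro!: derivative_eq_intros)
    from DERIV_chain2[OF pos_square_deriv this] show ?thesis by simp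
  qed
  then have "((\<lambda>t. 2 * (pos_square t - 2 * pos_square (t - 1/2) + pos_square (t - 1))) has_real_derivative
      2 * (2 * max t 0 - 2 * (2 * max (t - 1/2) 0) + 2 * max (t - 1) 0)) (at t)"
    by (intro DERIV_cmult DERIV_add DERIV_diff pos_square_deriv)
  then show ?thesis
    unfolding smooth_step_def[abs_def] smooth_step'_def by (simp add: algebra_simps)
qed

lemma smooth_step_values:
  shows "t \<le> 0 \<Longrightarrow> smooth_step t = 0" "t \<le> 0 \<Longrightarrow> smooth_step' t = 0"
    "1 \<le> t \<Longrightarrow> smooth_step t = 1" "1 \<le> t \<Longrightarrow> smooth_step' t = 0"
    "0 < t \<Longrightarrow> 0 < smooth_step t" "0 \<le> smooth_step t" "\<bar>smooth_step t\<bar> \<le> 1" "\<bar>smooth_step' t\<bar> \<le> 2"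
proof -
  consider "t \<le> 0" | "0 < t" "t \<le> 1/2" | "1/2 < t" "t < 1" | "1 \<le> t" by linarith
  then have *: "(t \<le> 0 \<longrightarrow> smooth_step t = 0 \<and> smooth_step' t = 0) \<and> (1 \<le> t \<longrightarrow> smooth_step t = 1 \<and> smooth_step' t = 0) \<and>
    (0 < t \<longrightarrow> 0 < smooth_step t) \<and> 0 \<le> smooth_step t \<and> \<bar>smooth_step t\<bar> \<le> 1 \<and> \<bar>smooth_step' t\<bar> \<le> 2"
  proof cases
    case 1
    then have "max t 0 = 0" "max (t - 1/2) 0 = 0" "max (t - 1) 0 = 0" by auto
    then show ?thesis using 1 by (simp add: smooth_step_def smooth_step'_def pos_square_def)
  next
    case 2
    then have m: "max t 0 = t" "max (t - 1/2) 0 = 0" "max (t - 1) 0 = 0" by auto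
    have "t\<^sup>2 \<le> (1/2)\<^sup>2" using 2 by (intro power_mono) auto
    then show ?thesis using 2 m by (simp add: smooth_step_def smooth_step'_def pos_square_def power2_eq_square)
  next
    case 3
    then have m: "max t 0 = t" "max (t - 1/2) 0 = t - 1/2" "max (t - 1) 0 = 0" by auto
    have "(1 - t)\<^sup>2 \<le> (1/2)\<^sup>2" using 3 by (intro power_mono) auto
    moreover have "smooth_step t = 1 - 2 * (1 - t)\<^sup>2"
      using m by (simp add: smooth_step_def pos_square_def power2_eq_square algebra_simps)
    moreover have "0 \<le> (1 - t)\<^sup>2" by simp
    ultimately have "1/2 \<le> smooth_step t" "smooth_step t \<le> 1" by (simp_all add: power2_eq_square)
    moreover have "smooth_step' t = 4 * (1 - t)" using m by (simp add: smooth_step'_def)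
    ultimately show ?thesis using 3 by auto
  next
    case 4
    then have m: "max t 0 = t" "max (t - 1/2) 0 = t - 1/2" "max (t - 1) 0 = t - 1" by auto
    then have "smooth_step t = 1" "smooth_step' t = 0"
      by (simp_all add: smooth_step_def smooth_step'_def pos_square_def power2_eq_square algebra_simps)
    then show ?thesis using 4 by simp
  qed
  show "t \<le> 0 \<Longrightarrow> smooth_step t = 0" "t \<le> 0 \<Longrightarrow> smooth_step' t = 0"
    "1 \<le> t \<Longrightarrow> smooth_step t = 1" "1 \<le> t \<Longrightarrow> smooth_step' t = 0"
    "0 < t \<Longrightarrow> 0 < smooth_step t" "0 \<le> smooth_step t" "\<bar>smooth_step t\<bar> \<le> 1" "\<bar>smooth_step' t\<bar> \<le> 2"
    using * by blast+
qed

text \<open>The step climbs between \<open>c * \<delta>\<close> and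
  \<open>(c + 1) * \<delta>\<close>; c = 0 and c = 1 give two consecutive ones. The bound
  \<open>2 / \<delta>\<close> is the tent height 2 after rescaling.\<close>

lemma cutoff_smooth_step:
  assumes "\<delta> > 0" "c \<ge> 0"
  shows "cutoff (max 1 (2 / \<delta>)) (\<lambda>t. smooth_step (t / \<delta> - c)) (\<lambda>t. smooth_step' (t / \<delta> - c) / \<delta>)"
  unfolding cutoff_def
proof (intro conjI allI impI)
  fix t :: real
  have "((\<lambda>t. t / \<delta> - c) has_real_derivative 1 / \<delta>) (at t)"
    using assms(1) by (auto intro!: derivative_eq_intros)
  from DERIV_chain2[OF smooth_step_deriv this]
  show "((\<lambda>t. smooth_step (t / \<delta> - c)) has_real_derivative smooth_step' (t / \<delta> - c) / \<delta>) (at t)" by simp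
  show "continuous_on UNIV (\<lambda>t. smooth_step' (t / \<delta> - c) / \<delta>)"
    unfolding smooth_step'_def using assms(1) by (intro continuous_intros) auto
  show "\<bar>smooth_step (t / \<delta> - c)\<bar> \<le> max 1 (2 / \<delta>)"
    using smooth_step_values(7)[of "t / \<delta> - c"] by linarith
  have "\<bar>smooth_step' (t / \<delta> - c) / \<delta>\<bar> \<le> 2 / \<delta>"
    using smooth_step_values(8)[of "t / \<delta> - c"] assms(1) by (simp add: abs_divide divide_right_mono)
  then show "\<bar>smooth_step' (t / \<delta> - c) / \<delta>\<bar> \<le> max 1 (2 / \<delta>)" by linarith
next
  fix t :: real assume "t \<le> 0"
  then have "t / \<delta> - c \<le> 0" using assms divide_nonpos_pos[of t \<delta>] by linarith
  then show "smooth_step (t / \<delta> - c) = 0" "smooth_step' (t / \<delta> - c) / \<delta> = 0"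
    using smooth_step_values by auto
qed

text \<open>The two sides of the weak inequality, tested with \<open>(u - v)\<^sup>+\<close> and compared pointwise; equality forces
  both vectors to point in the same direction.\<close>

lemma normalized_monotone:
  fixes \<alpha> \<beta> :: "'a::real_inner"
  defines "G \<equiv> if \<alpha> = 0 then - norm (\<alpha> - \<beta>) else (\<alpha> /\<^sub>R norm \<alpha>) \<bullet> (\<alpha> - \<beta>)"
    and "H \<equiv> if \<beta> = 0 then norm (\<alpha> - \<beta>) else (\<beta> /\<^sub>R norm \<beta>) \<bullet> (\<alpha> - \<beta>)"
  shows "H \<le> G" and "G = H \<Longrightarrow> norm \<alpha> *\<^sub>R \<beta> = norm \<beta> *\<^sub>R \<alpha>"
proof -
  have "H \<le> G \<and> (G = H \<longrightarrow> norm \<alpha> *\<^sub>R \<beta> = norm \<beta> *\<^sub>R \<alpha>)"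
  proof (cases "\<alpha> = 0 \<or> \<beta> = 0")
    \<comment> \<open>At singular points \<open>G\<close> and \<open>H\<close> coincide: both equal
      \<open>- norm \<beta>\<close> if \<alpha> = 0 and \<open>norm \<alpha>\<close> if \<beta> = 0.
      The claimed parallelism then reads 0 = 0.\<close>
    case True
    then show ?thesis
      by (auto simp: G_def H_def inner_diff_right divide_inverse dot_square_norm power2_eq_square)
  next
    case False
    then have n: "norm \<alpha> > 0" "norm \<beta> > 0" by auto
    \<comment> \<open>The factorization separates the Cauchy-Schwarz defect from a positive factor,
      so \<open>G = H\<close> is exactly the equality case of Cauchy-Schwarz.\<close>
    have "G - H = (norm \<alpha> * norm \<beta> - \<alpha> \<bullet> \<beta>) * (inverse (norm \<alpha>) + inverse (norm \<beta>))"
      using False n by (simp add: G_def H_def inner_diff_right dot_square_norm inner_commute[of \<beta> \<alpha>] power2_eq_square field_simps)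
    moreover have "\<alpha> \<bullet> \<beta> \<le> norm \<alpha> * norm \<beta>" by (rule norm_cauchy_schwarz)
    moreover have p: "inverse (norm \<alpha>) + inverse (norm \<beta>) > 0" using n by (intro add_pos_pos) auto
    ultimately have "G - H \<ge> 0" "G = H \<Longrightarrow> \<alpha> \<bullet> \<beta> = norm \<alpha> * norm \<beta>" by auto
    then show ?thesis using norm_cauchy_schwarz_eq[of \<alpha> \<beta>] by auto
  qed
  then show "H \<le> G" "G = H \<Longrightarrow> norm \<alpha> *\<^sub>R \<beta> = norm \<beta> *\<^sub>R \<alpha>" by auto
qed

section \<open>Algebra of the star operation\<close>

lemma UNIV_pair_2_sum:
  fixes f :: "'n::finite \<times> 2 \<Rightarrow> real"
  shows "(\<Sum>k\<in>UNIV. f k) = (\<Sum>j\<in>UNIV. f (j, 1) + f (j, 2))"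
proof -
  have "(\<Sum>k\<in>UNIV. f k) = (\<Sum>j\<in>UNIV. \<Sum>b\<in>UNIV. f (j, b))"
    by (simp add: sum.cartesian_product UNIV_Times_UNIV[symmetric] del: UNIV_Times_UNIV)
  then show ?thesis by (simp add: sum_2)
qed

lemma star_field_inner:
  "star_field G x \<bullet> y = (\<Sum>j\<in>UNIV. G x $ (j, 2) * y $ (j, 1) - G x $ (j, 1) * y $ (j, 2))"
  by (simp add: inner_vec_def UNIV_pair_2_sum star_field_def)

lemma star_field_self: "star_field G x \<bullet> G x = 0"
  by (simp add: star_field_inner mult.commute)

text \<open>If \<open>G x\<close> is nonzero, the assumption makes \<alpha> a multiple of it, and
  the starred vector is orthogonal to \<open>G x\<close>; if \<open>G x = 0\<close>, the starred
  vector is 0.\<close>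

lemma star_field_parallel:
  fixes \<alpha> :: "real ^ ('n::finite \<times> 2)"
  assumes "norm \<alpha> *\<^sub>R G x = norm (G x) *\<^sub>R \<alpha>"
  shows "star_field G x \<bullet> (\<alpha> - G x) = 0"
proof (cases "G x = 0")
  case True
  then show ?thesis by (simp add: star_field_inner)
next
  case False
  have "norm (G x) * (star_field G x \<bullet> \<alpha>) = star_field G x \<bullet> (norm (G x) *\<^sub>R \<alpha>)" by simp
  also have "\<dots> = star_field G x \<bullet> (norm \<alpha> *\<^sub>R G x)" using assms by simp
  also have "\<dots> = 0" by (simp add: star_field_self)
  finally show ?thesis using False by (simp add: inner_diff_right star_field_self)
qed

lemma star_field_add: "star_field (\<lambda>x. G x + H x) x = star_field G x + star_field H x"
  by (simp add: star_field_def vec_eq_iff)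

lemma Basis_vec_real: "(i::real ^ 'n) \<in> Basis \<longleftrightarrow> (\<exists>k. i = axis k 1)"
  by (auto simp: Basis_vec_def)

section \<open>Testing the weak inequality\<close>

lemma integral_split_sets:
  fixes f g :: "'a::euclidean_space \<Rightarrow> real"
  assumes S: "S \<in> sets lebesgue" "\<Omega> \<in> sets lebesgue" "S \<subseteq> \<Omega>"
    and fg: "integrable (lebesgue_on \<Omega>) f" "integrable (lebesgue_on \<Omega>) g"
  shows "(LINT x|lebesgue_on S. f x) + (LINT x|lebesgue_on (\<Omega> - S). g x)
      = (LINT x|lebesgue_on \<Omega>. (if x \<in> S then f x else g x))"
    and "integrable (lebesgue_on \<Omega>) (\<lambda>x. if x \<in> S then f x else g x)"
proof -
  have D: "\<Omega> - S \<in> sets lebesgue" using S by auto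
  have i: "integrable lebesgue (\<lambda>x. indicator \<Omega> x *\<^sub>R f x)" "integrable lebesgue (\<lambda>x. indicator \<Omega> x *\<^sub>R g x)"
    using fg S by (simp_all add: integrable_restrict_space)
  have e1: "indicator S x *\<^sub>R indicator \<Omega> x *\<^sub>R f x = indicator S x *\<^sub>R f x" for x
    using S(3) by (auto simp: indicator_def)
  have e2: "indicator (\<Omega> - S) x *\<^sub>R indicator \<Omega> x *\<^sub>R g x = indicator (\<Omega> - S) x *\<^sub>R g x" for x
    by (auto simp: indicator_def)
  have i1: "integrable lebesgue (\<lambda>x. indicator S x *\<^sub>R f x)"
    using integrable_mult_indicator[OF S(1) i(1)] unfolding e1 .
  have i2: "integrable lebesgue (\<lambda>x. indicator (\<Omega> - S) x *\<^sub>R g x)"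
    using integrable_mult_indicator[OF D i(2)] unfolding e2 .
  have e: "indicator S x *\<^sub>R f x + indicator (\<Omega> - S) x *\<^sub>R g x = indicator \<Omega> x *\<^sub>R (if x \<in> S then f x else g x)" for x
    using S(3) by (auto simp: indicator_def)
  have "(LINT x|lebesgue_on S. f x) + (LINT x|lebesgue_on (\<Omega> - S). g x)
    = (LINT x|lebesgue. indicator S x *\<^sub>R f x) + (LINT x|lebesgue. indicator (\<Omega> - S) x *\<^sub>R g x)"
    using S(1) D integral_restrict_space[of S lebesgue f] integral_restrict_space[of "\<Omega> - S" lebesgue g] by simp
  also have "\<dots> = (LINT x|lebesgue. indicator \<Omega> x *\<^sub>R (if x \<in> S then f x else g x))"
    unfolding e[symmetric] using i1 i2 by (rule Bochner_Integration.integral_add[symmetric])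
  also have "\<dots> = (LINT x|lebesgue_on \<Omega>. (if x \<in> S then f x else g x))"
    using S(2) integral_restrict_space[of \<Omega> lebesgue "\<lambda>x. if x \<in> S then f x else g x"] by simp
  finally show "(LINT x|lebesgue_on S. f x) + (LINT x|lebesgue_on (\<Omega> - S). g x)
      = (LINT x|lebesgue_on \<Omega>. (if x \<in> S then f x else g x))" .
  have "integrable lebesgue (\<lambda>x. indicator \<Omega> x *\<^sub>R (if x \<in> S then f x else g x))"
    unfolding e[symmetric] using i1 i2 by (rule Bochner_Integration.integrable_add)
  then show "integrable (lebesgue_on \<Omega>) (\<lambda>x. if x \<in> S then f x else g x)"
    using S(2) integrable_restrict_space[of \<Omega> lebesgue "\<lambda>x. if x \<in> S then f x else g x"] by simp
qed

lemma weak_grad_pos_part: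
  fixes u v :: "'a::euclidean_space \<Rightarrow> real"
  assumes \<Omega>: "open \<Omega>" and "u \<in> sobolev p \<Omega>" "v \<in> sobolev p \<Omega>" and w: "(\<lambda>x. max (u x - v x) 0) \<in> sobolev q \<Omega>"
  shows "AE x in lebesgue_on \<Omega>. weak_grad \<Omega> (\<lambda>x. max (u x - v x) 0) x
      = (if u x > v x then weak_grad \<Omega> u x - weak_grad \<Omega> v x else 0)"
proof -
  have "has_weak_grad \<Omega> (\<lambda>x. max (u x - v x) 0) (\<lambda>x. if u x > v x then weak_grad \<Omega> u x - weak_grad \<Omega> v x else 0)"
    unfolding has_weak_grad_iff_weak_partial
  proof
    fix i :: 'a assume i: "i \<in> Basis"
    have "weak_partial \<Omega> i (\<lambda>x. u x - v x) (\<lambda>x. weak_grad \<Omega> u x \<bullet> i - weak_grad \<Omega> v x \<bullet> i)"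
      using has_weak_grad_weak_grad[OF assms(2)] has_weak_grad_weak_grad[OF assms(3)] i
      by (intro weak_partial_diff[OF \<Omega>]) (auto simp: has_weak_grad_iff_weak_partial)
    from weak_partial_pos_part[OF \<Omega> this i]
    have "weak_partial \<Omega> i (\<lambda>x. max (u x - v x) 0) (\<lambda>x. if u x - v x > 0 then weak_grad \<Omega> u x \<bullet> i - weak_grad \<Omega> v x \<bullet> i else 0)" .
    moreover have "(\<lambda>x. if u x - v x > 0 then weak_grad \<Omega> u x \<bullet> i - weak_grad \<Omega> v x \<bullet> i else 0)
      = (\<lambda>x. (if u x > v x then weak_grad \<Omega> u x - weak_grad \<Omega> v x else 0) \<bullet> i)"
      by (auto simp: fun_eq_iff inner_diff_left)
    ultimately show "weak_partial \<Omega> i (\<lambda>x. max (u x - v x) 0) (\<lambda>x. (if u x > v x then weak_grad \<Omega> u x - weak_grad \<Omega> v x else 0) \<bullet> i)"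
      by simp
  qed
  from has_weak_grad_unique[OF \<Omega> has_weak_grad_weak_grad[OF w] this] show ?thesis .
qed

text \<open>The tested inequality says that the integral of \<open>G\<close> is at most that of
  \<open>H\<close>, whereas \<open>H \<le> G\<close> pointwise. Hence \<open>G = H\<close> almost
  everywhere, and the equality case of \<open>normalized_monotone\<close> applies.\<close>

lemma normals_agree:
  fixes \<Omega> :: "'a::euclidean_space set"
  assumes \<Omega>: "open \<Omega>" and u: "u \<in> sobolev p \<Omega>" and v: "v \<in> sobolev p \<Omega>"
    and F: "F \<in> borel_measurable (lebesgue_on \<Omega>)"
    and ge: "div_N_ge \<Omega> F u v" and bd: "le_on_boundary \<Omega> u v"
  defines "\<alpha> \<equiv> \<lambda>x. weak_grad \<Omega> u x + F x" and "\<beta> \<equiv> \<lambda>x. weak_grad \<Omega> v x + F x"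
  shows "AE x in lebesgue_on \<Omega>. u x > v x \<longrightarrow> norm (\<alpha> x) *\<^sub>R \<beta> x = norm (\<beta> x) *\<^sub>R \<alpha> x"
proof -
  define w where "w x = max (u x - v x) 0" for x
  let ?W = "weak_grad \<Omega> w"
  have w0: "w \<in> sobolev0 1 \<Omega>" using bd unfolding le_on_boundary_def w_def[abs_def] .
  then have w1: "w \<in> sobolev 1 \<Omega>" by (simp add: sobolev0_def)
  have WE: "AE x in lebesgue_on \<Omega>. ?W x = (if u x > v x then \<alpha> x - \<beta> x else 0)"
    using weak_grad_pos_part[OF \<Omega> u v w1[unfolded w_def[abs_def]]] unfolding w_def[abs_def, symmetric]
    by eventually_elim (simp add: \<alpha>_def \<beta>_def)
  have "in_Lp 1 \<Omega> ?W" by (rule sobolev_in_Lp[OF \<Omega> w1])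
  then have Wi: "integrable (lebesgue_on \<Omega>) ?W" by (rule in_Lp_1_integrable)
  have nWi: "integrable (lebesgue_on \<Omega>) (\<lambda>x. norm (?W x))" "integrable (lebesgue_on \<Omega>) (\<lambda>x. - norm (?W x))"
    using Wi by auto
  have m[measurable]: "\<alpha> \<in> borel_measurable (lebesgue_on \<Omega>)" "\<beta> \<in> borel_measurable (lebesgue_on \<Omega>)"
    unfolding \<alpha>_def \<beta>_def using has_weak_grad_measurable[OF \<Omega> has_weak_grad_weak_grad[OF u]]
      has_weak_grad_measurable[OF \<Omega> has_weak_grad_weak_grad[OF v]] F by auto
  have os: "\<Omega> \<in> sets lebesgue" using \<Omega> by (rule open_lebesgue_sets)
  have S: "{x \<in> \<Omega>. \<gamma> x = 0} \<in> sets lebesgue" if g: "\<gamma> \<in> borel_measurable (lebesgue_on \<Omega>)" for \<gamma> :: "'a \<Rightarrow> 'a"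
  proof -
    have "{x \<in> space (lebesgue_on \<Omega>). \<gamma> x = 0} \<in> sets (lebesgue_on \<Omega>)" using g by measurable
    then show ?thesis using os by (simp add: sets_restrict_space_iff)
  qed
  have N: "integrable (lebesgue_on \<Omega>) (\<lambda>x. (\<gamma> x /\<^sub>R norm (\<gamma> x)) \<bullet> ?W x)"
    if g[measurable]: "\<gamma> \<in> borel_measurable (lebesgue_on \<Omega>)" for \<gamma> :: "'a \<Rightarrow> 'a"
  proof (rule Bochner_Integration.integrable_bound[OF nWi(1)])
    have [measurable]: "?W \<in> borel_measurable (lebesgue_on \<Omega>)" using Wi by auto
    show "(\<lambda>x. (\<gamma> x /\<^sub>R norm (\<gamma> x)) \<bullet> ?W x) \<in> borel_measurable (lebesgue_on \<Omega>)" by measurable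
    have "\<bar>(c /\<^sub>R norm c) \<bullet> d\<bar> \<le> norm d" for c d :: 'a
      using Cauchy_Schwarz_ineq2[of "c /\<^sub>R norm c" d] by (cases "c = 0") auto
    then show "AE x in lebesgue_on \<Omega>. norm ((\<gamma> x /\<^sub>R norm (\<gamma> x)) \<bullet> ?W x) \<le> norm (norm (?W x))" by simp
  qed
  define G where "G x = (if x \<in> {x \<in> \<Omega>. \<alpha> x = 0} then - norm (?W x) else (\<alpha> x /\<^sub>R norm (\<alpha> x)) \<bullet> ?W x)" for x
  define H where "H x = (if x \<in> {x \<in> \<Omega>. \<beta> x = 0} then norm (?W x) else (\<beta> x /\<^sub>R norm (\<beta> x)) \<bullet> ?W x)" for x
  have sG: "(LINT x|lebesgue_on {x \<in> \<Omega>. \<alpha> x = 0}. - norm (?W x)) + (LINT x|lebesgue_on (\<Omega> - {x \<in> \<Omega>. \<alpha> x = 0}). (\<alpha> x /\<^sub>R norm (\<alpha> x)) \<bullet> ?W x)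
      = (LINT x|lebesgue_on \<Omega>. G x)" and iG: "integrable (lebesgue_on \<Omega>) G"
    unfolding G_def using integral_split_sets[OF S[OF m(1)] os _ nWi(2) N[OF m(1)]] by auto
  have sH: "(LINT x|lebesgue_on {x \<in> \<Omega>. \<beta> x = 0}. norm (?W x)) + (LINT x|lebesgue_on (\<Omega> - {x \<in> \<Omega>. \<beta> x = 0}). (\<beta> x /\<^sub>R norm (\<beta> x)) \<bullet> ?W x)
      = (LINT x|lebesgue_on \<Omega>. H x)" and iH: "integrable (lebesgue_on \<Omega>) H"
    unfolding H_def using integral_split_sets[OF S[OF m(2)] os _ nWi(1) N[OF m(2)]] by auto
  have "AE x in lebesgue_on \<Omega>. w x \<ge> 0" by (simp add: w_def)
  with ge w0 have "(LINT x|lebesgue_on \<Omega>. G x) \<le> (LINT x|lebesgue_on \<Omega>. H x)"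
    unfolding div_N_ge_def sing_set_def N_field_def sG[symmetric] sH[symmetric] \<alpha>_def \<beta>_def by auto
  then have le: "(LINT x|lebesgue_on \<Omega>. G x - H x) \<le> 0" using iG iH by simp
  \<comment> \<open>Off the set where u > v the gradient of the test function is 0, so both
    integrands vanish there and carry no information.\<close>
  have pt: "AE x in lebesgue_on \<Omega>. 0 \<le> G x - H x \<and> (G x - H x = 0 \<longrightarrow> u x > v x \<longrightarrow> norm (\<alpha> x) *\<^sub>R \<beta> x = norm (\<beta> x) *\<^sub>R \<alpha> x)"
    using WE AE_space
  proof eventually_elim
    case (elim x)
    show ?case
    proof (cases "u x > v x")
      case True
      then show ?thesis
        using normalized_monotone[where \<alpha> = "\<alpha> x" and \<beta> = "\<beta> x"] elim by (auto simp: G_def H_def)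
    next
      case False
      then show ?thesis using elim by (auto simp: G_def H_def)
    qed
  qed
  have "(LINT x|lebesgue_on \<Omega>. G x - H x) = 0"
    using le pt by (intro antisym integral_nonneg_AE) (auto elim: AE_mp)
  then have "AE x in lebesgue_on \<Omega>. G x - H x = 0"
    using integral_nonneg_eq_0_iff_AE[of "lebesgue_on \<Omega>" "\<lambda>x. G x - H x"] iG iH pt by (auto elim: AE_mp)
  with pt show ?thesis by eventually_elim blast
qed

lemma vanishing_pos_part_intro:
  fixes \<Omega> :: "'a::euclidean_space set"
  assumes \<Omega>: "open \<Omega>" "bounded \<Omega>" and u: "u \<in> sobolev 2 \<Omega>" and v: "v \<in> sobolev 2 \<Omega>" and bd: "le_on_boundary \<Omega> u v"
  obtains \<phi> where "vanishing_pos_part \<Omega> (\<lambda>x. u x - v x) (\<lambda>x. weak_grad \<Omega> u x - weak_grad \<Omega> v x) \<phi>"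
proof -
  have w0: "(\<lambda>x. max (u x - v x) 0) \<in> sobolev0 1 \<Omega>" using bd unfolding le_on_boundary_def .
  then have w1: "(\<lambda>x. max (u x - v x) 0) \<in> sobolev 1 \<Omega>" by (simp add: sobolev0_def)
  note WE = weak_grad_pos_part[OF \<Omega>(1) u v w1]
  show thesis
  proof (rule sobolev0_approx[OF \<Omega>(1) w0])
    fix \<phi> assume \<phi>: "\<And>n. \<phi> n \<in> test_fun \<Omega>" "AE x in lebesgue_on \<Omega>. (\<lambda>n. \<phi> n x) \<longlonglongrightarrow> max (u x - v x) 0"
      and l: "\<And>i. i \<in> Basis \<Longrightarrow> (\<lambda>n. LINT x|lebesgue_on \<Omega>. \<bar>frechet_derivative (\<phi> n) (at x) i - weak_grad \<Omega> (\<lambda>x. max (u x - v x) 0) x \<bullet> i\<bar>) \<longlonglongrightarrow> 0"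
    show thesis
    proof (rule that, unfold_locales)
      show "open \<Omega>" "bounded \<Omega>" by (rule \<Omega>)+
      show "\<phi> n \<in> test_fun \<Omega>" for n by (rule \<phi>)
      show "AE x in lebesgue_on \<Omega>. (\<lambda>n. \<phi> n x) \<longlonglongrightarrow> max (u x - v x) 0" by (rule \<phi>)
      fix i :: 'a assume i: "i \<in> Basis"
      note U = sobolev_2_facts[OF \<Omega>(1) u i] and V = sobolev_2_facts[OF \<Omega>(1) v i]
      show "weak_partial \<Omega> i (\<lambda>x. u x - v x) (\<lambda>x. (weak_grad \<Omega> u x - weak_grad \<Omega> v x) \<bullet> i)"
        unfolding inner_diff_left by (rule weak_partial_diff[OF \<Omega>(1) U(1) V(1) i])
      have "integrable (lebesgue_on \<Omega>) (\<lambda>x. (weak_grad \<Omega> u x \<bullet> i) * (weak_grad \<Omega> v x \<bullet> i))"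
        by (rule integrable_mult_squares) (use U V in auto)
      then have "integrable (lebesgue_on \<Omega>) (\<lambda>x. (weak_grad \<Omega> u x \<bullet> i)\<^sup>2 + (weak_grad \<Omega> v x \<bullet> i)\<^sup>2 - 2 * ((weak_grad \<Omega> u x \<bullet> i) * (weak_grad \<Omega> v x \<bullet> i)))"
        using U V by (intro Bochner_Integration.integrable_diff Bochner_Integration.integrable_add integrable_mult_right) auto
      then show "integrable (lebesgue_on \<Omega>) (\<lambda>x. ((weak_grad \<Omega> u x - weak_grad \<Omega> v x) \<bullet> i)\<^sup>2)"
        by (simp add: inner_diff_left power2_diff mult.assoc)
      have "(LINT x|lebesgue_on \<Omega>. \<bar>frechet_derivative (\<phi> n) (at x) i - weak_grad \<Omega> (\<lambda>x. max (u x - v x) 0) x \<bullet> i\<bar>)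
        = (LINT x|lebesgue_on \<Omega>. \<bar>frechet_derivative (\<phi> n) (at x) i - (if u x - v x > 0 then (weak_grad \<Omega> u x - weak_grad \<Omega> v x) \<bullet> i else 0)\<bar>)" for n
      proof (rule integral_cong_AE)
        have "continuous_on UNIV (\<lambda>x. frechet_derivative (\<phi> n) (at x) i)"
          using test_fun_partial[OF \<phi>(1) i] by (auto simp: has_partial_def)
        note [measurable] = continuous_measurable_lebesgue_on[OF this, of \<Omega>]
          has_weak_grad_measurable[OF \<Omega>(1) has_weak_grad_weak_grad[OF w1]] U(2,4) V(2,4)
        show "(\<lambda>x. \<bar>frechet_derivative (\<phi> n) (at x) i - weak_grad \<Omega> (\<lambda>x. max (u x - v x) 0) x \<bullet> i\<bar>) \<in> borel_measurable (lebesgue_on \<Omega>)"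
          by measurable
        show "(\<lambda>x. \<bar>frechet_derivative (\<phi> n) (at x) i - (if u x - v x > 0 then (weak_grad \<Omega> u x - weak_grad \<Omega> v x) \<bullet> i else 0)\<bar>) \<in> borel_measurable (lebesgue_on \<Omega>)"
          unfolding inner_diff_left by measurable
        show "AE x in lebesgue_on \<Omega>. \<bar>frechet_derivative (\<phi> n) (at x) i - weak_grad \<Omega> (\<lambda>x. max (u x - v x) 0) x \<bullet> i\<bar>
          = \<bar>frechet_derivative (\<phi> n) (at x) i - (if u x - v x > 0 then (weak_grad \<Omega> u x - weak_grad \<Omega> v x) \<bullet> i else 0)\<bar>"
          using WE by eventually_elim auto
      qed
      with l[OF i] show "(\<lambda>n. LINT x|lebesgue_on \<Omega>. \<bar>frechet_derivative (\<phi> n) (at x) i - (if u x - v x > 0 then (weak_grad \<Omega> u x - weak_grad \<Omega> v x) \<bullet> i else 0)\<bar>) \<longlonglongrightarrow> 0"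
        by simp
    qed
  qed
qed

lemma sobolev_uminus:
  fixes f :: "'a::euclidean_space \<Rightarrow> real"
  assumes "open \<Omega>" "f \<in> sobolev p \<Omega>"
  shows "(\<lambda>x. - f x) \<in> sobolev p \<Omega>"
proof -
  obtain D where D: "in_Lp p \<Omega> f" "has_weak_grad \<Omega> f D" "in_Lp p \<Omega> D" using assms(2) by (auto simp: sobolev_def)
  have "has_weak_grad \<Omega> (\<lambda>x. 0 - f x) (\<lambda>x. - D x)"
    unfolding has_weak_grad_iff_weak_partial
  proof
    fix i :: 'a assume i: "i \<in> Basis"
    have "weak_partial \<Omega> i (\<lambda>x. 0 - f x) (\<lambda>x. 0 - D x \<bullet> i)"
      using D(2) i by (intro weak_partial_diff[OF assms(1) has_partial_imp_weak_partial[OF assms(1) has_partial_const i]])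
        (auto simp: has_weak_grad_iff_weak_partial)
    then show "weak_partial \<Omega> i (\<lambda>x. 0 - f x) (\<lambda>x. - D x \<bullet> i)" by simp
  qed
  moreover have "in_Lp p \<Omega> (\<lambda>x. - f x)" "in_Lp p \<Omega> (\<lambda>x. - D x)" using D by (auto simp: in_Lp_def)
  ultimately show ?thesis by (auto simp: sobolev_def)
qed

lemma star_field_sobolev:
  fixes F :: "real ^ ('n::finite \<times> 2) \<Rightarrow> real ^ ('n \<times> 2)"
  assumes "open \<Omega>" "F \<in> sobolev_field p \<Omega>" "i \<in> Basis"
  shows "(\<lambda>y. star_field F y \<bullet> i) \<in> sobolev p \<Omega>"
proof -
  obtain k where i: "i = axis k 1" using assms(3) by (auto simp: Basis_vec_real)
  have "axis l (1::real) \<in> Basis" for l :: "'n \<times> 2" unfolding Basis_vec_real by blast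
  then have "(\<lambda>x. F x \<bullet> axis l 1) \<in> sobolev p \<Omega>" for l
    using assms(2) by (simp add: sobolev_field_def)
  then have F: "(\<lambda>x. F x $ l) \<in> sobolev p \<Omega>" for l by (simp add: inner_axis)
  show ?thesis
    using F[of "(fst k, 2)"] sobolev_uminus[OF assms(1) F[of "(fst k, 1)"]]
    by (cases "snd k = 1") (simp_all add: i inner_axis star_field_def)
qed

section \<open>The comparison at a positive level\<close>

text \<open>Stopping at a level \<delta> > 0 leaves the strip where u - v lies between 0 and
  \<delta> free for the auxiliary cut-off \<open>k\<close> to climb to 1.\<close>

lemma diff_le_level:
  fixes \<Omega> :: "(real ^ ('n::finite \<times> 2)) set"
    and F :: "real ^ ('n \<times> 2) \<Rightarrow> real ^ ('n \<times> 2)"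
    and u v :: "real ^ ('n \<times> 2) \<Rightarrow> real"
  assumes \<Omega>: "open \<Omega>" "bounded \<Omega>"
    and F: "F \<in> sobolev_field 2 \<Omega>"
    and div_pos: "AE x in lebesgue_on \<Omega>. weak_div \<Omega> (star_field F) x > 0"
    and u: "u \<in> sobolev 2 \<Omega>" and v: "v \<in> sobolev 2 \<Omega>"
    and ge: "div_N_ge \<Omega> F u v"
    and bd: "le_on_boundary \<Omega> u v"
    and \<delta>: "\<delta> > 0"
  shows "AE x in lebesgue_on \<Omega>. u x - v x \<le> \<delta>"
proof -
  define a where "a x = u x - v x" for x
  define U where "U = weak_grad \<Omega> u"
  define V where "V = weak_grad \<Omega> v"
  define A where "A x = U x - V x" for x
  \<comment> \<open>\<open>h\<close> leaves 0 at \<delta>, exactly where \<open>k\<close> reaches 1;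
    at \<delta> both derivatives are 0. The \<open>- 0\<close> in \<open>k\<close> matches the
    shifted form of the step.\<close>
  define h where "h t = smooth_step (t / \<delta> - 1)" for t
  define h' where "h' t = smooth_step' (t / \<delta> - 1) / \<delta>" for t
  define k where "k t = smooth_step (t / \<delta> - 0)" for t
  define k' where "k' t = smooth_step' (t / \<delta> - 0) / \<delta>" for t
  define B where "B = max 1 (2 / \<delta>)"
  have cut: "cutoff B h h'" and cut2: "cutoff B k k'"
    unfolding B_def h_def[abs_def] h'_def[abs_def] k_def[abs_def] k'_def[abs_def]
    by (rule cutoff_smooth_step[OF \<delta>]; simp)+
  have one: "k t = 1 \<and> k' t = 0" if "h' t \<noteq> 0" for t
  proof -
    have "\<not> t / \<delta> - 1 \<le> 0" using smooth_step_values(2)[of "t / \<delta> - 1"] that by (auto simp: h'_def)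
    then have "1 \<le> t / \<delta> - 0" by simp
    then show ?thesis using smooth_step_values(3,4) by (simp add: k_def k'_def)
  qed
  have Fm: "F \<in> borel_measurable (lebesgue_on \<Omega>)"
  proof (subst borel_measurable_euclidean_space, intro ballI)
    fix i :: "real ^ ('n \<times> 2)" assume "i \<in> Basis"
    then have "(\<lambda>x. F x \<bullet> i) \<in> sobolev 2 \<Omega>" using F by (simp add: sobolev_field_def)
    then show "(\<lambda>x. F x \<bullet> i) \<in> borel_measurable (lebesgue_on \<Omega>)" by (auto simp: sobolev_def in_Lp_def)
  qed
  obtain \<phi> where "vanishing_pos_part \<Omega> (\<lambda>x. u x - v x) (\<lambda>x. weak_grad \<Omega> u x - weak_grad \<Omega> v x) \<phi>"
    by (rule vanishing_pos_part_intro[OF \<Omega> u v bd])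
  then interpret vanishing_pos_part \<Omega> a A \<phi>
    unfolding a_def[abs_def] A_def[abs_def] U_def V_def .
  \<comment> \<open>\<open>p\<close> is the gradient of h(u - v).\<close>
  define p where "p x = h' (a x) *\<^sub>R A x" for x
  have p: "p x \<bullet> i = h' (a x) * (A x \<bullet> i)" for x i by (simp add: p_def)
  have pm: "(\<lambda>x. p x \<bullet> i) \<in> borel_measurable (lebesgue_on \<Omega>)" if "i \<in> Basis" for i
    unfolding p using cutoff_measurable(2)[OF cut] measurable_A[OF that] by simp
  have p2: "integrable (lebesgue_on \<Omega>) (\<lambda>x. (p x \<bullet> i)\<^sup>2)" if "i \<in> Basis" for i
    unfolding p by (rule cutoff_times_square_integrable[OF cut measurable_A[OF that] grad_L2[OF that]])
  define E where "E i x = weak_grad \<Omega> (\<lambda>y. star_field F y \<bullet> i) x \<bullet> i" for i x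
  have SF: "weak_partial \<Omega> i (\<lambda>x. star_field F x \<bullet> i) (E i)"
    "integrable (lebesgue_on \<Omega>) (\<lambda>x. (star_field F x \<bullet> i)\<^sup>2)"
    "(\<lambda>x. star_field F x \<bullet> i) \<in> borel_measurable (lebesgue_on \<Omega>)"
    "integrable (lebesgue_on \<Omega>) (E i)" if i: "i \<in> Basis" for i
  proof -
    note S = sobolev_2_facts[OF \<Omega>(1) star_field_sobolev[OF \<Omega>(1) F i] i]
    show "weak_partial \<Omega> i (\<lambda>x. star_field F x \<bullet> i) (E i)" unfolding E_def[abs_def] by (rule S)
    show "integrable (lebesgue_on \<Omega>) (\<lambda>x. (star_field F x \<bullet> i)\<^sup>2)"
      "(\<lambda>x. star_field F x \<bullet> i) \<in> borel_measurable (lebesgue_on \<Omega>)" by (rule S)+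
    show "integrable (lebesgue_on \<Omega>) (E i)"
      unfolding E_def[abs_def]
      by (rule integrable_square_imp_integrable[OF finite_measure_bounded_open[OF \<Omega>] S(4,5)])
  qed
  have Fp: "integrable (lebesgue_on \<Omega>) (\<lambda>x. (star_field F x \<bullet> i) * (p x \<bullet> i))" if "i \<in> Basis" for i
    by (rule integrable_mult_squares[OF SF(3)[OF that] pm[OF that] SF(2)[OF that] p2[OF that]])
  have hE: "integrable (lebesgue_on \<Omega>) (\<lambda>x. h (a x) * E i x)" if "i \<in> Basis" for i
    by (rule cutoff_times_integrable(1)[OF cut SF(4)[OF that]])
  have wd: "weak_div \<Omega> (star_field F) x = (\<Sum>i\<in>Basis. E i x)" for x
    by (simp add: weak_div_def E_def)
  have hD: "integrable (lebesgue_on \<Omega>) (\<lambda>x. h (a x) * weak_div \<Omega> (star_field F) x)"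
    unfolding wd sum_distrib_left by (intro Bochner_Integration.integrable_sum hE)
  have ei: "star_field F x \<bullet> p x = (\<Sum>i\<in>Basis. (star_field F x \<bullet> i) * (p x \<bullet> i))" for x
    by (rule euclidean_inner)
  have FpI: "integrable (lebesgue_on \<Omega>) (\<lambda>x. star_field F x \<bullet> p x)"
    unfolding ei by (intro Bochner_Integration.integrable_sum Fp)
  have "(\<Sum>i\<in>Basis. LINT x|lebesgue_on \<Omega>. h (a x) * E i x + (star_field F x \<bullet> i) * (p x \<bullet> i)) = 0"
    unfolding p by (intro sum.neutral ballI integral_cutoff_component[OF _ cut] SF)
  then have "(LINT x|lebesgue_on \<Omega>. (\<Sum>i\<in>Basis. h (a x) * E i x + (star_field F x \<bullet> i) * (p x \<bullet> i))) = 0"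
    using hE Fp by (subst Bochner_Integration.integral_sum) auto
  then have "(LINT x|lebesgue_on \<Omega>. h (a x) * weak_div \<Omega> (star_field F) x + star_field F x \<bullet> p x) = 0"
    unfolding wd sum_distrib_left ei sum.distrib .
  then have 1: "(LINT x|lebesgue_on \<Omega>. h (a x) * weak_div \<Omega> (star_field F) x) = - (LINT x|lebesgue_on \<Omega>. star_field F x \<bullet> p x)"
    using hD FpI by simp
  have ax: "axis l (1::real) \<in> Basis" for l :: "'n \<times> 2" unfolding Basis_vec_real by blast
  have Vl: "weak_partial \<Omega> (axis l 1) v (\<lambda>x. V x $ l)" "integrable (lebesgue_on \<Omega>) (\<lambda>x. (V x $ l)\<^sup>2)"
    "(\<lambda>x. V x $ l) \<in> borel_measurable (lebesgue_on \<Omega>)" for l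
    using sobolev_2_facts[OF \<Omega>(1) v ax[of l]] by (simp_all add: V_def inner_axis)
  have Vp: "integrable (lebesgue_on \<Omega>) (\<lambda>x. V x $ l * p x $ m)" for l m
    using integrable_mult_squares[OF Vl(3)[of l] pm[OF ax[of m]] Vl(2)[of l] p2[OF ax[of m]]] by (simp add: inner_axis)
  have cross: "(LINT x|lebesgue_on \<Omega>. V x $ l * p x $ m) = (LINT x|lebesgue_on \<Omega>. V x $ m * p x $ l)" for l m
    using integral_cross[OF ax[of l] ax[of m] cut cut2 one Vl(1)[of l] Vl(1)[of m] Vl(2)[of l] Vl(2)[of m]]
    by (simp add: inner_axis p_def)
  \<comment> \<open>Each coordinate pair contributes a difference of two crossed products of
    components of \<open>V\<close> and \<open>p\<close>, whose integrals are equal. This is the weak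
    form of div \<open>V\<^sup>*\<close> = 0.\<close>
  have 2: "(LINT x|lebesgue_on \<Omega>. star_field V x \<bullet> p x) = 0"
    unfolding star_field_inner using Vp cross by simp
  have VpI: "integrable (lebesgue_on \<Omega>) (\<lambda>x. star_field V x \<bullet> p x)"
    unfolding star_field_inner using Vp by (intro Bochner_Integration.integrable_sum Bochner_Integration.integrable_diff)
  \<comment> \<open>In \<alpha> - \<beta> the field F cancels and leaves \<open>A\<close>, so on {u
    > v} parallelism makes \<open>p\<close> orthogonal to the starred \<beta>; elsewhere
    \<open>p = 0\<close>. The terms in \<open>V\<close> and \<open>F\<close> are kept apart because
    the former integrates to 0 by itself.\<close>
  have "AE x in lebesgue_on \<Omega>. star_field V x \<bullet> p x + star_field F x \<bullet> p x = 0"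
    using normals_agree[OF \<Omega>(1) u v Fm ge bd]
  proof eventually_elim
    case (elim x)
    show ?case
    proof (cases "a x > 0")
      case True
      have "star_field (\<lambda>x. V x + F x) x \<bullet> (U x + F x - (V x + F x)) = 0"
        using elim True by (intro star_field_parallel) (simp add: a_def U_def V_def)
      then have "star_field V x \<bullet> A x + star_field F x \<bullet> A x = 0"
        by (simp add: star_field_add inner_add_left A_def)
      then have "h' (a x) * (star_field V x \<bullet> A x + star_field F x \<bullet> A x) = 0" by simp
      then show ?thesis by (simp add: p_def distrib_left)
    next
      case False
      then show ?thesis using cut by (simp add: p_def cutoff_def)
    qed
  qed
  then have "(LINT x|lebesgue_on \<Omega>. star_field V x \<bullet> p x + star_field F x \<bullet> p x) = 0"
    by (rule integral_eq_zero_AE)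
  then have "(LINT x|lebesgue_on \<Omega>. star_field F x \<bullet> p x) = 0" using 2 VpI FpI by simp
  with 1 have "(LINT x|lebesgue_on \<Omega>. h (a x) * weak_div \<Omega> (star_field F) x) = 0" by simp
  moreover have "AE x in lebesgue_on \<Omega>. 0 \<le> h (a x) * weak_div \<Omega> (star_field F) x"
    using div_pos by eventually_elim (simp add: h_def smooth_step_values(6))
  ultimately have "AE x in lebesgue_on \<Omega>. h (a x) * weak_div \<Omega> (star_field F) x = 0"
    using integral_nonneg_eq_0_iff_AE[OF hD] by simp
  with div_pos show ?thesis
  proof eventually_elim
    case (elim x)
    \<comment> \<open>The positive divergence is divided out; the step is positive for positive
      arguments, so u - v cannot exceed \<delta>, where it starts.\<close>
    then have "h (a x) = 0" by simp
    then have "\<not> a x / \<delta> - 1 > 0" using smooth_step_values(5)[of "a x / \<delta> - 1"] unfolding h_def by linarith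
    then show ?case using \<delta> by (simp add: a_def pos_less_divide_eq)
  qed
qed

theorem theoremC:
  fixes \<Omega> :: "(real ^ ('n::finite \<times> 2)) set"
    and F :: "real ^ ('n \<times> 2) \<Rightarrow> real ^ ('n \<times> 2)"
    and u v :: "real ^ ('n \<times> 2) \<Rightarrow> real"
  assumes "open \<Omega>" and "connected \<Omega>" and "\<Omega> \<noteq> {}" and "bounded \<Omega>"
    and "F \<in> sobolev_field 2 \<Omega>"
    and "AE x in lebesgue_on \<Omega>. weak_div \<Omega> (star_field F) x > 0"
    and "u \<in> sobolev 2 \<Omega>" and "v \<in> sobolev 2 \<Omega>"
    and "div_N_ge \<Omega> F u v"
    and "le_on_boundary \<Omega> u v"
  shows "AE x in lebesgue_on \<Omega>. u x \<le> v x"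
proof -
  \<comment> \<open>Countably many levels tending to 0 suffice, and they keep the union of the
    exceptional sets null.\<close>
  have "AE x in lebesgue_on \<Omega>. u x - v x \<le> inverse (real (Suc n))" for n
    by (rule diff_le_level[OF assms(1,4-10)]) simp
  then have "AE x in lebesgue_on \<Omega>. \<forall>n. u x - v x \<le> inverse (real (Suc n))"
    by (subst AE_all_countable) simp
  then show ?thesis
  proof eventually_elim
    case (elim x)
    have "u x - v x \<le> 0"
      by (rule LIMSEQ_le_const[OF LIMSEQ_inverse_real_of_nat]) (use elim in blast)
    then show ?case by simp
  qed
qed

end
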